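(* Let $\omega>0$, let $\lambda,\mu$ be constants with $\mu>0$, $\lambda+\mu>0$, and let $\mathbb{G}(x,y,\omega)$ be the Green tensor of the two-dimensional Navier equation (defined in the context). Let $D\subset\mathbb{R}^2$ be a rectangular domain, let $\boldsymbol{g}=(g_1,g_2)^\top\in L^2(D)^2$ be a deterministic real vector function, and let $\boldsymbol{h}={\rm diag}(h_1,h_2)$ be a deterministic diagonal matrix function with $h_j\ge 0$, $h_j\in L^p(D)$ for some $p\in(2,\infty]$, and $h_j\in C^{0,\eta}(D)$ (i.e. $\eta$-Hölder continuous) for some $\eta\in(0,1]$, $j=1,2$; the functions $g_j,h_j$ have compact supports contained in $D$. Let $W=(W_1,W_2)^\top$ be a two-dimensional two-parameter Brownian sheet. Let $\Omega\subset\mathbb{R}^2$ be a bounded domain. Then there exists a unique continuous stochastic process $\boldsymbol{u}:\Omega\to\mathbb{C}^2$ satisfying \[ \boldsymbol{u}(x, \omega)=\int_D \mathbb{G}(x, y, \omega)\boldsymbol{g}(y)\,{\rm d}y+\int_D \mathbb{G}(x, y, \omega) \boldsymbol{h} (y)\,{\rm d}W_y\quad a.s. \] (called the mild solution of the stochastic scattering problem $\mu\Delta\boldsymbol{u}+(\lambda+\mu)\nabla\nabla\cdot\boldsymbol{u}+\omega^2\boldsymbol{u}=\boldsymbol{g}+\boldsymbol{h}\dot W_x$ in $\mathbb{R}^2$ with the Kupradze–Sommerfeld radiation condition).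
   Context: $\kappa_{\rm p}=\omega/\sqrt{\lambda+2\mu}$, $\kappa_{\rm s}=\omega/\sqrt{\mu}$, and for $x\ne y$ \[ \mathbb{G}(x,y,\omega)=\frac{\rm i}{4\mu}H_{0}^{(1)}(\kappa_{\rm s}|x-y|)\mathbb{I}+\frac{\rm i}{4\omega^2}\nabla_{x}\nabla_{x}^\top\Bigl[H_{0}^{(1)}(\kappa_{\rm s}|x-y|)-H_{0}^{(1)}(\kappa_{\rm p}|x-y|)\Bigr], \] with $H_0^{(1)}$ the Hankel function of the first kind of order zero. A one-dimensional Brownian sheet on $\mathbb{R}^2_+$ is $W_x=W\{(0,x]\}$ where $W$ is a random set function on Borel sets such that $W(A)\sim\mathcal N(0,|A|)$ and $W(A),W(B)$ are independent with $W(A\cup B)=W(A)+W(B)$ whenever $A\cap B=\emptyset$; it is extended to $\mathbb{R}^2$ using $4$ independent such sheets, one per quadrant ($W_x:=W^{t(x)}_{(|x_1|,|x_2|)}$ with $t(x)=({\rm sgn}\,x_1,{\rm sgn}\,x_2)$). A two-dimensional Brownian sheet $W=(W_1,W_2)^\top$ has independent one-dimensional Brownian sheet components. For a scalar function $\phi$, $\int\phi(x)\,{\rm d}W_x$ is the Wiener integral (defined for smooth compactly supported $\phi$ by $\int W_x\,\partial_{x_1}\partial_{x_2}\phi(x)\,{\rm d}x$ and satisfying $\mathbf{E}\int\phi\,{\rm d}W=0$, $\mathbf{E}|\int\phi\,{\rm d}W|^2=\int|\phi|^2$); for a matrix function $\phi=(\phi_{jk})$ the integral $\int\phi(x)\,{\rm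 d}W(x)$ is the vector whose $j$-th component is $\sum_k\int\phi_{jk}(x)\,{\rm d}W_k(x)$. *)

theory Defs
  imports "HOL-Analysis.Analysis" "HOL-Probability.Probability"
begin

definition bessel_J0 :: "real \<Rightarrow> real" where
  "bessel_J0 z = (\<Sum>k. (-1) ^ k * (z / 2) ^ (2 * k) / (fact k)\<^sup>2)"

definition bessel_Y0 :: "real \<Rightarrow> real" where
  "bessel_Y0 z = (2 / pi) * (ln (z / 2) + euler_mascheroni) * bessel_J0 z
     + (2 / pi) * (\<Sum>k. (-1) ^ k * harm (k + 1) * (z / 2) ^ (2 * (k + 1)) / (fact (k + 1))\<^sup>2)"

definition hankel0 :: "real \<Rightarrow> complex" where
  "hankel0 z = Complex (bessel_J0 z) (bessel_Y0 z)"

definition partial_deriv :: "(real^2 \<Rightarrow> complex) \<Rightarrow> 2 \<Rightarrow> real^2 \<Rightarrow> complex" where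
  "partial_deriv f j x = vector_derivative (\<lambda>t. f (x + t *\<^sub>R axis j 1)) (at 0)"

text \<open>Green tensor G(x,y,om) (meaningful for x \<noteq> y), lam, mu the Lame constants,
  om the frequency; entry (i,j).\<close>
definition green_navier :: "real \<Rightarrow> real \<Rightarrow> real \<Rightarrow> real^2 \<Rightarrow> real^2 \<Rightarrow> complex^2^2" where
  "green_navier lam mu om x y =
    (let ks = om / sqrt mu; kp = om / sqrt (lam + 2 * mu);
         phi = (\<lambda>z. hankel0 (ks * norm (z - y)) - hankel0 (kp * norm (z - y)))
     in \<chi> i j. (if i = j then \<i> / (4 * complex_of_real mu) * hankel0 (ks * norm (x - y)) else 0)
              + \<i> / (4 * complex_of_real (om\<^sup>2)) * partial_deriv (partial_deriv phi j) i x)"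

definition Lp_on :: "ereal \<Rightarrow> (real^2) set \<Rightarrow> (real^2 \<Rightarrow> real) \<Rightarrow> bool" where
  "Lp_on p D f \<longleftrightarrow> set_borel_measurable lebesgue D f \<and>
     (if p = \<infinity> then (\<exists>C. AE x in lebesgue. x \<in> D \<longrightarrow> \<bar>f x\<bar> \<le> C)
      else (\<integral>\<^sup>+x\<in>D. ennreal (\<bar>f x\<bar> powr real_of_ereal p) \<partial>lebesgue) < \<infinity>)"

definition holder_on :: "real \<Rightarrow> (real^2) set \<Rightarrow> (real^2 \<Rightarrow> real) \<Rightarrow> bool" where
  "holder_on \<eta> D f \<longleftrightarrow> (\<exists>C. \<forall>x\<in>D. \<forall>y\<in>D. \<bar>f x - f y\<bar> \<le> C * dist x y powr \<eta>)"

definition compact_support_in :: "(real^2) set \<Rightarrow> (real^2 \<Rightarrow> 'b::zero) \<Rightarrow> bool" where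
  "compact_support_in D f \<longleftrightarrow> (\<exists>K. compact K \<and> K \<subseteq> D \<and> (\<forall>x. x \<notin> K \<longrightarrow> f x = 0))"

fun iter_partial :: "2 list \<Rightarrow> (real^2 \<Rightarrow> complex) \<Rightarrow> real^2 \<Rightarrow> complex" where
  "iter_partial [] f = f"
| "iter_partial (j # js) f = partial_deriv (iter_partial js f) j"

definition smooth_fun :: "(real^2 \<Rightarrow> complex) \<Rightarrow> bool" where
  "smooth_fun f \<longleftrightarrow> (\<forall>js x. iter_partial js f differentiable (at x))"

definition test_fun :: "(real^2 \<Rightarrow> complex) \<Rightarrow> bool" where
  "test_fun f \<longleftrightarrow> smooth_fun f \<and> compact_support_in UNIV f"

definition pos_quadrant :: "(real^2) set" where
  "pos_quadrant = {y. \<forall>i. 0 < y $ i}"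

definition fin_borel_pos :: "(real^2) set set" where
  "fin_borel_pos = {A. A \<in> sets lborel \<and> A \<subseteq> pos_quadrant \<and> emeasure lborel A < \<infinity>}"

definition rect0 :: "real^2 \<Rightarrow> (real^2) set" where
  "rect0 x = {y. \<forall>i. 0 < y $ i \<and> y $ i \<le> x $ i}"

definition white_noise_pos :: "'a measure \<Rightarrow> ((real^2) set \<Rightarrow> 'a \<Rightarrow> real) \<Rightarrow> bool" where
  "white_noise_pos M B \<longleftrightarrow>
    (\<forall>A\<in>fin_borel_pos. B A \<in> borel_measurable M \<and>
        distr M lborel (B A) =
          (if measure lborel A = 0 then return lborel 0
           else density lborel (\<lambda>t. ennreal (normal_density 0 (sqrt (measure lborel A)) t)))) \<and>
    (\<forall>A\<in>fin_borel_pos. \<forall>C\<in>fin_borel_pos. A \<inter> C = {} \<longrightarrow>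
        prob_space.indep_var M borel (B A) borel (B C) \<and>
        (AE \<omega> in M. B (A \<union> C) \<omega> = B A \<omega> + B C \<omega>))"

definition nonneg_quadrant :: "(real^2) set" where
  "nonneg_quadrant = {y. \<forall>i. 0 \<le> y $ i}"

text \<open>A two-dimensional Brownian sheet W = (W_1, W_2) on R^2: W k x is built from
  8 independent one-dimensional sheets x \<mapsto> B (k, q) (0,x] on the positive quadrant,
  one per component k and quadrant q, W_k(x) = B(k,t(x)) (0,|x|]
  (up to modification; quadrant q encoded by the signs (0 \<le> x_1, 0 \<le> x_2));
  moreover W is jointly measurable, so that pathwise integrals make sense.\<close>
definition brownian_sheet2 :: "'a measure \<Rightarrow> (2 \<Rightarrow> real^2 \<Rightarrow> 'a \<Rightarrow> real) \<Rightarrow> bool" where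
  "brownian_sheet2 M W \<longleftrightarrow>
    (\<exists>B :: 2 \<times> bool \<times> bool \<Rightarrow> (real^2) set \<Rightarrow> 'a \<Rightarrow> real.
       (\<forall>i. white_noise_pos M (B i)) \<and>
       prob_space.indep_vars M (\<lambda>_. PiM nonneg_quadrant (\<lambda>_. borel))
          (\<lambda>i \<omega>. restrict (\<lambda>x. B i (rect0 x) \<omega>) nonneg_quadrant) UNIV \<and>
       (\<forall>k x. AE \<omega> in M. W k x \<omega> = B (k, 0 \<le> x $ 1, 0 \<le> x $ 2) (rect0 (\<chi> i. \<bar>x $ i\<bar>)) \<omega>)) \<and>
    (\<forall>k. (\<lambda>(x, \<omega>). W k x \<omega>) \<in> borel_measurable (lborel \<Otimes>\<^sub>M M))"

definition wiener_integral :: "'a measure \<Rightarrow> (real^2 \<Rightarrow> 'a \<Rightarrow> real) \<Rightarrow> (real^2 \<Rightarrow> complex) \<Rightarrow> ('a \<Rightarrow> complex) \<Rightarrow> bool" where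
  "wiener_integral M W phi I \<longleftrightarrow>
     phi \<in> borel_measurable lebesgue \<and> I \<in> borel_measurable M \<and>
     (\<exists>psi. (\<forall>n. test_fun (psi n)) \<and>
        ((\<lambda>n. \<integral>\<^sup>+x. ennreal ((norm (psi n x - phi x))\<^sup>2) \<partial>lebesgue) \<longlonglongrightarrow> 0) \<and>
        ((\<lambda>n. \<integral>\<^sup>+\<omega>. ennreal ((norm ((\<integral>x. W x \<omega> *\<^sub>R partial_deriv (partial_deriv (psi n) 2) 1 x \<partial>lborel) - I \<omega>))\<^sup>2) \<partial>M) \<longlonglongrightarrow> 0))"

definition mild_solution ::
  "'a measure \<Rightarrow> (2 \<Rightarrow> real^2 \<Rightarrow> 'a \<Rightarrow> real) \<Rightarrow> real \<Rightarrow> real \<Rightarrow> real \<Rightarrow> (real^2) set \<Rightarrow>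
   (real^2 \<Rightarrow> real^2) \<Rightarrow> (2 \<Rightarrow> real^2 \<Rightarrow> real) \<Rightarrow> (real^2) set \<Rightarrow> (real^2 \<Rightarrow> 'a \<Rightarrow> complex^2) \<Rightarrow> bool" where
  "mild_solution M W lam mu om D g h \<Omega> u \<longleftrightarrow>
     (\<forall>x\<in>\<Omega>. u x \<in> borel_measurable M) \<and>
     (\<forall>\<omega>\<in>space M. continuous_on \<Omega> (\<lambda>x. u x \<omega>)) \<and>
     (\<forall>x\<in>\<Omega>. \<exists>I :: 2 \<Rightarrow> 2 \<Rightarrow> 'a \<Rightarrow> complex.
        (\<forall>j k. wiener_integral M (W k)
           (\<lambda>y. indicator D y * (green_navier lam mu om x y ** (\<chi> a b. if a = b then complex_of_real (h a y) else 0)) $ j $ k)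
           (I j k)) \<and>
        (AE \<omega> in M. u x \<omega> =
            (LINT y:D|lebesgue. green_navier lam mu om x y *v (\<chi> k. complex_of_real (g y $ k)))
            + (\<chi> j. \<Sum>k\<in>UNIV. I j k \<omega>)))"

end

(*
The Wiener integral is a bounded map from L^2 not only into L^2 of the probability space but also into
L^4: for a test function psi the pairing of W with its mixed second derivative has fourth moment at
most a constant times the fourth power of the L^2 norm of psi. On each quadrant this is Wick's formula
for four values of the sheet, followed by Fubini and the fundamental theorem of calculus; the four
quadrants are added up by convexity. Hence Wiener integrals exist by completeness, are unique, and
inherit the fourth moment bound.

With z = x - y, every entry of the Green tensor is a combination of 1, ln |z| and z_i z_j / |z|^2 with
coefficients that are entire in |z|^2 or polynomial in z. Therefore G(x,.) - G(z,.) is at most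
C |x-z|^(3/4) (|x-y|^(-3/4) + |z-y|^(-3/4)), and the weight is square integrable in y. So the stochastic
part satisfies E |I(x) - I(z)|^4 <= C |x-z|^3, and since 3 exceeds the dimension 2, Kolmogorov's
criterion provides a continuous modification. Second moments alone would just miss this
threshold. Uniqueness follows on a countable dense set and extends by continuity.
*)

theory Submission
  imports Defs "HOL-Computational_Algebra.Polynomial"
begin

section \<open>Lebesgue measure on the plane\<close>

text \<open>Two derivatives of a logarithm behave like |z|^(-2), which is not square integrable in
  the plane. The Green tensor escapes this because the logarithmic part of
  \<open>hankel0 (\<kappa> * r)\<close> has the same leading coefficient \<open>\<i> / pi\<close>
  for every \<kappa>. In the difference of the shear and pressure terms it cancels, the leading
  singularity is r^2 ln r, and two derivatives leave only a logarithm and a bounded angular term.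

  Every Hoelder exponent \<alpha> with 1/2 < \<alpha> < 1 would do in place of 3/4: \<alpha> < 1
  makes |z|^(-2\<alpha>) locally integrable in the plane, and 4\<alpha> > 2 is Kolmogorov's
  condition for fourth moments.

  The sheet is prescribed only almost surely at each single point, and a Wiener integral is a mean
  square limit of pairings with test functions. Hence moments of pairings have to be computed by
  Fubini from moments of the sheet at finitely many points, and kernels with a point singularity
  have to be approximated by test functions in L^2.\<close>

definition vec2 :: "real \<Rightarrow> real \<Rightarrow> real^2" where
  "vec2 s t = (\<chi> i. if i = 1 then s else t)"

lemma vec2_nth [simp]: "vec2 s t $ 1 = s" "vec2 s t $ 2 = t"
  by (simp_all add: vec2_def)

lemma vec2_eta [simp]: "vec2 (x $ 1) (x $ 2) = x"
  by (simp add: vec2_def vec_eq_iff forall_2)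

lemma vec2_eq_axis: "vec2 s t = s *\<^sub>R axis 1 1 + t *\<^sub>R axis 2 1"
  by (simp add: vec2_def vec_eq_iff forall_2 axis_def)

lemma continuous_on_vec2 [continuous_intros]:
  "continuous_on S f \<Longrightarrow> continuous_on S g \<Longrightarrow> continuous_on S (\<lambda>x. vec2 (f x) (g x))"
  unfolding vec2_eq_axis by (intro continuous_intros)

lemma measurable_vec2 [measurable (raw)]:
  "f \<in> borel_measurable M \<Longrightarrow> g \<in> borel_measurable M \<Longrightarrow> (\<lambda>x. vec2 (f x) (g x)) \<in> borel_measurable M"
  unfolding vec2_eq_axis by (intro borel_measurable_add borel_measurable_scaleR borel_measurable_const)

text \<open>Both measures give a box the product of its side lengths, which determines
  \<open>lborel\<close>. This carries the Fubini theorems of product measures over to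
  \<open>real^2\<close>.\<close>

lemma lborel_vec2:
  "(lborel :: (real^2) measure) = distr (lborel \<Otimes>\<^sub>M lborel) borel (\<lambda>(s, t). vec2 s t)"
proof (rule lborel_eqI)
  fix l u :: "real^2"
  assume le: "\<And>b. b \<in> Basis \<Longrightarrow> l \<bullet> b \<le> u \<bullet> b"
  have le12: "l $ 1 \<le> u $ 1" "l $ 2 \<le> u $ 2"
    using le[of "axis 1 1"] le[of "axis 2 1"] by (auto simp: inner_axis axis_in_Basis_iff)
  have "emeasure (distr (lborel \<Otimes>\<^sub>M lborel) borel (\<lambda>(s, t). vec2 s t)) (box l u)
      = emeasure (lborel \<Otimes>\<^sub>M lborel) ((\<lambda>(s, t). vec2 s t) -` box l u \<inter> space (lborel \<Otimes>\<^sub>M lborel))"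
    by (subst emeasure_distr) auto
  also have "(\<lambda>(s, t). vec2 s t) -` box l u \<inter> space (lborel \<Otimes>\<^sub>M lborel)
      = {l $ 1<..<u $ 1} \<times> {l $ 2<..<u $ 2}"
    by (auto simp: space_pair_measure mem_box_cart forall_2)
  also have "emeasure (lborel \<Otimes>\<^sub>M lborel) ({l $ 1<..<u $ 1} \<times> {l $ 2<..<u $ 2})
      = ennreal (u $ 1 - l $ 1) * ennreal (u $ 2 - l $ 2)"
    using le12 by (subst lborel.emeasure_pair_measure_Times) auto
  also have "\<dots> = ennreal (\<Prod>b\<in>Basis. (u - l) \<bullet> b)"
  proof -
    have "(\<Prod>b\<in>Basis. (u - l) \<bullet> b) = (\<Prod>i\<in>UNIV. (u - l) $ i)"
      unfolding Basis_vec_def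
      by (subst prod.UNION_disjoint) (auto simp: axis_eq_axis inner_axis UNION_singleton_eq_range)
    also have "\<dots> = (u $ 1 - l $ 1) * (u $ 2 - l $ 2)"
      by (simp add: UNIV_2)
    finally show ?thesis
      using le12 by (simp add: ennreal_mult'')
  qed
  finally show "emeasure (distr (lborel \<Otimes>\<^sub>M lborel) borel (\<lambda>(s, t). vec2 s t)) (box l u)
      = (\<Prod>b\<in>Basis. (u - l) \<bullet> b)" .
qed auto

lemma nn_integral_vec2:
  fixes f :: "real^2 \<Rightarrow> ennreal"
  assumes [measurable]: "f \<in> borel_measurable borel"
  shows "(\<integral>\<^sup>+x. f x \<partial>lborel) = (\<integral>\<^sup>+s. \<integral>\<^sup>+t. f (vec2 s t) \<partial>lborel \<partial>lborel)"
  by (subst lborel_vec2, subst nn_integral_distr)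
     (auto simp: lborel.nn_integral_fst[symmetric] intro!: nn_integral_cong)

lemma integral_vec2:
  fixes f :: "real^2 \<Rightarrow> 'b::{banach, second_countable_topology}"
  assumes f: "integrable lborel f"
  shows "(\<integral>x. f x \<partial>lborel) = (\<integral>s. \<integral>t. f (vec2 s t) \<partial>lborel \<partial>lborel)"
proof -
  have [measurable]: "f \<in> borel_measurable borel"
    using f by auto
  have "integrable (lborel \<Otimes>\<^sub>M lborel) (\<lambda>p. f (case p of (s, t) \<Rightarrow> vec2 s t))"
    using f by (subst (asm) lborel_vec2, subst (asm) integrable_distr_eq) auto
  then have "(\<integral>p. f (case p of (s, t) \<Rightarrow> vec2 s t) \<partial>(lborel \<Otimes>\<^sub>M lborel))
      = (\<integral>s. \<integral>t. f (vec2 s t) \<partial>lborel \<partial>lborel)"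
    by (subst lborel_pair.integral_fst'[symmetric]) auto
  moreover have "(\<integral>x. f x \<partial>lborel) = (\<integral>p. f (case p of (s, t) \<Rightarrow> vec2 s t) \<partial>(lborel \<Otimes>\<^sub>M lborel))"
    by (subst lborel_vec2, subst integral_distr) auto
  ultimately show ?thesis by simp
qed

lemma emeasure_lborel_vec2:
  assumes [measurable]: "S \<in> sets borel" "T \<in> sets borel"
  shows "emeasure lborel {r::real^2. r $ 1 \<in> S \<and> r $ 2 \<in> T} = emeasure lborel S * emeasure lborel T"
proof -
  have "emeasure lborel {r::real^2. r $ 1 \<in> S \<and> r $ 2 \<in> T}
      = emeasure (lborel \<Otimes>\<^sub>M lborel)
          ((\<lambda>(s, t). vec2 s t) -` {r::real^2. r $ 1 \<in> S \<and> r $ 2 \<in> T} \<inter> space (lborel \<Otimes>\<^sub>M lborel))"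
    by (subst lborel_vec2, subst emeasure_distr) auto
  also have "(\<lambda>(s, t). vec2 s t) -` {r::real^2. r $ 1 \<in> S \<and> r $ 2 \<in> T} \<inter> space (lborel \<Otimes>\<^sub>M lborel)
      = S \<times> T"
    by (auto simp: space_pair_measure)
  finally show ?thesis
    by (simp add: lborel.emeasure_pair_measure_Times)
qed

text \<open>Within distance 1 of \<open>x\<close> the weight is dominated by two one-sided copies of
  \<open>k\<close>, each of integral 4 = 1 / (1 - 3/4); farther away it is at most 1 and contributes
  at most the length of the interval. The bound does not depend on \<open>x\<close>.\<close>

lemma nn_integral_abs_powr_le:
  assumes "a \<le> b"
  shows "(\<integral>\<^sup>+s. indicator {a<..<b} s * ennreal (\<bar>x - s\<bar> powr (-3/4)) \<partial>lborel) \<le> ennreal (8 + (b - a))"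
proof -
  define k :: "real \<Rightarrow> real" where "k r = (if r \<in> {0..1} then r powr (-3/4) else 0)" for r
  have [measurable]: "k \<in> borel_measurable borel"
    unfolding k_def by measurable
  have "(k has_integral 4) UNIV"
    unfolding k_def
    by (subst has_integral_restrict_UNIV) (use has_integral_powr_from_0[of "-3/4" 1] in simp)
  then have k: "(\<integral>\<^sup>+s. ennreal (k s) \<partial>lborel) = 4"
    by (subst nn_integral_has_integral_lborel) (auto simp: k_def)
  have k1: "(\<integral>\<^sup>+s. ennreal (k (s - x)) \<partial>lborel) = 4"
    using k by (subst (asm) nn_integral_real_affine[where c=1 and t="-x"]) (auto simp: algebra_simps)
  have k2: "(\<integral>\<^sup>+s. ennreal (k (x - s)) \<partial>lborel) = 4"
    using k by (subst (asm) nn_integral_real_affine[where c="-1" and t="x"]) (auto simp: algebra_simps)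
  have "(\<integral>\<^sup>+s. indicator {a<..<b} s * ennreal (\<bar>x - s\<bar> powr (-3/4)) \<partial>lborel)
      \<le> (\<integral>\<^sup>+s. (ennreal (k (s - x)) + ennreal (k (x - s))) + indicator {a<..<b} s \<partial>lborel)"
  proof (rule nn_integral_mono)
    fix s
    consider "\<bar>x - s\<bar> \<ge> 1" | "\<bar>x - s\<bar> < 1" "s \<ge> x" | "\<bar>x - s\<bar> < 1" "s < x" by linarith
    then show "indicator {a<..<b} s * ennreal (\<bar>x - s\<bar> powr (-3/4))
        \<le> (ennreal (k (s - x)) + ennreal (k (x - s))) + indicator {a<..<b} s"
    proof cases
      case 1
      have "\<bar>x - s\<bar> powr (-3/4) \<le> 1"
        using 1 powr_mono[of "-3/4" 0 "\<bar>x - s\<bar>"] by (auto split: if_splits)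
      then have "ennreal (\<bar>x - s\<bar> powr (-3/4)) \<le> 1"
        using ennreal_leI by fastforce
      then show ?thesis
        by (auto split: split_indicator intro: add_increasing)
    next
      case 2
      then have "ennreal (k (s - x)) = ennreal (\<bar>x - s\<bar> powr (-3/4))"
        by (auto simp: k_def abs_if)
      then show ?thesis
        by (auto split: split_indicator intro: add_increasing2 simp: add.assoc)
    next
      case 3
      then have "ennreal (k (x - s)) = ennreal (\<bar>x - s\<bar> powr (-3/4))"
        by (auto simp: k_def abs_if)
      then show ?thesis
        by (auto split: split_indicator intro: add_increasing add_increasing2)
    qed
  qed
  also have "\<dots> = 4 + 4 + ennreal (b - a)"
    using assms by (subst nn_integral_add, simp, simp)+ (simp add: k1 k2)
  also have "\<dots> = ennreal (8 + (b - a))"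
    using assms by (simp add: ennreal_plus)
  finally show ?thesis .
qed

text \<open>The norm dominates both coordinates, so |z|^(-3/2) is at most |z_1|^(-3/4) |z_2|^(-3/4)
  and the plane integral splits into two integrals on the line.\<close>

lemma nn_integral_norm_powr_le:
  fixes a b x :: "real^2"
  assumes "a $ 1 \<le> b $ 1" "a $ 2 \<le> b $ 2"
  shows "(\<integral>\<^sup>+y. indicator (box a b) y * ennreal (norm (x - y) powr (-3/2)) \<partial>lborel)
    \<le> ennreal ((8 + (b $ 1 - a $ 1)) * (8 + (b $ 2 - a $ 2)))"
proof -
  have "(\<integral>\<^sup>+y. indicator (box a b) y * ennreal (norm (x - y) powr (-3/2)) \<partial>lborel)
     = (\<integral>\<^sup>+s. \<integral>\<^sup>+t. indicator (box a b) (vec2 s t) * ennreal (norm (x - vec2 s t) powr (-3/2)) \<partial>lborel \<partial>lborel)"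
    by (subst nn_integral_vec2) auto
  also have "\<dots> \<le> (\<integral>\<^sup>+s. \<integral>\<^sup>+t. (indicator {a $ 1<..<b $ 1} s * ennreal (\<bar>x $ 1 - s\<bar> powr (-3/4)))
      * (indicator {a $ 2<..<b $ 2} t * ennreal (\<bar>x $ 2 - t\<bar> powr (-3/4))) \<partial>lborel \<partial>lborel)"
  proof (intro nn_integral_mono_AE)
    \<comment> \<open>The two coordinate lines through \<open>x\<close> are removed because
      \<open>0 powr (-3/4) = 0\<close>: there the product bound fails.\<close>
    have 1: "AE s in lborel. s \<noteq> x $ 1" and 2: "AE t in lborel. t \<noteq> x $ 2"
      by (auto intro!: AE_lborel_singleton)
    show "AE s in lborel. (\<integral>\<^sup>+t. indicator (box a b) (vec2 s t) * ennreal (norm (x - vec2 s t) powr (-3/2)) \<partial>lborel)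
      \<le> (\<integral>\<^sup>+t. (indicator {a $ 1<..<b $ 1} s * ennreal (\<bar>x $ 1 - s\<bar> powr (-3/4)))
      * (indicator {a $ 2<..<b $ 2} t * ennreal (\<bar>x $ 2 - t\<bar> powr (-3/4))) \<partial>lborel)"
      using 1
    proof (eventually_elim, intro nn_integral_mono_AE)
      fix s assume s: "s \<noteq> x $ 1"
      show "AE t in lborel. indicator (box a b) (vec2 s t) * ennreal (norm (x - vec2 s t) powr (-3/2))
        \<le> (indicator {a $ 1<..<b $ 1} s * ennreal (\<bar>x $ 1 - s\<bar> powr (-3/4)))
      * (indicator {a $ 2<..<b $ 2} t * ennreal (\<bar>x $ 2 - t\<bar> powr (-3/4)))"
        using 2
      proof eventually_elim
        fix t assume t: "t \<noteq> x $ 2"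
        have n: "\<bar>x $ 1 - s\<bar> \<le> norm (x - vec2 s t)" "\<bar>x $ 2 - t\<bar> \<le> norm (x - vec2 s t)"
          using component_le_norm_cart[of "x - vec2 s t" 1] component_le_norm_cart[of "x - vec2 s t" 2]
          by auto
        have "norm (x - vec2 s t) powr (-3/2)
            = norm (x - vec2 s t) powr (-3/4) * norm (x - vec2 s t) powr (-3/4)"
          by (simp add: powr_add[symmetric])
        also have "\<dots> \<le> \<bar>x $ 1 - s\<bar> powr (-3/4) * \<bar>x $ 2 - t\<bar> powr (-3/4)"
          using n s t by (intro mult_mono powr_mono2') auto
        finally have "ennreal (norm (x - vec2 s t) powr (-3/2))
            \<le> ennreal (\<bar>x $ 1 - s\<bar> powr (-3/4)) * ennreal (\<bar>x $ 2 - t\<bar> powr (-3/4))"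
          by (simp add: ennreal_mult'[symmetric] ennreal_leI)
        then show "indicator (box a b) (vec2 s t) * ennreal (norm (x - vec2 s t) powr (-3/2))
        \<le> (indicator {a $ 1<..<b $ 1} s * ennreal (\<bar>x $ 1 - s\<bar> powr (-3/4)))
      * (indicator {a $ 2<..<b $ 2} t * ennreal (\<bar>x $ 2 - t\<bar> powr (-3/4)))"
          by (auto split: split_indicator simp: mem_box_cart forall_2)
      qed
    qed
  qed
  also have "\<dots> = (\<integral>\<^sup>+s. indicator {a $ 1<..<b $ 1} s * ennreal (\<bar>x $ 1 - s\<bar> powr (-3/4)) \<partial>lborel)
      * (\<integral>\<^sup>+t. indicator {a $ 2<..<b $ 2} t * ennreal (\<bar>x $ 2 - t\<bar> powr (-3/4)) \<partial>lborel)"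
    by (simp add: nn_integral_cmult nn_integral_multc)
  also have "\<dots> \<le> ennreal (8 + (b $ 1 - a $ 1)) * ennreal (8 + (b $ 2 - a $ 2))"
    by (intro mult_mono nn_integral_abs_powr_le assms) auto
  also have "\<dots> = ennreal ((8 + (b $ 1 - a $ 1)) * (8 + (b $ 2 - a $ 2)))"
    using assms by (simp add: ennreal_mult)
  finally show ?thesis .
qed

section \<open>Fourth moments of white noise\<close>

definition L4 :: "'a measure \<Rightarrow> ('a \<Rightarrow> real) \<Rightarrow> bool" where
  "L4 M f \<longleftrightarrow> f \<in> borel_measurable M \<and> integrable M (\<lambda>x. f x ^ 4)"

text \<open>The inequality |xy| \<le> x^2 + y^2 applied twice. It makes every product of four
  functions with finite fourth moment integrable.\<close>

lemma abs_prod4_le: "\<bar>a * b * c * d\<bar> \<le> a ^ 4 + b ^ 4 + c ^ 4 + (d::real) ^ 4"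
proof -
  have sq: "\<bar>x * y\<bar> \<le> x\<^sup>2 + y\<^sup>2" for x y :: real
  proof -
    have "2 * (\<bar>x\<bar> * \<bar>y\<bar>) \<le> x\<^sup>2 + y\<^sup>2"
      using sum_squares_bound[of "\<bar>x\<bar>" "\<bar>y\<bar>"] by (simp add: mult.assoc)
    moreover have "0 \<le> \<bar>x\<bar> * \<bar>y\<bar>" by simp
    ultimately show ?thesis by (simp only: abs_mult)
  qed
  have "\<bar>a * b * c * d\<bar> = \<bar>(a * b) * (c * d)\<bar>"
    by (simp add: mult.assoc)
  also have "\<dots> \<le> (a * b)\<^sup>2 + (c * d)\<^sup>2"
    by (rule sq)
  also have "\<dots> = \<bar>a\<^sup>2 * b\<^sup>2\<bar> + \<bar>c\<^sup>2 * d\<^sup>2\<bar>"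
    by (simp add: power_mult_distrib)
  also have "\<dots> \<le> ((a\<^sup>2)\<^sup>2 + (b\<^sup>2)\<^sup>2) + ((c\<^sup>2)\<^sup>2 + (d\<^sup>2)\<^sup>2)"
    by (intro add_mono sq)
  finally show ?thesis by (simp add: algebra_simps)
qed

lemma L4_integrable_prod:
  assumes "L4 M a" "L4 M b" "L4 M c" "L4 M d"
  shows "integrable M (\<lambda>x. a x * b x * c x * d x)"
proof (rule Bochner_Integration.integrable_bound)
  show "integrable M (\<lambda>x. a x ^ 4 + b x ^ 4 + c x ^ 4 + d x ^ 4)"
    using assms by (auto simp: L4_def)
  show "(\<lambda>x. a x * b x * c x * d x) \<in> borel_measurable M"
    using assms by (auto simp: L4_def)
  show "AE x in M. norm (a x * b x * c x * d x) \<le> norm (a x ^ 4 + b x ^ 4 + c x ^ 4 + d x ^ 4)"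
    by (intro AE_I2) (use abs_prod4_le in \<open>auto intro: order_trans\<close>)
qed

lemma L4_bound:
  assumes "L4 M g" "f \<in> borel_measurable M" "AE x in M. \<bar>f x\<bar> \<le> \<bar>g x\<bar>"
  shows "L4 M f"
  unfolding L4_def
proof
  show "integrable M (\<lambda>x. f x ^ 4)"
  proof (rule Bochner_Integration.integrable_bound)
    show "integrable M (\<lambda>x. g x ^ 4)" using assms by (simp add: L4_def)
    show "AE x in M. norm (f x ^ 4) \<le> norm (g x ^ 4)"
      using assms(3)
    proof eventually_elim
      case (elim x)
      then show ?case using power_mono[of "\<bar>f x\<bar>" "\<bar>g x\<bar>" 4] by simp
    qed
  qed (use assms in auto)
qed (fact assms)

lemma power4_add_le: "((a::real) + b) ^ 4 \<le> 8 * (a ^ 4 + b ^ 4)"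
proof -
  have sq: "(x + y)\<^sup>2 \<le> 2 * (x\<^sup>2 + y\<^sup>2)" for x y :: real
    using sum_squares_bound[of x y] by (simp add: power2_sum)
  have "(a + b) ^ 4 = ((a + b)\<^sup>2)\<^sup>2" by simp
  also have "\<dots> \<le> (2 * (a\<^sup>2 + b\<^sup>2))\<^sup>2"
    by (intro power_mono sq) auto
  also have "\<dots> = 4 * (a\<^sup>2 + b\<^sup>2)\<^sup>2"
    by (simp add: power2_eq_square algebra_simps)
  also have "\<dots> \<le> 4 * (2 * ((a\<^sup>2)\<^sup>2 + (b\<^sup>2)\<^sup>2))"
    by (intro mult_left_mono sq) auto
  finally show ?thesis by simp
qed

lemma (in finite_measure) L4_const: "L4 M (\<lambda>_. c)"
  by (simp add: L4_def)

locale pos_white_noise = prob_space M for M :: "'a measure" +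
  fixes B :: "(real^2) set \<Rightarrow> 'a \<Rightarrow> real"
  assumes noise: "white_noise_pos M B"
begin

abbreviation vol :: "(real^2) set \<Rightarrow> real" where "vol \<equiv> measure lborel"

lemma fin_Un: "A \<in> fin_borel_pos \<Longrightarrow> C \<in> fin_borel_pos \<Longrightarrow> A \<union> C \<in> fin_borel_pos"
  unfolding fin_borel_pos_def using emeasure_subadditive[of A lborel C]
  by (auto simp: less_top[symmetric] top_unique)

lemma fin_subset: "A \<in> fin_borel_pos \<Longrightarrow> C \<in> sets borel \<Longrightarrow> C \<subseteq> A \<Longrightarrow> C \<in> fin_borel_pos"
  unfolding fin_borel_pos_def using emeasure_mono[of C A lborel] by auto

lemma vol_Un:
  "A \<in> fin_borel_pos \<Longrightarrow> C \<in> fin_borel_pos \<Longrightarrow> A \<inter> C = {} \<Longrightarrow> vol (A \<union> C) = vol A + vol C"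
  by (rule measure_Union) (auto simp: fin_borel_pos_def)

lemma B_measurable: "A \<in> fin_borel_pos \<Longrightarrow> B A \<in> borel_measurable M"
  using noise by (simp add: white_noise_pos_def)

lemma B_moments:
  assumes A: "A \<in> fin_borel_pos"
  shows B_L4: "L4 M (B A)"
    and B_square: "expectation (\<lambda>x. B A x ^ 2) = vol A"
    and B_cube: "expectation (\<lambda>x. B A x ^ 3) = 0"
    and B_fourth: "expectation (\<lambda>x. B A x ^ 4) = 3 * vol A ^ 2"
proof -
  note [measurable] = B_measurable[OF A]
  have "integrable M (\<lambda>x. B A x ^ 4) \<and> expectation (\<lambda>x. B A x ^ 2) = vol A
      \<and> expectation (\<lambda>x. B A x ^ 3) = 0 \<and> expectation (\<lambda>x. B A x ^ 4) = 3 * vol A ^ 2"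
  proof (cases "vol A = 0")
    case True
    then have D: "distr M lborel (B A) = return lborel 0"
      using noise A by (simp add: white_noise_pos_def)
    have "AE t in distr M lborel (B A). t = 0"
      unfolding D by (subst AE_return) auto
    then have ae: "AE x in M. B A x = 0"
      by (subst (asm) AE_distr_iff) auto
    have "integrable M (\<lambda>x. B A x ^ n) \<and> expectation (\<lambda>x. B A x ^ n) = 0" if "n > 0" for n
    proof -
      have ae': "AE x in M. B A x ^ n = 0" using ae by eventually_elim (use that in simp)
      have "integrable M (\<lambda>x. B A x ^ n) \<longleftrightarrow> integrable M (\<lambda>x. 0::real)"
        using ae' by (intro integrable_cong_AE) auto
      moreover have "expectation (\<lambda>x. B A x ^ n) = expectation (\<lambda>x. 0)"
        using ae' by (intro integral_cong_AE) auto
      ultimately show ?thesis by simp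
    qed
    from this[of 2] this[of 3] this[of 4] True show ?thesis by simp
  next
    case False
    then have pos: "vol A > 0"
      by (simp add: measure_nonneg order_less_le)
    let ?s = "sqrt (vol A)"
    have D: "distr M lborel (B A) = density lborel (\<lambda>t. ennreal (normal_density 0 ?s t))"
      using noise A False by (simp add: white_noise_pos_def)
    have eq: "expectation (\<lambda>x. B A x ^ n) = (\<integral>t. normal_density 0 ?s t * t ^ n \<partial>lborel)" for n
    proof -
      have "expectation (\<lambda>x. B A x ^ n) = (\<integral>t. t ^ n \<partial>distr M lborel (B A))"
        by (subst integral_distr) auto
      also have "\<dots> = (\<integral>t. normal_density 0 ?s t * t ^ n \<partial>lborel)"
        unfolding D by (subst integral_density) auto
      finally show ?thesis .
    qed
    have "integrable M (\<lambda>x. B A x ^ n) \<longleftrightarrow> integrable (distr M lborel (B A)) (\<lambda>t. t ^ n)" for n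
      by (subst integrable_distr_eq) auto
    then have int: "integrable M (\<lambda>x. B A x ^ n)" for n
      unfolding D using integrable_normal_moment[of ?s 0 n] pos
      by (subst (asm) integrable_density) auto
    have m: "(\<integral>t. normal_density 0 ?s t * t ^ 3 \<partial>lborel) = 0"
      "(\<integral>t. normal_density 0 ?s t * t ^ 2 \<partial>lborel) = vol A"
      "(\<integral>t. normal_density 0 ?s t * t ^ 4 \<partial>lborel) = 3 * vol A ^ 2"
      using pos integral_normal_moment_odd[of ?s 0 1]
        integral_normal_moment_even[of ?s 0 1] integral_normal_moment_even[of ?s 0 2]
      by (simp_all add: fact_numeral power2_eq_square)
    show ?thesis
      using int[of 4] eq[of 2] eq[of 3] eq[of 4] unfolding m by (simp del: integral_mult_right_zero)
  qed
  then show "L4 M (B A)" "expectation (\<lambda>x. B A x ^ 2) = vol A"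
    "expectation (\<lambda>x. B A x ^ 3) = 0" "expectation (\<lambda>x. B A x ^ 4) = 3 * vol A ^ 2"
    by (auto simp: L4_def)
qed

lemma L4_power_integrable:
  assumes "L4 M f" "n \<le> 4"
  shows "integrable M (\<lambda>x. f x ^ n)"
proof -
  consider "n = 0" | "n = 1" | "n = 2" | "n = 3" | "n = 4" using assms(2) by linarith
  then show ?thesis
  proof cases
    case 2 then show ?thesis
      using L4_integrable_prod[OF assms(1) L4_const L4_const L4_const, of 1 1 1] by simp
  next
    case 3 then show ?thesis
      using L4_integrable_prod[OF assms(1) assms(1) L4_const L4_const, of 1 1] by (simp add: power2_eq_square)
  next
    case 4 then show ?thesis
      using L4_integrable_prod[OF assms(1) assms(1) assms(1) L4_const, of 1] by (simp add: power3_eq_cube)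
  qed (use assms in \<open>auto simp: L4_def\<close>)
qed

lemma B_indep:
  assumes A: "A \<in> fin_borel_pos" and C: "C \<in> fin_borel_pos" and AC: "A \<inter> C = {}"
    and "m \<le> 4" "n \<le> 4"
  shows "expectation (\<lambda>x. B A x ^ m * B C x ^ n)
    = expectation (\<lambda>x. B A x ^ m) * expectation (\<lambda>x. B C x ^ n)"
proof -
  have "indep_var borel (B A) borel (B C)"
    using noise A C AC by (auto simp: white_noise_pos_def)
  then have "indep_var borel ((\<lambda>t. t ^ m) \<circ> B A) borel ((\<lambda>t. t ^ n) \<circ> B C)"
    by (rule indep_var_compose) auto
  then show ?thesis
    using indep_var_lebesgue_integral[of "\<lambda>x. B A x ^ m" "\<lambda>x. B C x ^ n"]
      L4_power_integrable[OF B_L4[OF A] \<open>m \<le> 4\<close>] L4_power_integrable[OF B_L4[OF C] \<open>n \<le> 4\<close>]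
    by (simp add: comp_def)
qed

lemma B_Un: "A \<in> fin_borel_pos \<Longrightarrow> C \<in> fin_borel_pos \<Longrightarrow> A \<inter> C = {} \<Longrightarrow>
    AE x in M. B (A \<union> C) x = B A x + B C x"
  using noise by (auto simp: white_noise_pos_def)

lemma B_22: "A \<in> fin_borel_pos \<Longrightarrow> C \<in> fin_borel_pos \<Longrightarrow> A \<inter> C = {} \<Longrightarrow>
    expectation (\<lambda>x. B A x ^ 2 * B C x ^ 2) = vol A * vol C"
  by (simp add: B_indep B_square)

lemma B_31: "A \<in> fin_borel_pos \<Longrightarrow> C \<in> fin_borel_pos \<Longrightarrow> A \<inter> C = {} \<Longrightarrow>
    expectation (\<lambda>x. B A x ^ 3 * B C x) = 0"
  using B_indep[of A C 3 1] by (simp add: B_cube)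

end

section \<open>Wick's formula for the noise of four sets\<close>

lemma sum_mult4:
  fixes a b c d :: "'i \<Rightarrow> real"
  shows "(\<Sum>s\<in>I. a s) * (\<Sum>t\<in>I. b t) * (\<Sum>u\<in>I. c u) * (\<Sum>w\<in>I. d w)
    = (\<Sum>s\<in>I. \<Sum>t\<in>I. \<Sum>u\<in>I. \<Sum>w\<in>I. a s * b t * c u * d w)"
  by (simp only: sum_distrib_left[symmetric] sum_distrib_right[symmetric])

text \<open>Each summand carries the Kronecker deltas of one of the three pairings of four indices,
  and these collapse the fourfold sum to a product of two single sums.\<close>

lemma sum_pairings:
  fixes a b c d v :: "'i::finite \<Rightarrow> real"
  shows "(\<Sum>s\<in>UNIV. \<Sum>t\<in>UNIV. \<Sum>u\<in>UNIV. \<Sum>w\<in>UNIV. a s * b t * c u * d w *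
      (of_bool (s = t) * of_bool (u = w) * (v s * v u)
       + of_bool (s = u) * of_bool (t = w) * (v s * v t)
       + of_bool (s = w) * of_bool (t = u) * (v s * v t)))
    = (\<Sum>s\<in>UNIV. a s * b s * v s) * (\<Sum>s\<in>UNIV. c s * d s * v s)
    + (\<Sum>s\<in>UNIV. a s * c s * v s) * (\<Sum>s\<in>UNIV. b s * d s * v s)
    + (\<Sum>s\<in>UNIV. a s * d s * v s) * (\<Sum>s\<in>UNIV. b s * c s * v s)"
proof -
  have d: "(\<Sum>t\<in>UNIV. of_bool (s = t) * f t) = f s" "(\<Sum>t\<in>UNIV. of_bool (t = s) * f t) = f s" for s and f :: "'i \<Rightarrow> real"
    by (simp_all add: of_bool_def if_distrib[of "\<lambda>x. x * _"] cong: if_cong)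
  have 1: "(\<Sum>s\<in>UNIV. \<Sum>t\<in>UNIV. \<Sum>u\<in>UNIV. \<Sum>w\<in>UNIV. of_bool (s = t) * (of_bool (u = w) * (a s * b t * c u * d w * (v s * v u))))
    = (\<Sum>s\<in>UNIV. a s * b s * v s) * (\<Sum>s\<in>UNIV. c s * d s * v s)"
    unfolding d sum_distrib_left[symmetric] by (simp add: sum_product mult_ac)
  have 2: "(\<Sum>s\<in>UNIV. \<Sum>t\<in>UNIV. \<Sum>u\<in>UNIV. \<Sum>w\<in>UNIV. of_bool (s = u) * (of_bool (t = w) * (a s * b t * c u * d w * (v s * v t))))
    = (\<Sum>s\<in>UNIV. a s * c s * v s) * (\<Sum>s\<in>UNIV. b s * d s * v s)"
    unfolding d sum_distrib_left[symmetric] by (simp add: sum_product mult_ac)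
  have 3: "(\<Sum>s\<in>UNIV. \<Sum>t\<in>UNIV. \<Sum>u\<in>UNIV. \<Sum>w\<in>UNIV. of_bool (s = w) * (of_bool (t = u) * (a s * b t * c u * d w * (v s * v t))))
    = (\<Sum>s\<in>UNIV. a s * d s * v s) * (\<Sum>s\<in>UNIV. b s * c s * v s)"
    unfolding d by (simp add: sum_product mult_ac)
  have "(\<Sum>s\<in>UNIV. \<Sum>t\<in>UNIV. \<Sum>u\<in>UNIV. \<Sum>w\<in>UNIV. a s * b t * c u * d w *
      (of_bool (s = t) * of_bool (u = w) * (v s * v u)
       + of_bool (s = u) * of_bool (t = w) * (v s * v t)
       + of_bool (s = w) * of_bool (t = u) * (v s * v t)))
     = (\<Sum>s\<in>UNIV. \<Sum>t\<in>UNIV. \<Sum>u\<in>UNIV. \<Sum>w\<in>UNIV. of_bool (s = t) * (of_bool (u = w) * (a s * b t * c u * d w * (v s * v u)))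
      + of_bool (s = u) * (of_bool (t = w) * (a s * b t * c u * d w * (v s * v t)))
      + of_bool (s = w) * (of_bool (t = u) * (a s * b t * c u * d w * (v s * v t))))"
    by (intro sum.cong refl) (simp only: distrib_left mult_ac)
  then show ?thesis
    by (simp only: sum.distrib 1 2 3)
qed

context pos_white_noise begin

text \<open>Only pairwise independence is assumed, but applied to unions of disjoint sets it determines
  all mixed moments of order four.\<close>

lemma B_211:
  assumes A: "A \<in> fin_borel_pos" and C: "C \<in> fin_borel_pos" and D: "D \<in> fin_borel_pos"
    and disj: "A \<inter> C = {}" "A \<inter> D = {}" "C \<inter> D = {}"
  shows "expectation (\<lambda>x. B A x ^ 2 * B C x * B D x) = 0"
proof -
  note [measurable] = B_measurable[OF A] B_measurable[OF C] B_measurable[OF D]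
    B_measurable[OF fin_Un[OF C D]]
  note L = B_L4[OF A] B_L4[OF C] B_L4[OF D]
  have [simp]: "integrable M (\<lambda>x. B A x ^ 2 * B C x ^ 2)" "integrable M (\<lambda>x. B A x ^ 2 * B D x ^ 2)"
    "integrable M (\<lambda>x. B A x ^ 2 * B C x * B D x)"
    using L4_integrable_prod[OF L(1) L(1) L(2) L(2)] L4_integrable_prod[OF L(1) L(1) L(3) L(3)]
      L4_integrable_prod[OF L(1) L(1) L(2) L(3)] by (simp_all add: power2_eq_square mult.assoc)
  \<comment> \<open>Independence of \<open>A\<close> and \<open>C \<union> D\<close> gives the value
    directly; expanding by additivity gives the same value plus twice the wanted moment, which is
    therefore zero.\<close>
  have "vol A * (vol C + vol D) = expectation (\<lambda>x. B A x ^ 2 * B (C \<union> D) x ^ 2)"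
    using disj B_22[OF A fin_Un[OF C D]] vol_Un[OF C D] by (simp add: Int_Un_distrib)
  also have "\<dots> = expectation (\<lambda>x. B A x ^ 2 * B C x ^ 2 + B A x ^ 2 * B D x ^ 2
      + 2 * (B A x ^ 2 * B C x * B D x))"
    by (rule integral_cong_AE) (use B_Un[OF C D disj(3)] in \<open>auto simp: power2_sum algebra_simps\<close>)
  also have "\<dots> = expectation (\<lambda>x. B A x ^ 2 * B C x ^ 2) + expectation (\<lambda>x. B A x ^ 2 * B D x ^ 2)
      + 2 * expectation (\<lambda>x. B A x ^ 2 * B C x * B D x)"
    by (simp del: mult.assoc)
  also have "\<dots> = vol A * (vol C + vol D) + 2 * expectation (\<lambda>x. B A x ^ 2 * B C x * B D x)"
    using A C D disj by (simp add: B_22 algebra_simps)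
  finally show ?thesis by simp
qed

lemma B_1111:
  assumes A: "A \<in> fin_borel_pos" and C: "C \<in> fin_borel_pos" and D: "D \<in> fin_borel_pos"
    and F: "F \<in> fin_borel_pos"
    and disj: "A \<inter> C = {}" "A \<inter> D = {}" "C \<inter> D = {}" "A \<inter> F = {}" "C \<inter> F = {}" "D \<inter> F = {}"
  shows "expectation (\<lambda>x. B A x * B C x * B D x * B F x) = 0"
proof -
  note [measurable] = B_measurable[OF A] B_measurable[OF C] B_measurable[OF D] B_measurable[OF F]
    B_measurable[OF fin_Un[OF A C]] B_measurable[OF fin_Un[OF D F]]
  note L = B_L4[OF A] B_L4[OF C] B_L4[OF D] B_L4[OF F]
  have disj': "D \<inter> A = {}" "D \<inter> C = {}" "F \<inter> A = {}" "F \<inter> C = {}" "(A \<union> C) \<inter> F = {}" "(A \<union> C) \<inter> D = {}"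
    "D \<inter> (A \<union> C) = {}" "F \<inter> (A \<union> C) = {}"
    using disj by auto
  have [simp]: "integrable M (\<lambda>x. B D x ^ 2 * B (A \<union> C) x ^ 2)" "integrable M (\<lambda>x. B F x ^ 2 * B (A \<union> C) x ^ 2)"
    "integrable M (\<lambda>x. B A x ^ 2 * B D x * B F x)" "integrable M (\<lambda>x. B C x ^ 2 * B D x * B F x)"
    "integrable M (\<lambda>x. B A x * B C x * B D x * B F x)"
    using L4_integrable_prod[OF L(3) L(3) B_L4[OF fin_Un[OF A C]] B_L4[OF fin_Un[OF A C]]]
      L4_integrable_prod[OF L(4) L(4) B_L4[OF fin_Un[OF A C]] B_L4[OF fin_Un[OF A C]]]
      L4_integrable_prod[OF L(1) L(1) L(3) L(4)] L4_integrable_prod[OF L(2) L(2) L(3) L(4)]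
      L4_integrable_prod[OF L(1) L(2) L(3) L(4)] by (simp_all add: power2_eq_square mult.assoc)
  \<comment> \<open>The same comparison with a union in both squares: all mixed terms except the one
    with four distinct sets are already known.\<close>
  have "vol (A \<union> C) * (vol D + vol F) = expectation (\<lambda>x. B (A \<union> C) x ^ 2 * B (D \<union> F) x ^ 2)"
    using disj' B_22[OF fin_Un[OF A C] fin_Un[OF D F]] vol_Un[OF D F] disj by (simp add: Int_Un_distrib)
  also have "\<dots> = expectation (\<lambda>x. B D x ^ 2 * B (A \<union> C) x ^ 2 + B F x ^ 2 * B (A \<union> C) x ^ 2
      + 2 * (B A x ^ 2 * B D x * B F x) + 2 * (B C x ^ 2 * B D x * B F x)
      + 4 * (B A x * B C x * B D x * B F x))"
  proof (rule integral_cong_AE)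
    show "AE x in M. B (A \<union> C) x ^ 2 * B (D \<union> F) x ^ 2 = B D x ^ 2 * B (A \<union> C) x ^ 2
      + B F x ^ 2 * B (A \<union> C) x ^ 2 + 2 * (B A x ^ 2 * B D x * B F x) + 2 * (B C x ^ 2 * B D x * B F x)
      + 4 * (B A x * B C x * B D x * B F x)"
      using B_Un[OF A C disj(1)] B_Un[OF D F disj(6)]
      by eventually_elim (simp add: power2_eq_square algebra_simps)
  qed auto
  also have "\<dots> = expectation (\<lambda>x. B D x ^ 2 * B (A \<union> C) x ^ 2) + expectation (\<lambda>x. B F x ^ 2 * B (A \<union> C) x ^ 2)
      + 2 * expectation (\<lambda>x. B A x ^ 2 * B D x * B F x) + 2 * expectation (\<lambda>x. B C x ^ 2 * B D x * B F x)
      + 4 * expectation (\<lambda>x. B A x * B C x * B D x * B F x)"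
    by simp
  also have "\<dots> = vol (A \<union> C) * (vol D + vol F) + 4 * expectation (\<lambda>x. B A x * B C x * B D x * B F x)"
    using B_22[OF D fin_Un[OF A C] disj'(7)] B_22[OF F fin_Un[OF A C] disj'(8)]
      B_211[OF A D F] B_211[OF C D F] disj by (simp add: algebra_simps)
  finally show ?thesis by simp
qed

text \<open>Up to transpositions of neighbouring factors, four indices coincide in one of the
  patterns iiii, iijj, iiij, iijk, ijkl. The first two give 3 v^2 and a product of volumes, the
  others vanish.\<close>

lemma B_wick_disjoint:
  fixes P :: "'i \<Rightarrow> (real^2) set"
  assumes P: "\<And>i. P i \<in> fin_borel_pos" and disj: "\<And>i j. i \<noteq> j \<Longrightarrow> P i \<inter> P j = {}"
  shows "expectation (\<lambda>x. B (P i) x * B (P j) x * B (P k) x * B (P l) x)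
    = of_bool (i = j) * of_bool (k = l) * (vol (P i) * vol (P k))
      + of_bool (i = k) * of_bool (j = l) * (vol (P i) * vol (P j))
      + of_bool (i = l) * of_bool (j = k) * (vol (P i) * vol (P j))"
proof -
  define e where "e i j k l = expectation (\<lambda>x. B (P i) x * B (P j) x * B (P k) x * B (P l) x)" for i j k l
  have s1: "e i j k l = e j i k l" and s2: "e i j k l = e i k j l" and s3: "e i j k l = e i j l k" for i j k l
    by (simp_all add: e_def mult.commute mult.left_commute mult.assoc)
  have q4: "e i i i i = 3 * vol (P i) ^ 2" for i
    using B_fourth[OF P, of i] by (simp add: e_def power4_eq_xxxx)
  have q22: "e i i j j = vol (P i) * vol (P j)" if "i \<noteq> j" for i j
    using B_22[OF P P disj[OF that]] by (simp add: e_def power2_eq_square mult.assoc)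
  have q31: "e i i i j = 0" if "i \<noteq> j" for i j
    using B_31[OF P P disj[OF that]] by (simp add: e_def power3_eq_cube)
  have q211: "e i i j k = 0" if "i \<noteq> j" "i \<noteq> k" "j \<noteq> k" for i j k
    using B_211[OF P P P disj disj disj, of i j k] that by (simp add: e_def power2_eq_square)
  have q1111: "e i j k l = 0" if "i \<noteq> j" "i \<noteq> k" "j \<noteq> k" "i \<noteq> l" "j \<noteq> l" "k \<noteq> l" for i j k l
    using B_1111[OF P P P P disj disj disj disj disj disj, of i j k l] that by (simp add: e_def)
  have "e i j k l = of_bool (i = j) * of_bool (k = l) * (vol (P i) * vol (P k))
      + of_bool (i = k) * of_bool (j = l) * (vol (P i) * vol (P j))
      + of_bool (i = l) * of_bool (j = k) * (vol (P i) * vol (P j))"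
  proof (cases "i = j")
    case ij: True
    consider (1) "k = l" "i = k" | (2) "k = l" "i \<noteq> k" | (3) "k \<noteq> l" "i = k" | (4) "k \<noteq> l" "i = l"
      | (5) "k \<noteq> l" "i \<noteq> k" "i \<noteq> l"
      by blast
    then show ?thesis
    proof cases
      case 1
      then have "e i j k l = 3 * vol (P i) ^ 2"
        using ij q4[of i] by metis
      then show ?thesis using 1 ij by (simp add: power2_eq_square)
    next
      case 2
      then have "e i j k l = vol (P i) * vol (P k)"
        using ij q22[of i k] by metis
      then show ?thesis using 2 ij by (simp add: power2_eq_square)
    next
      case 3
      then have "e i j k l = 0"
        using ij q31[of i l] by metis
      then show ?thesis using 3 ij by (simp add: power2_eq_square)
    next
      case 4
      then have "e i j k l = 0"
        using ij q31[of i k] s3[of i i i k] by metis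
      then show ?thesis using 4 ij by (simp add: power2_eq_square)
    next
      case 5
      then have "e i j k l = 0"
        using ij q211[of i k l] by metis
      then show ?thesis using 5 ij by (simp add: power2_eq_square)
    qed
  next
    case ij: False
    consider (1) "i = k" "j = l" | (2) "i = k" "l = i" | (3) "i = k" "j \<noteq> l" "l \<noteq> i"
      | (4) "i \<noteq> k" "i = l" "j = k" | (5) "i \<noteq> k" "i = l" "j \<noteq> k"
      | (6) "i \<noteq> k" "i \<noteq> l" "j = k" "j = l" | (7) "i \<noteq> k" "i \<noteq> l" "j = k" "j \<noteq> l"
      | (8) "i \<noteq> k" "i \<noteq> l" "j \<noteq> k" "j = l" | (9) "i \<noteq> k" "i \<noteq> l" "j \<noteq> k" "j \<noteq> l" "k = l"
      | (10) "i \<noteq> k" "i \<noteq> l" "j \<noteq> k" "j \<noteq> l" "k \<noteq> l"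
      by blast
    then show ?thesis
    proof cases
      case 1
      then have "e i j k l = vol (P i) * vol (P j)"
        using ij q22[of i j] s2[of i i j j] by metis
      then show ?thesis using 1 ij by (simp add: power2_eq_square)
    next
      case 2
      then have "e i j k l = 0"
        using ij q31[of i j] s2[of i i j i] s3[of i i i j] by metis
      then show ?thesis using 2 ij by (simp add: power2_eq_square)
    next
      case 3
      then have "e i j k l = 0"
        using ij q211[of i j l] s2[of i i j l] by metis
      then show ?thesis using 3 ij by (simp add: power2_eq_square)
    next
      case 4
      then have "e i j k l = vol (P i) * vol (P j)"
        using ij q22[of i j] s2[of i i j j] s3[of i j i j] by metis
      then show ?thesis using 4 ij by (simp add: power2_eq_square)
    next
      case 5
      then have "e i j k l = 0"
        using ij q211[of i j k] s2[of i i j k] s3[of i j i k] by metis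
      then show ?thesis using 5 ij by (simp add: power2_eq_square)
    next
      case 6
      then have "e i j k l = 0"
        using ij q31[of j i] s1[of i j j j] s2[of j i j j] s3[of j j i j] by metis
      then show ?thesis using 6 ij by (simp add: power2_eq_square)
    next
      case 7
      then have "e i j k l = 0"
        using ij q211[of j i l] s1[of i j j l] s2[of j i j l] by metis
      then show ?thesis using 7 ij by (simp add: power2_eq_square)
    next
      case 8
      then have "e i j k l = 0"
        using ij q211[of j i k] s1[of i j k j] s3[of j i k j] s2[of j i j k] by metis
      then show ?thesis using 8 ij by (simp add: power2_eq_square)
    next
      case 9
      then have "e i j k l = 0"
        using ij q211[of k i j] s2[of i j k k] s1[of i k j k] s3[of k i j k] s2[of k i k j] by metis
      then show ?thesis using 9 ij by (simp add: power2_eq_square)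
    next
      case 10
      then have "e i j k l = 0"
        using ij q1111[of i j k l] by metis
      then show ?thesis using 10 ij by (simp add: power2_eq_square)
    qed
  qed
  then show ?thesis by (simp add: e_def)
qed

lemma B_sum:
  fixes P :: "'i \<Rightarrow> (real^2) set"
  assumes "finite I" "\<And>i. P i \<in> fin_borel_pos" "\<And>i j. i \<noteq> j \<Longrightarrow> P i \<inter> P j = {}"
  shows "(\<Union>i\<in>I. P i) \<in> fin_borel_pos \<and> (AE x in M. B (\<Union>i\<in>I. P i) x = (\<Sum>i\<in>I. B (P i) x))
    \<and> vol (\<Union>i\<in>I. P i) = (\<Sum>i\<in>I. vol (P i))"
  using assms(1)
proof (induction rule: finite_induct)
  case empty
  have e: "{} \<in> fin_borel_pos" by (simp add: fin_borel_pos_def)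
  \<comment> \<open>The empty set is disjoint from itself, so additivity forces its noise to vanish
    almost surely.\<close>
  have "AE x in M. B ({} \<union> {}) x = B {} x + B {} x"
    by (intro B_Un e) simp
  then have "AE x in M. B {} x = 0"
    by eventually_elim simp
  with e show ?case by simp
next
  case (insert i I)
  have d: "P i \<inter> (\<Union>i\<in>I. P i) = {}"
  proof -
    have "P i \<inter> P j = {}" if "j \<in> I" for j
      using that insert.hyps assms(3)[of i j] by metis
    then show ?thesis by auto
  qed
  define U where "U = (\<Union>i\<in>I. P i)"
  have U: "U \<in> fin_borel_pos" "AE x in M. B U x = (\<Sum>i\<in>I. B (P i) x)" "vol U = (\<Sum>i\<in>I. vol (P i))"
    using insert.IH[folded U_def] by blast+
  have "AE x in M. B (P i \<union> U) x = B (P i) x + B U x"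
    using B_Un[OF assms(2) U(1)] d by (simp add: U_def)
  with U(2) have "AE x in M. B (P i \<union> U) x = (\<Sum>i\<in>insert i I. B (P i) x)"
    by eventually_elim (use insert.hyps in simp)
  moreover have "vol (P i \<union> U) = (\<Sum>i\<in>insert i I. vol (P i))"
    using vol_Un[OF assms(2) U(1)] d insert.hyps U(3) by (simp add: U_def)
  moreover have "(\<Union>i\<in>insert i I. P i) = P i \<union> U"
    by (simp add: U_def)
  ultimately show ?case
    using fin_Un[OF assms(2) U(1)] by (simp only:)
qed

lemma expectation_sum4:
  fixes X :: "'i::finite \<Rightarrow> 'a \<Rightarrow> real"
  assumes "\<And>i. L4 M (X i)"
  shows "expectation (\<lambda>x. \<Sum>s\<in>UNIV. \<Sum>t\<in>UNIV. \<Sum>u\<in>UNIV. \<Sum>w\<in>UNIV.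
        a s * b t * c u * d w * (X s x * X t x * X u x * X w x))
    = (\<Sum>s\<in>UNIV. \<Sum>t\<in>UNIV. \<Sum>u\<in>UNIV. \<Sum>w\<in>UNIV.
        a s * b t * c u * d w * expectation (\<lambda>x. X s x * X t x * X u x * X w x))"
proof -
  have *: "integrable M (\<lambda>x. X s x * X t x * X u x * X w x)" for s t u w
    by (intro L4_integrable_prod assms)
  show ?thesis
    by (simp only: Bochner_Integration.integral_sum Bochner_Integration.integrable_sum
        integrable_mult_right integral_mult_right_zero *)
qed

text \<open>The four sets are cut into the atoms of the algebra they generate, indexed by membership
  patterns. Noise and volume of each set are sums over atoms, both sides are multilinear in the
  membership indicators, and the formula reduces to disjoint sets.\<close>

lemma B_wick:
  assumes "A1 \<in> fin_borel_pos" "A2 \<in> fin_borel_pos" "A3 \<in> fin_borel_pos" "A4 \<in> fin_borel_pos"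
  shows "expectation (\<lambda>x. B A1 x * B A2 x * B A3 x * B A4 x)
    = vol (A1 \<inter> A2) * vol (A3 \<inter> A4) + vol (A1 \<inter> A3) * vol (A2 \<inter> A4) + vol (A1 \<inter> A4) * vol (A2 \<inter> A3)"
proof -
  define U where "U = A1 \<union> A2 \<union> A3 \<union> A4"
  \<comment> \<open>Intersecting with \<open>U\<close> makes the all-False atom empty instead of a
    set of infinite measure.\<close>
  define P where "P s = {x \<in> U. (x \<in> A1, x \<in> A2, x \<in> A3, x \<in> A4) = s}" for s
  have [measurable]: "A1 \<in> sets borel" "A2 \<in> sets borel" "A3 \<in> sets borel" "A4 \<in> sets borel"
    using assms by (auto simp: fin_borel_pos_def)
  have U: "U \<in> fin_borel_pos" unfolding U_def by (intro fin_Un assms)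
  have [measurable]: "P s \<in> sets borel" for s
  proof (cases s)
    case (fields a b c d)
    have "P s = U \<inter> (if a then A1 else - A1) \<inter> (if b then A2 else - A2)
        \<inter> (if c then A3 else - A3) \<inter> (if d then A4 else - A4)"
      by (auto simp: P_def fields)
    then show ?thesis
      by (simp add: U_def Compl_eq_Diff_UNIV)
  qed
  have P: "P s \<in> fin_borel_pos" for s
    by (rule fin_subset[OF U]) (measurable, auto simp: P_def)
  have disj: "P s \<inter> P t = {}" if "s \<noteq> t" for s t
    using that by (auto simp: P_def)
  let ?c1 = "\<lambda>(a, b, c, d). a" and ?c2 = "\<lambda>(a, b, c, d). b" and ?c3 = "\<lambda>(a, b, c, d). c"
    and ?c4 = "\<lambda>(a, b, c, d). d"
  have un: "(\<Union>s\<in>{s. c s}. P s) = {x \<in> U. c (x \<in> A1, x \<in> A2, x \<in> A3, x \<in> A4)}" for c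
    by (auto simp: P_def)
  have B: "AE x in M. B A x = (\<Sum>s\<in>UNIV. of_bool (c s) * B (P s) x)"
    and V: "vol A = (\<Sum>s\<in>UNIV. of_bool (c s) * vol (P s))"
    if "A = {x \<in> U. c (x \<in> A1, x \<in> A2, x \<in> A3, x \<in> A4)}" for A c
  proof -
    have *: "(\<Sum>s\<in>UNIV. of_bool (c s) * f s) = (\<Sum>s\<in>{s. c s}. f s)" for f :: "_ \<Rightarrow> real"
      by (rule sum.mono_neutral_cong_right) auto
    show "AE x in M. B A x = (\<Sum>s\<in>UNIV. of_bool (c s) * B (P s) x)"
      "vol A = (\<Sum>s\<in>UNIV. of_bool (c s) * vol (P s))"
      using B_sum[of "{s. c s}" P, OF _ P disj] un[of c] that by (simp_all add: *)
  qed
  have B1: "AE x in M. B A1 x = (\<Sum>s\<in>UNIV. of_bool (?c1 s) * B (P s) x)"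
    and B2: "AE x in M. B A2 x = (\<Sum>s\<in>UNIV. of_bool (?c2 s) * B (P s) x)"
    and B3: "AE x in M. B A3 x = (\<Sum>s\<in>UNIV. of_bool (?c3 s) * B (P s) x)"
    and B4: "AE x in M. B A4 x = (\<Sum>s\<in>UNIV. of_bool (?c4 s) * B (P s) x)"
    by (rule B; auto simp: U_def)+
  note [measurable] = B_measurable[OF P] B_measurable[OF assms(1)] B_measurable[OF assms(2)]
     B_measurable[OF assms(3)] B_measurable[OF assms(4)]
  have w: "expectation (\<lambda>x. B (P s) x * B (P t) x * B (P u) x * B (P w) x)
    = of_bool (s = t) * of_bool (u = w) * (vol (P s) * vol (P u))
      + of_bool (s = u) * of_bool (t = w) * (vol (P s) * vol (P t))
      + of_bool (s = w) * of_bool (t = u) * (vol (P s) * vol (P t))" for s t u w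
    by (rule B_wick_disjoint[OF P]) (rule disj)
  have "expectation (\<lambda>x. B A1 x * B A2 x * B A3 x * B A4 x)
     = expectation (\<lambda>x. \<Sum>s\<in>UNIV. \<Sum>t\<in>UNIV. \<Sum>u\<in>UNIV. \<Sum>w\<in>UNIV.
        of_bool (?c1 s) * of_bool (?c2 t) * of_bool (?c3 u) * of_bool (?c4 w) *
        (B (P s) x * B (P t) x * B (P u) x * B (P w) x))"
  proof (rule integral_cong_AE)
    show "AE x in M. B A1 x * B A2 x * B A3 x * B A4 x = (\<Sum>s\<in>UNIV. \<Sum>t\<in>UNIV. \<Sum>u\<in>UNIV. \<Sum>w\<in>UNIV.
        of_bool (?c1 s) * of_bool (?c2 t) * of_bool (?c3 u) * of_bool (?c4 w) *
        (B (P s) x * B (P t) x * B (P u) x * B (P w) x))"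
      using B1 B2 B3 B4
    proof eventually_elim
      case (elim x)
      show ?case
        unfolding elim sum_mult4 by (intro sum.cong refl) (simp only: mult_ac)
    qed
  qed measurable
  also have "\<dots> = (\<Sum>s\<in>UNIV. \<Sum>t\<in>UNIV. \<Sum>u\<in>UNIV. \<Sum>w\<in>UNIV.
        of_bool (?c1 s) * of_bool (?c2 t) * of_bool (?c3 u) * of_bool (?c4 w) *
        expectation (\<lambda>x. B (P s) x * B (P t) x * B (P u) x * B (P w) x))"
    by (rule expectation_sum4) (intro B_L4 P)
  also have "\<dots> = (\<Sum>s\<in>UNIV. of_bool (?c1 s \<and> ?c2 s) * vol (P s)) * (\<Sum>s\<in>UNIV. of_bool (?c3 s \<and> ?c4 s) * vol (P s))
    + (\<Sum>s\<in>UNIV. of_bool (?c1 s \<and> ?c3 s) * vol (P s)) * (\<Sum>s\<in>UNIV. of_bool (?c2 s \<and> ?c4 s) * vol (P s))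
    + (\<Sum>s\<in>UNIV. of_bool (?c1 s \<and> ?c4 s) * vol (P s)) * (\<Sum>s\<in>UNIV. of_bool (?c2 s \<and> ?c3 s) * vol (P s))"
    by (simp only: w sum_pairings of_bool_conj)
  also have "(\<Sum>s\<in>UNIV. of_bool (?c1 s \<and> ?c2 s) * vol (P s)) = vol (A1 \<inter> A2)"
    by (rule V[symmetric]) (auto simp: U_def)
  also have "(\<Sum>s\<in>UNIV. of_bool (?c3 s \<and> ?c4 s) * vol (P s)) = vol (A3 \<inter> A4)"
    by (rule V[symmetric]) (auto simp: U_def)
  also have "(\<Sum>s\<in>UNIV. of_bool (?c1 s \<and> ?c3 s) * vol (P s)) = vol (A1 \<inter> A3)"
    by (rule V[symmetric]) (auto simp: U_def)
  also have "(\<Sum>s\<in>UNIV. of_bool (?c2 s \<and> ?c4 s) * vol (P s)) = vol (A2 \<inter> A4)"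
    by (rule V[symmetric]) (auto simp: U_def)
  also have "(\<Sum>s\<in>UNIV. of_bool (?c1 s \<and> ?c4 s) * vol (P s)) = vol (A1 \<inter> A4)"
    by (rule V[symmetric]) (auto simp: U_def)
  also have "(\<Sum>s\<in>UNIV. of_bool (?c2 s \<and> ?c3 s) * vol (P s)) = vol (A2 \<inter> A3)"
    by (rule V[symmetric]) (auto simp: U_def)
  finally show ?thesis .
qed

end

section \<open>Fourth moments of integrals of random fields\<close>

text \<open>\<open>N\<close> is the measure against which the parameter of the field is integrated.
  Its finiteness and the uniform bound \<open>C\<close> are what every application of Fubini rests
  on.\<close>

locale fourth_moment_field = N: finite_measure N + prob_space M for N :: "'b measure" and M :: "'a measure" +
  fixes Y :: "'b \<Rightarrow> 'a \<Rightarrow> real" and C :: real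
  assumes Y_measurable [measurable]: "(\<lambda>(z, x). Y z x) \<in> borel_measurable (N \<Otimes>\<^sub>M M)"
    and Y_L4: "\<And>z. z \<in> space N \<Longrightarrow> L4 M (Y z)"
    and Y_bound: "\<And>z. z \<in> space N \<Longrightarrow> expectation (\<lambda>x. Y z x ^ 4) \<le> C"
begin

definition Z :: "'a \<Rightarrow> real" where "Z x = (\<integral>z. Y z x \<partial>N)"

sublocale NM: pair_sigma_finite N M ..

lemma Y_measurable_swap [measurable]: "(\<lambda>(x, z). Y z x) \<in> borel_measurable (M \<Otimes>\<^sub>M N)"
  using measurable_compose[OF measurable_pair_swap' Y_measurable] by (simp add: split_def)

lemma Z_measurable [measurable]: "Z \<in> borel_measurable M"
  unfolding Z_def by (rule N.borel_measurable_lebesgue_integral) (rule Y_measurable_swap)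

text \<open>Three factors are left free so that one lemma serves every stage of expanding the fourth
  power of \<open>Z\<close>, when some factors are still \<open>Z\<close> and others are already
  values of \<open>Y\<close>.\<close>

lemma integrable_pair_prod3:
  assumes "L4 M U1" "L4 M U2" "L4 M U3"
  shows "integrable (N \<Otimes>\<^sub>M M) (\<lambda>(z, x). U1 x * U2 x * U3 x * Y z x)"
proof (rule NM.Fubini_integrable)
  have [measurable]: "U1 \<in> borel_measurable M" "U2 \<in> borel_measurable M" "U3 \<in> borel_measurable M"
    using assms by (auto simp: L4_def)
  show "(\<lambda>(z, x). U1 x * U2 x * U3 x * Y z x) \<in> borel_measurable (N \<Otimes>\<^sub>M M)"
    by measurable
  let ?S = "expectation (\<lambda>x. U1 x ^ 4) + expectation (\<lambda>x. U2 x ^ 4) + expectation (\<lambda>x. U3 x ^ 4) + C"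
  have int: "integrable M (\<lambda>x. U1 x * U2 x * U3 x * Y z x)" if "z \<in> space N" for z
    by (intro L4_integrable_prod assms Y_L4 that)
  have "norm (\<integral>x. norm (case (z, x) of (z, x) \<Rightarrow> U1 x * U2 x * U3 x * Y z x) \<partial>M) \<le> ?S" if z: "z \<in> space N" for z
  proof -
    have "(\<integral>x. norm (U1 x * U2 x * U3 x * Y z x) \<partial>M) \<le> (\<integral>x. U1 x ^ 4 + U2 x ^ 4 + U3 x ^ 4 + Y z x ^ 4 \<partial>M)"
      using int[OF z] assms Y_L4[OF z] abs_prod4_le
      by (intro integral_mono) (auto simp: L4_def)
    also have "\<dots> = expectation (\<lambda>x. U1 x ^ 4) + expectation (\<lambda>x. U2 x ^ 4) + expectation (\<lambda>x. U3 x ^ 4)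
        + expectation (\<lambda>x. Y z x ^ 4)"
      using assms Y_L4[OF z] by (simp add: L4_def)
    finally have "(\<integral>x. norm (U1 x * U2 x * U3 x * Y z x) \<partial>M) \<le> ?S"
      using Y_bound[OF z] by linarith
    then show ?thesis by simp
  qed
  then show "integrable N (\<lambda>z. \<integral>x. norm (case (z, x) of (z, x) \<Rightarrow> U1 x * U2 x * U3 x * Y z x) \<partial>M)"
    by (intro N.integrable_const_bound[where B="?S"] AE_I2) auto
  show "AE z in N. integrable M (\<lambda>x. case (z, x) of (z, x) \<Rightarrow> U1 x * U2 x * U3 x * Y z x)"
    using int by (intro AE_I2) auto
qed

lemma expectation_prod3_Z:
  assumes "L4 M U1" "L4 M U2" "L4 M U3"
  shows "expectation (\<lambda>x. U1 x * U2 x * U3 x * Z x) = (\<integral>z. expectation (\<lambda>x. U1 x * U2 x * U3 x * Y z x) \<partial>N)"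
proof -
  have "(\<integral>x. \<integral>z. U1 x * U2 x * U3 x * Y z x \<partial>N \<partial>M) = (\<integral>z. \<integral>x. U1 x * U2 x * U3 x * Y z x \<partial>M \<partial>N)"
    by (rule NM.Fubini_integral) (rule integrable_pair_prod3[OF assms])
  then show ?thesis
    by (simp add: Z_def)
qed

lemma AE_integrable: "AE x in M. integrable N (\<lambda>z. Y z x)"
proof -
  have "integrable (N \<Otimes>\<^sub>M M) (\<lambda>(z, x). 1 * 1 * 1 * Y z x)"
    by (intro integrable_pair_prod3 L4_const)
  then show ?thesis
    using NM.AE_integrable_snd[of Y] by simp
qed

text \<open>Cauchy-Schwarz against the constant 1, used twice, bounds the fourth power of an
  integral over \<open>N\<close> by the cube of the total mass times the integral of fourth powers.
  The expectation is then exchanged with the integral over \<open>N\<close>.\<close>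

lemma Z_L4: "L4 M Z"
  unfolding L4_def
proof
  define n where "n = emeasure N (space N)"
  have n: "n < \<infinity>" unfolding n_def using N.emeasure_finite by (simp add: less_top[symmetric])
  have meas [measurable]: "(\<lambda>z. Y z x) \<in> borel_measurable N" if "x \<in> space M" for x
    using measurable_Pair1'[OF that, of N] Y_measurable_swap
    by (metis (no_types, lifting) measurable_Pair2 measurable_cong old.prod.case that)
  have pt: "ennreal (Z x ^ 4) \<le> n ^ 3 * (\<integral>\<^sup>+z. ennreal (Y z x ^ 4) \<partial>N)" if x: "x \<in> space M" for x
  proof -
    note [measurable] = meas[OF x]
    have cs: "(\<integral>\<^sup>+z. f z \<partial>N)\<^sup>2 \<le> n * (\<integral>\<^sup>+z. (f z)\<^sup>2 \<partial>N)" if [measurable]: "f \<in> borel_measurable N" for f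
      using Cauchy_Schwarz_nn_integral[of "\<lambda>_. 1" N f] by (simp add: n_def)
    \<comment> \<open>Where the field is not integrable in the parameter, the Bochner integral is 0
      by default and the estimate persists.\<close>
    have "ennreal \<bar>Z x\<bar> \<le> (\<integral>\<^sup>+z. ennreal \<bar>Y z x\<bar> \<partial>N)"
      unfolding Z_def using integral_norm_bound_ennreal[of N "\<lambda>z. Y z x"]
      by (cases "integrable N (\<lambda>z. Y z x)") (auto simp: not_integrable_integral_eq)
    then have "ennreal \<bar>Z x\<bar> ^ 4 \<le> (\<integral>\<^sup>+z. ennreal \<bar>Y z x\<bar> \<partial>N) ^ 4"
      by (intro power_mono) auto
    also have "\<dots> = ((\<integral>\<^sup>+z. ennreal \<bar>Y z x\<bar> \<partial>N)\<^sup>2)\<^sup>2"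
      by (simp flip: power_mult)
    also have "\<dots> \<le> (n * (\<integral>\<^sup>+z. (ennreal \<bar>Y z x\<bar>)\<^sup>2 \<partial>N))\<^sup>2"
      by (intro power_mono cs) auto
    also have "\<dots> = n\<^sup>2 * (\<integral>\<^sup>+z. (ennreal \<bar>Y z x\<bar>)\<^sup>2 \<partial>N)\<^sup>2"
      by (simp add: power_mult_distrib)
    also have "\<dots> \<le> n\<^sup>2 * (n * (\<integral>\<^sup>+z. ((ennreal \<bar>Y z x\<bar>)\<^sup>2)\<^sup>2 \<partial>N))"
      by (intro mult_left_mono cs) auto
    also have "\<dots> = n ^ 3 * (\<integral>\<^sup>+z. ennreal (Y z x ^ 4) \<partial>N)"
      by (simp add: power2_eq_square power3_eq_cube power4_eq_xxxx mult.assoc ennreal_mult'[symmetric])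
    finally show ?thesis
      by (simp add: ennreal_power)
  qed
  have "(\<integral>\<^sup>+x. ennreal (Z x ^ 4) \<partial>M) \<le> (\<integral>\<^sup>+x. n ^ 3 * (\<integral>\<^sup>+z. ennreal (Y z x ^ 4) \<partial>N) \<partial>M)"
    by (intro nn_integral_mono pt)
  also have "\<dots> = n ^ 3 * (\<integral>\<^sup>+x. \<integral>\<^sup>+z. ennreal (Y z x ^ 4) \<partial>N \<partial>M)"
    by (intro nn_integral_cmult) measurable
  also have "(\<integral>\<^sup>+x. \<integral>\<^sup>+z. ennreal (Y z x ^ 4) \<partial>N \<partial>M) = (\<integral>\<^sup>+z. \<integral>\<^sup>+x. ennreal (Y z x ^ 4) \<partial>M \<partial>N)"
    by (rule NM.Fubini') measurable
  also have "\<dots> \<le> (\<integral>\<^sup>+z. ennreal C \<partial>N)"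
  proof (rule nn_integral_mono)
    fix z assume z: "z \<in> space N"
    then have "(\<integral>\<^sup>+x. ennreal (Y z x ^ 4) \<partial>M) = ennreal (expectation (\<lambda>x. Y z x ^ 4))"
      using Y_L4[OF z] by (intro nn_integral_eq_integral) (auto simp: L4_def)
    then show "(\<integral>\<^sup>+x. ennreal (Y z x ^ 4) \<partial>M) \<le> ennreal C"
      using Y_bound[OF z] by (simp add: ennreal_leI)
  qed
  also have "\<dots> = ennreal C * n" by (simp add: n_def)
  finally have "(\<integral>\<^sup>+x. ennreal (Z x ^ 4) \<partial>M) \<le> n ^ 3 * (ennreal C * n)"
    by (simp add: mult_left_mono)
  also have "\<dots> < \<infinity>"
    using n by (simp add: ennreal_mult_less_top power_less_top_ennreal)
  finally show "integrable M (\<lambda>x. Z x ^ 4)"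
    unfolding integrable_iff_bounded by simp
qed (fact Z_measurable)

text \<open>One factor \<open>Z\<close> at a time is replaced by an integral of \<open>Y\<close>;
  the factors \<open>Z\<close> not yet replaced are admissible because \<open>Z\<close> itself has a
  finite fourth moment.\<close>

lemma expectation_Z4:
  "expectation (\<lambda>x. Z x ^ 4)
    = (\<integral>a. \<integral>b. \<integral>c. \<integral>d. expectation (\<lambda>x. Y a x * Y b x * Y c x * Y d x) \<partial>N \<partial>N \<partial>N \<partial>N)"
proof -
  have "expectation (\<lambda>x. Z x ^ 4) = expectation (\<lambda>x. Z x * Z x * Z x * Z x)"
    by (simp add: power4_eq_xxxx mult.assoc)
  also have "\<dots> = (\<integral>a. expectation (\<lambda>x. Y a x * Z x * Z x * Z x) \<partial>N)"
    by (subst expectation_prod3_Z[OF Z_L4 Z_L4 Z_L4]) (simp add: mult_ac)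
  also have "\<dots> = (\<integral>a. \<integral>b. expectation (\<lambda>x. Y a x * Y b x * Z x * Z x) \<partial>N \<partial>N)"
    by (intro Bochner_Integration.integral_cong refl, subst expectation_prod3_Z[OF Y_L4 Z_L4 Z_L4])
       (simp_all add: mult_ac)
  also have "\<dots> = (\<integral>a. \<integral>b. \<integral>c. expectation (\<lambda>x. Y a x * Y b x * Y c x * Z x) \<partial>N \<partial>N \<partial>N)"
    by (intro Bochner_Integration.integral_cong refl, subst expectation_prod3_Z[OF Y_L4 Y_L4 Z_L4])
       (simp_all add: mult_ac)
  also have "\<dots> = (\<integral>a. \<integral>b. \<integral>c. \<integral>d. expectation (\<lambda>x. Y a x * Y b x * Y c x * Y d x) \<partial>N \<partial>N \<partial>N \<partial>N)"
    by (intro Bochner_Integration.integral_cong refl, subst expectation_prod3_Z[OF Y_L4 Y_L4 Y_L4])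
       (simp_all add: mult_ac)
  finally show ?thesis .
qed

text \<open>Integrated over all four parameters, each of the three pairings gives the same square,
  as for a centred Gaussian variable whose variance is the double integral of
  \<open>k\<close>.\<close>

lemma expectation_Z4_wick:
  assumes k [measurable]: "(\<lambda>(a, b). k a b) \<in> borel_measurable (N \<Otimes>\<^sub>M N)"
    and kb: "\<And>a b. a \<in> space N \<Longrightarrow> b \<in> space N \<Longrightarrow> \<bar>k a b\<bar> \<le> K"
    and wick: "\<And>a b c d. a \<in> space N \<Longrightarrow> b \<in> space N \<Longrightarrow> c \<in> space N \<Longrightarrow> d \<in> space N \<Longrightarrow>
      expectation (\<lambda>x. Y a x * Y b x * Y c x * Y d x) = k a b * k c d + k a c * k b d + k a d * k b c"
  shows "expectation (\<lambda>x. Z x ^ 4) = 3 * (\<integral>a. \<integral>b. k a b \<partial>N \<partial>N)\<^sup>2"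
proof -
  define \<kappa> where "\<kappa> a = (\<integral>b. k a b \<partial>N)" for a
  define I where "I = (\<integral>a. \<kappa> a \<partial>N)"
  have [measurable]: "\<kappa> \<in> borel_measurable N" unfolding \<kappa>_def by measurable
  have ki [simp]: "integrable N (k a)" if "a \<in> space N" for a
    using kb[OF that] that by (intro N.integrable_const_bound[where B=K] AE_I2) auto
  have "\<bar>\<kappa> a\<bar> \<le> K * measure N (space N)" if a: "a \<in> space N" for a
  proof -
    have "\<bar>\<kappa> a\<bar> \<le> (\<integral>b. \<bar>k a b\<bar> \<partial>N)" unfolding \<kappa>_def by (rule integral_abs_bound)
    also have "\<dots> \<le> (\<integral>b. K \<partial>N)"
      using kb[OF a] ki[OF a] by (intro integral_mono) auto
    finally show ?thesis by (simp add: mult.commute)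
  qed
  then have \<kappa>i [simp]: "integrable N \<kappa>"
    by (intro N.integrable_const_bound[where B="K * measure N (space N)"] AE_I2) auto
  have "expectation (\<lambda>x. Z x ^ 4)
     = (\<integral>a. \<integral>b. \<integral>c. \<integral>d. k a b * k c d + k a c * k b d + k a d * k b c \<partial>N \<partial>N \<partial>N \<partial>N)"
    unfolding expectation_Z4 by (intro Bochner_Integration.integral_cong refl wick)
  also have "\<dots> = (\<integral>a. \<integral>b. \<integral>c. k a b * \<kappa> c + k a c * \<kappa> b + \<kappa> a * k b c \<partial>N \<partial>N \<partial>N)"
    by (intro Bochner_Integration.integral_cong refl) (simp add: \<kappa>_def[symmetric])
  also have "\<dots> = (\<integral>a. \<integral>b. k a b * I + \<kappa> a * \<kappa> b + \<kappa> a * \<kappa> b \<partial>N \<partial>N)"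
    by (intro Bochner_Integration.integral_cong refl) (simp add: \<kappa>_def[symmetric] I_def)
  also have "\<dots> = (\<integral>a. \<kappa> a * I + \<kappa> a * I + \<kappa> a * I \<partial>N)"
    by (intro Bochner_Integration.integral_cong refl) (simp add: \<kappa>_def[symmetric] I_def)
  also have "\<dots> = 3 * I\<^sup>2"
    by (simp add: I_def[symmetric] power2_eq_square)
  finally show ?thesis by (simp add: I_def \<kappa>_def)
qed

end

section \<open>Pairing a Brownian sheet with test functions\<close>

text \<open>\<open>partial_deriv\<close> differentiates at parameter 0 only; translating the base
  point along the axis yields the derivative at every parameter, as integration along a line
  requires.\<close>

lemma has_vector_derivative_partial:
  fixes f :: "real^2 \<Rightarrow> complex"
  assumes "f differentiable (at (x + s *\<^sub>R axis j 1))"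
  shows "((\<lambda>t. f (x + t *\<^sub>R axis j 1)) has_vector_derivative partial_deriv f j (x + s *\<^sub>R axis j 1)) (at s)"
proof -
  let ?y = "x + s *\<^sub>R axis j (1::real)"
  have "((\<lambda>t. ?y + t *\<^sub>R axis j 1) has_derivative (\<lambda>t. t *\<^sub>R axis j 1)) (at 0)"
    by (auto intro!: derivative_eq_intros)
  then have "(\<lambda>t. ?y + t *\<^sub>R axis j (1::real)) differentiable (at 0)"
    by (auto simp: differentiable_def)
  then have "(f \<circ> (\<lambda>t. ?y + t *\<^sub>R axis j 1)) differentiable (at 0)"
    by (rule differentiable_chain_at) (use assms in simp)
  then have "((\<lambda>t. f (?y + t *\<^sub>R axis j 1)) has_vector_derivative partial_deriv f j ?y) (at 0)"
    unfolding partial_deriv_def by (simp add: vector_derivative_works o_def)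
  then have "((\<lambda>t. f (?y + t *\<^sub>R axis j 1)) \<circ> (\<lambda>t. t - s) has_vector_derivative 1 *\<^sub>R partial_deriv f j ?y) (at s)"
    by (intro vector_diff_chain_at) (auto intro!: derivative_eq_intros)
  then show ?thesis
    by (simp add: o_def algebra_simps)
qed

lemma has_vector_derivative_vec2:
  fixes f :: "real^2 \<Rightarrow> complex"
  assumes "f differentiable (at (vec2 s t))"
  shows "((\<lambda>s. f (vec2 s t)) has_vector_derivative partial_deriv f 1 (vec2 s t)) (at s)"
    and "((\<lambda>t. f (vec2 s t)) has_vector_derivative partial_deriv f 2 (vec2 s t)) (at t)"
proof -
  have 1: "vec2 0 t + s *\<^sub>R axis 1 1 = vec2 s t" and 2: "vec2 s 0 + t *\<^sub>R axis 2 1 = vec2 s t" for s t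
    by (simp_all add: vec2_eq_axis)
  show "((\<lambda>s. f (vec2 s t)) has_vector_derivative partial_deriv f 1 (vec2 s t)) (at s)"
    using has_vector_derivative_partial[of f "vec2 0 t" s 1] assms unfolding 1 by simp
  show "((\<lambda>t. f (vec2 s t)) has_vector_derivative partial_deriv f 2 (vec2 s t)) (at t)"
    using has_vector_derivative_partial[of f "vec2 s 0" t 2] assms unfolding 2 by simp
qed

lemma partial_deriv_zero_outside:
  assumes "closed K" "\<And>y. y \<notin> K \<Longrightarrow> f y = 0" "x \<notin> K"
  shows "partial_deriv f j x = 0"
proof -
  have "open ((\<lambda>t::real. x + t *\<^sub>R axis j 1) -` (- K))"
    using assms(1) by (intro continuous_open_vimage) (auto intro!: continuous_intros)
  moreover have "0 \<in> (\<lambda>t::real. x + t *\<^sub>R axis j 1) -` (- K)"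
    using assms(3) by simp
  ultimately have "((\<lambda>t. f (x + t *\<^sub>R axis j 1)) has_vector_derivative 0) (at 0)"
    by (rule has_vector_derivative_transform_within_open[OF has_vector_derivative_const[of 0]])
       (use assms(2) in auto)
  then show ?thesis
    unfolding partial_deriv_def by (rule vector_derivative_at)
qed

text \<open>The kernel of Brownian motion on the half-line chosen by \<open>q\<close>: as functions
  of \<open>\<rho>\<close>, the indicators of the intervals between 0 and s have L^2 products min
  |s| |t|, which is the covariance.\<close>

definition half_ind :: "bool \<Rightarrow> real \<Rightarrow> real \<Rightarrow> real" where
  "half_ind q s \<rho> = of_bool (if q then 0 < \<rho> \<and> \<rho> \<le> s else s \<le> \<rho> \<and> \<rho> < 0)"

text \<open>The sign of the boundary term when a derivative is integrated from \<open>\<rho>\<close>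
  away from the origin: \<open>\<rho>\<close> is the lower end on the positive half-line and the
  upper end on the negative one.\<close>

definition half_sgn :: "bool \<Rightarrow> real \<Rightarrow> real" where
  "half_sgn q \<rho> = (if q then - of_bool (0 < \<rho>) else of_bool (\<rho> < 0))"

lemma half_ind_measurable [measurable]: "(\<lambda>(s, \<rho>). half_ind q s \<rho>) \<in> borel_measurable (borel \<Otimes>\<^sub>M borel)"
  unfolding half_ind_def by measurable

lemma half_ind_measurable_comp [measurable (raw)]:
  "f \<in> borel_measurable M \<Longrightarrow> g \<in> borel_measurable M \<Longrightarrow> (\<lambda>x. half_ind q (f x) (g x)) \<in> borel_measurable M"
  using measurable_compose[OF measurable_Pair half_ind_measurable] by simp

lemma half_ind_le: "0 \<le> half_ind q s \<rho>" "half_ind q s \<rho> \<le> 1"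
  by (auto simp: half_ind_def)

lemma half_sgn_le: "\<bar>half_sgn q \<rho>\<bar> \<le> 1"
  by (auto simp: half_sgn_def)

text \<open>For fixed \<open>\<rho>\<close> in the chosen half-line the weight, as a function of
  \<open>s\<close>, is the indicator of the ray that starts at \<open>\<rho>\<close> and leads away
  from 0. As \<open>F\<close> vanishes far out, only the boundary term at \<open>\<rho>\<close>
  survives.\<close>

lemma integral_half_ind_deriv:
  fixes F :: "real \<Rightarrow> complex"
  assumes F: "\<And>s. (F has_vector_derivative F' s) (at s)" and c: "continuous_on UNIV F'"
    and z: "\<And>s. \<bar>s\<bar> > L \<Longrightarrow> F s = 0" and z': "\<And>s. \<bar>s\<bar> > L \<Longrightarrow> F' s = 0"
  shows "(\<integral>s. half_ind q s \<rho> *\<^sub>R F' s \<partial>lborel) = half_sgn q \<rho> *\<^sub>R F \<rho>"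
proof -
  have ftc: "(\<integral>s. indicator {a..b} s *\<^sub>R F' s \<partial>lborel) = F b - F a" if "a \<le> b" for a b
    by (rule integral_FTC_Icc[OF that]) (use F c in \<open>auto intro: has_vector_derivative_at_within continuous_on_subset\<close>)
  \<comment> \<open>Large enough that \<open>F\<close> and \<open>F'\<close> vanish from there on,
    and that \<open>\<rho>\<close> lies strictly between -M and M.\<close>
  define M where "M = \<bar>L\<bar> + \<bar>\<rho>\<bar> + 1"
  have M: "M > L" "M > \<bar>\<rho>\<bar>" "M > 0" by (auto simp: M_def)
  have outside: "s \<notin> {-M..M} \<Longrightarrow> F' s = 0" "F M = 0" "F (-M) = 0" for s
    using z[of M] z[of "-M"] z'[of s] M by auto
  consider "q" "0 < \<rho>" | "\<not> q" "\<rho> < 0" | "q" "\<not> 0 < \<rho>" | "\<not> q" "\<not> \<rho> < 0" by blast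
  then show ?thesis
  proof cases
    case 1
    have "half_ind q s \<rho> *\<^sub>R F' s = indicator {\<rho>..M} s *\<^sub>R F' s" for s
      using 1 outside(1)[of s] M by (auto simp: half_ind_def split: split_indicator)
    then have "(\<lambda>s. half_ind q s \<rho> *\<^sub>R F' s) = (\<lambda>s. indicator {\<rho>..M} s *\<^sub>R F' s)" by (rule ext)
    then show ?thesis using ftc[of \<rho> M] 1 M outside by (simp add: half_sgn_def)
  next
    case 2
    have "half_ind q s \<rho> *\<^sub>R F' s = indicator {-M..\<rho>} s *\<^sub>R F' s" for s
      using 2 outside(1)[of s] M by (auto simp: half_ind_def split: split_indicator)
    then have "(\<lambda>s. half_ind q s \<rho> *\<^sub>R F' s) = (\<lambda>s. indicator {-M..\<rho>} s *\<^sub>R F' s)" by (rule ext)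
    then show ?thesis using ftc[of "-M" \<rho>] 2 M outside by (simp add: half_sgn_def)
  qed (auto simp: half_ind_def half_sgn_def)
qed

lemma integral_half_ind_overlap:
  assumes "(0 \<le> s) = q" "(0 \<le> t) = q"
  shows "(\<integral>\<rho>. half_ind q s \<rho> * half_ind q t \<rho> \<partial>lborel) = min \<bar>s\<bar> \<bar>t\<bar>"
proof (cases q)
  case True
  have "(\<lambda>\<rho>. half_ind q s \<rho> * half_ind q t \<rho>) = indicator {0<..min s t}"
    using True by (auto simp: half_ind_def fun_eq_iff split: split_indicator)
  then show ?thesis using True assms by simp
next
  case False
  have "(\<lambda>\<rho>. half_ind q s \<rho> * half_ind q t \<rho>) = indicator {max s t..<0}"
    using False by (auto simp: half_ind_def fun_eq_iff split: split_indicator)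
  then show ?thesis using False assms by simp
qed

lemma integral_vec2_swap:
  fixes f :: "real^2 \<Rightarrow> 'b::{banach, second_countable_topology}"
  assumes f: "integrable lborel f"
  shows "(\<integral>x. f x \<partial>lborel) = (\<integral>t. \<integral>s. f (vec2 s t) \<partial>lborel \<partial>lborel)"
proof -
  have [measurable]: "f \<in> borel_measurable borel"
    using f by auto
  have "integrable (lborel \<Otimes>\<^sub>M lborel) (\<lambda>p. f (case p of (s, t) \<Rightarrow> vec2 s t))"
    using f by (subst (asm) lborel_vec2, subst (asm) integrable_distr_eq) auto
  then have "integrable (lborel \<Otimes>\<^sub>M lborel) (\<lambda>(s, t). f (vec2 s t))"
    by (simp add: split_def)
  from lborel_pair.Fubini_integral[OF this] show ?thesis
    using integral_vec2[OF f] by simp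
qed

text \<open>For \<open>x\<close> in the quadrant \<open>(q1, q2)\<close> this is, in
  \<open>r\<close>, the indicator of the rectangle spanned by the origin and \<open>x\<close>, up to
  its edges. Outside that quadrant it vanishes identically.\<close>

definition quad_ind :: "bool \<Rightarrow> bool \<Rightarrow> real^2 \<Rightarrow> real^2 \<Rightarrow> real" where
  "quad_ind q1 q2 x r = half_ind q1 (x $ 1) (r $ 1) * half_ind q2 (x $ 2) (r $ 2)"

lemma borel_measurable_vec_nth [measurable (raw)]:
  fixes f :: "'a \<Rightarrow> 'b::real_normed_vector ^ 'n"
  assumes "f \<in> borel_measurable M"
  shows "(\<lambda>x. f x $ i) \<in> borel_measurable M"
  by (rule borel_measurable_continuous_on[OF _ assms, of "\<lambda>v. v $ i"]) (intro continuous_intros)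

lemma quad_ind_measurable [measurable (raw)]:
  "f \<in> borel_measurable M \<Longrightarrow> g \<in> borel_measurable M \<Longrightarrow> (\<lambda>x. quad_ind q1 q2 (f x) (g x)) \<in> borel_measurable M"
  unfolding quad_ind_def by (intro borel_measurable_times half_ind_measurable_comp borel_measurable_vec_nth)

lemma quad_ind_le: "0 \<le> quad_ind q1 q2 x r" "quad_ind q1 q2 x r \<le> 1"
  unfolding quad_ind_def using half_ind_le by (auto intro: mult_le_one)

lemma quad_ind_norm: "quad_ind q1 q2 x r \<noteq> 0 \<Longrightarrow> norm r \<le> norm x"
proof -
  assume "quad_ind q1 q2 x r \<noteq> 0"
  then have "\<bar>r $ 1\<bar> \<le> \<bar>x $ 1\<bar>" "\<bar>r $ 2\<bar> \<le> \<bar>x $ 2\<bar>"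
    by (auto simp: quad_ind_def half_ind_def split: if_splits)
  then show "norm r \<le> norm x"
    using forall_2[of "\<lambda>i. norm (r $ i) \<le> norm (x $ i)"] by (intro norm_le_componentwise_cart) simp
qed

lemma quad_ind_imp_quadrant: "quad_ind q1 q2 x r \<noteq> 0 \<Longrightarrow> (0 \<le> x $ 1) = q1 \<and> (0 \<le> x $ 2) = q2"
  by (auto simp: quad_ind_def half_ind_def split: if_splits)

lemma integral_quad_ind_overlap:
  assumes "(0 \<le> x $ 1) = q1" "(0 \<le> x $ 2) = q2" "(0 \<le> y $ 1) = q1" "(0 \<le> y $ 2) = q2"
  shows "(\<integral>r. quad_ind q1 q2 x r * quad_ind q1 q2 y r \<partial>lborel)
    = min \<bar>x $ 1\<bar> \<bar>y $ 1\<bar> * min \<bar>x $ 2\<bar> \<bar>y $ 2\<bar>"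
proof -
  have "integrable lborel (\<lambda>r. indicator (cball 0 (norm x)) r :: real)"
    using emeasure_bounded_finite[of "cball 0 (norm x)"]
    by (subst integrable_indicator_iff) (auto simp: less_top)
  then have "integrable lborel (\<lambda>r. quad_ind q1 q2 x r * quad_ind q1 q2 y r)"
  proof (rule Bochner_Integration.integrable_bound)
    show "AE r in lborel. norm (quad_ind q1 q2 x r * quad_ind q1 q2 y r)
        \<le> norm (indicator (cball 0 (norm x)) r :: real)"
    proof (rule AE_I2)
      fix r
      show "norm (quad_ind q1 q2 x r * quad_ind q1 q2 y r) \<le> norm (indicator (cball 0 (norm x)) r :: real)"
        using quad_ind_norm[of q1 q2 x r] quad_ind_le[of q1 q2 x r] quad_ind_le[of q1 q2 y r]
        by (cases "quad_ind q1 q2 x r = 0") (auto simp: abs_mult intro: mult_le_one)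
    qed
  qed measurable
  from integral_vec2[OF this] show ?thesis
    using integral_half_ind_overlap[of "x $ 1" q1 "y $ 1"] integral_half_ind_overlap[of "x $ 2" q2 "y $ 2"] assms
    by (simp add: quad_ind_def mult_ac)
       (simp flip: mult.assoc)
qed

lemma test_fun_facts:
  assumes "test_fun \<psi>"
  shows "\<psi> differentiable (at x)" "partial_deriv \<psi> 2 differentiable (at x)"
    "continuous_on UNIV \<psi>"  "continuous_on UNIV (partial_deriv \<psi> 2)"
    "continuous_on UNIV (partial_deriv (partial_deriv \<psi> 2) 1)"
proof -
  have d: "iter_partial js \<psi> differentiable (at x)" for js x
    using assms by (simp add: test_fun_def smooth_fun_def)
  then have "continuous_on UNIV (iter_partial js \<psi>)" for js
    by (intro differentiable_imp_continuous_on) (simp add: differentiable_on_def differentiable_at_withinI)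
  from d[of "[]"] d[of "[2]"] this[of "[]"] this[of "[2]"] this[of "[1, 2]"]
  show "\<psi> differentiable (at x)" "partial_deriv \<psi> 2 differentiable (at x)"
    "continuous_on UNIV \<psi>"  "continuous_on UNIV (partial_deriv \<psi> 2)"
    "continuous_on UNIV (partial_deriv (partial_deriv \<psi> 2) 1)"
    by simp_all
qed

lemma test_fun_support:
  assumes "test_fun \<psi>"
  obtains R where "R > 0" "\<And>x. norm x > R \<Longrightarrow> \<psi> x = 0" "\<And>x. norm x > R \<Longrightarrow> partial_deriv \<psi> 2 x = 0"
    "\<And>x. norm x > R \<Longrightarrow> partial_deriv (partial_deriv \<psi> 2) 1 x = 0"
proof -
  obtain K where K: "compact K" "\<And>x. x \<notin> K \<Longrightarrow> \<psi> x = 0"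
    using assms by (auto simp: test_fun_def compact_support_in_def)
  obtain R where R: "R > 0" "K \<subseteq> cball 0 R"
    using bounded_subset_ballD[OF compact_imp_bounded[OF K(1)], of 0] ball_subset_cball by blast
  have 0: "\<And>y. y \<notin> cball 0 R \<Longrightarrow> \<psi> y = 0" using K(2) R(2) by blast
  have 1: "\<And>y. y \<notin> cball 0 R \<Longrightarrow> partial_deriv \<psi> 2 y = 0"
    by (rule partial_deriv_zero_outside[of "cball 0 R"]) (use 0 in auto)
  have 2: "\<And>y. y \<notin> cball 0 R \<Longrightarrow> partial_deriv (partial_deriv \<psi> 2) 1 y = 0"
    by (rule partial_deriv_zero_outside[of "cball 0 R"]) (use 1 in auto)
  show thesis
    by (rule that[OF R(1)]) (use 0 1 2 in auto)
qed

lemma integrable_compact_support: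
  fixes f :: "'b::euclidean_space \<Rightarrow> 'c::{banach, second_countable_topology}"
  assumes "continuous_on UNIV f" "\<And>x. norm x > R \<Longrightarrow> f x = 0"
  shows "integrable lborel f"
proof -
  have "integrable lborel (\<lambda>x. indicator (cball 0 R) x *\<^sub>R f x)"
    by (rule borel_integrable_compact) (use assms(1) in \<open>auto intro: continuous_on_subset\<close>)
  moreover have "(\<lambda>x. indicator (cball 0 R) x *\<^sub>R f x) = f"
    using assms(2) by (auto simp: fun_eq_iff split: split_indicator)
  ultimately show ?thesis by simp
qed

text \<open>The mixed second derivative in the pairing is undone here: the fundamental theorem of
  calculus in each coordinate returns the test function, up to a sign, on one open quadrant and 0
  elsewhere.\<close>

lemma integral_quad_ind_deriv:
  assumes \<psi>: "test_fun \<psi>"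
  shows "(\<integral>x. quad_ind q1 q2 x r *\<^sub>R partial_deriv (partial_deriv \<psi> 2) 1 x \<partial>lborel)
    = (half_sgn q1 (r $ 1) * half_sgn q2 (r $ 2)) *\<^sub>R \<psi> r"
proof -
  note facts = test_fun_facts[OF \<psi>]
  obtain R where R: "\<And>x. norm x > R \<Longrightarrow> \<psi> x = 0" "\<And>x. norm x > R \<Longrightarrow> partial_deriv \<psi> 2 x = 0"
    "\<And>x. norm x > R \<Longrightarrow> partial_deriv (partial_deriv \<psi> 2) 1 x = 0"
    using test_fun_support[OF \<psi>] by metis
  let ?F = "partial_deriv (partial_deriv \<psi> 2) 1"
  have [measurable]: "?F \<in> borel_measurable borel"
    by (rule borel_measurable_continuous_onI) (rule facts)
  have big: "norm (vec2 s t) > R" if "\<bar>s\<bar> > R \<or> \<bar>t\<bar> > R" for s t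
    using component_le_norm_cart[of "vec2 s t" 1] component_le_norm_cart[of "vec2 s t" 2] that by auto
  have int: "integrable lborel (\<lambda>x. quad_ind q1 q2 x r *\<^sub>R ?F x)"
  proof (rule Bochner_Integration.integrable_bound)
    show "integrable lborel ?F" by (rule integrable_compact_support[OF facts(5) R(3)])
    show "AE x in lborel. norm (quad_ind q1 q2 x r *\<^sub>R ?F x) \<le> norm (?F x)"
      using quad_ind_le by (intro AE_I2) (auto intro!: mult_left_le_one_le)
  qed measurable
  have c1: "continuous_on UNIV (\<lambda>s. vec2 s t)" and c2: "continuous_on UNIV (\<lambda>s. vec2 t s)" for t
    by (intro continuous_intros)+
  \<comment> \<open>The first coordinate is integrated innermost because the derivative in
    coordinate 1 is the outer one.\<close>
  have "(\<integral>x. quad_ind q1 q2 x r *\<^sub>R ?F x \<partial>lborel)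
      = (\<integral>t. \<integral>s. quad_ind q1 q2 (vec2 s t) r *\<^sub>R ?F (vec2 s t) \<partial>lborel \<partial>lborel)"
    by (rule integral_vec2_swap[OF int])
  also have "\<dots> = (\<integral>t. half_ind q2 t (r $ 2) *\<^sub>R (\<integral>s. half_ind q1 s (r $ 1) *\<^sub>R ?F (vec2 s t) \<partial>lborel) \<partial>lborel)"
    by (simp add: quad_ind_def mult.commute[of "half_ind q1 _ _"] flip: scaleR_scaleR)
  also have "\<dots> = (\<integral>t. half_ind q2 t (r $ 2) *\<^sub>R half_sgn q1 (r $ 1) *\<^sub>R partial_deriv \<psi> 2 (vec2 (r $ 1) t) \<partial>lborel)"
  proof (intro Bochner_Integration.integral_cong refl arg_cong2[of _ _ _ _ scaleR])
    fix t
    show "(\<integral>s. half_ind q1 s (r $ 1) *\<^sub>R ?F (vec2 s t) \<partial>lborel)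
      = half_sgn q1 (r $ 1) *\<^sub>R partial_deriv \<psi> 2 (vec2 (r $ 1) t)"
    proof (rule integral_half_ind_deriv[where F="\<lambda>s. partial_deriv \<psi> 2 (vec2 s t)" and L=R])
      show "continuous_on UNIV (\<lambda>s. ?F (vec2 s t))"
        using continuous_on_compose2[OF facts(5) c1] by simp
    qed (use R big in \<open>auto intro!: has_vector_derivative_vec2 facts\<close>)
  qed
  also have "\<dots> = half_sgn q1 (r $ 1) *\<^sub>R (\<integral>t. half_ind q2 t (r $ 2) *\<^sub>R partial_deriv \<psi> 2 (vec2 (r $ 1) t) \<partial>lborel)"
    by (subst integral_scaleR_right[symmetric]) (simp add: mult.commute)
  also have "(\<integral>t. half_ind q2 t (r $ 2) *\<^sub>R partial_deriv \<psi> 2 (vec2 (r $ 1) t) \<partial>lborel)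
      = half_sgn q2 (r $ 2) *\<^sub>R \<psi> (vec2 (r $ 1) (r $ 2))"
  proof (rule integral_half_ind_deriv[where F="\<lambda>t. \<psi> (vec2 (r $ 1) t)" and L=R])
    show "continuous_on UNIV (\<lambda>t. partial_deriv \<psi> 2 (vec2 (r $ 1) t))"
      using continuous_on_compose2[OF facts(4) c2] by simp
  qed (use R big in \<open>auto intro!: has_vector_derivative_vec2 facts\<close>)
  finally show ?thesis by simp
qed

section \<open>The sheet on a single quadrant\<close>

lemma rect0_eq: "rect0 u = {y. y $ 1 \<in> {0<..u $ 1} \<and> y $ 2 \<in> {0<..u $ 2}}"
  by (auto simp: rect0_def forall_2)

lemma rect0_in_fin_borel_pos: "rect0 u \<in> fin_borel_pos"
proof -
  have "emeasure lborel (rect0 u) = emeasure lborel {0<..u $ 1} * emeasure lborel {0<..u $ 2}"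
    unfolding rect0_eq by (rule emeasure_lborel_vec2) auto
  moreover have "emeasure lborel {0<..s::real} < \<infinity>" for s
    by (cases "0 \<le> s") auto
  ultimately have "emeasure lborel (rect0 u) < \<infinity>"
    by (simp add: ennreal_mult_less_top)
  moreover have "rect0 u \<in> sets borel"
    unfolding rect0_eq by measurable
  moreover have "rect0 u \<subseteq> pos_quadrant"
    by (auto simp: rect0_def pos_quadrant_def)
  ultimately show ?thesis by (simp add: fin_borel_pos_def)
qed

lemma measure_rect0_Int:
  assumes "0 \<le> u $ 1" "0 \<le> u $ 2" "0 \<le> v $ 1" "0 \<le> v $ 2"
  shows "measure lborel (rect0 u \<inter> rect0 v) = min (u $ 1) (v $ 1) * min (u $ 2) (v $ 2)"
proof -
  have eq: "rect0 u \<inter> rect0 v = {y. y $ 1 \<in> {0<..min (u $ 1) (v $ 1)} \<and> y $ 2 \<in> {0<..min (u $ 2) (v $ 2)}}"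
    by (auto simp: rect0_eq)
  have "emeasure lborel (rect0 u \<inter> rect0 v)
      = emeasure lborel {0<..min (u $ 1) (v $ 1)} * emeasure lborel {0<..min (u $ 2) (v $ 2)}"
    unfolding eq by (rule emeasure_lborel_vec2) auto
  also have "\<dots> = ennreal (min (u $ 1) (v $ 1) * min (u $ 2) (v $ 2))"
    using assms by (simp add: ennreal_mult)
  finally show ?thesis
    using assms by (simp add: measure_def)
qed

text \<open>\<open>f\<close> will be the real or imaginary part of the mixed derivative of a test
  function, and \<open>p\<close> the modulus of that test function. Only the domination
  \<open>G_p\<close> of the primitive of \<open>f\<close> by \<open>p\<close> is kept, so both parts
  are treated at once.\<close>

locale quadrant_sheet = pos_white_noise M B for M :: "'a measure" and B +
  fixes W :: "real^2 \<Rightarrow> 'a \<Rightarrow> real" and q1 q2 :: bool and f :: "real^2 \<Rightarrow> real" and Cf R :: real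
    and p :: "real^2 \<Rightarrow> real"
  assumes W [measurable]: "(\<lambda>(x, \<omega>). W x \<omega>) \<in> borel_measurable (lborel \<Otimes>\<^sub>M M)"
    and W_B: "\<And>x. (0 \<le> x $ 1) = q1 \<Longrightarrow> (0 \<le> x $ 2) = q2 \<Longrightarrow> AE \<omega> in M. W x \<omega> = B (rect0 (\<chi> i. \<bar>x $ i\<bar>)) \<omega>"
    and f [measurable]: "f \<in> borel_measurable borel" and f_le: "\<And>x. \<bar>f x\<bar> \<le> Cf"
    and f_0: "\<And>x. norm x > R \<Longrightarrow> f x = 0" and R: "R > 0"
    and p [measurable]: "integrable lborel (\<lambda>r. (p r)\<^sup>2)"
    and G_p: "\<And>r. \<bar>\<integral>x. quad_ind q1 q2 x r * f x \<partial>lborel\<bar> \<le> \<bar>p r\<bar>"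
begin

definition Qi :: "real^2 \<Rightarrow> real" where
  "Qi x = of_bool ((0 \<le> x $ 1) = q1 \<and> (0 \<le> x $ 2) = q2)"

definition Y :: "real^2 \<Rightarrow> 'a \<Rightarrow> real" where
  "Y x \<omega> = Qi x * f x * W x \<omega>"

definition k :: "real^2 \<Rightarrow> real^2 \<Rightarrow> real" where
  "k x y = Qi x * f x * (Qi y * f y) * (min \<bar>x $ 1\<bar> \<bar>y $ 1\<bar> * min \<bar>x $ 2\<bar> \<bar>y $ 2\<bar>)"

text \<open>The ball contains the support of \<open>f\<close>, so restricting to it changes no
  integral of the field and supplies a finite measure.\<close>

definition N :: "(real^2) measure" where
  "N = density lborel (indicator (cball 0 R))"

lemma Qi_measurable [measurable]: "Qi \<in> borel_measurable borel"
  unfolding Qi_def by measurable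

lemma indicator_cball_measurable [simp]:
  "(indicator (cball (0::real^2) R) :: _ \<Rightarrow> real) \<in> borel_measurable borel"
  "(indicator (cball (0::real^2) R) :: _ \<Rightarrow> ennreal) \<in> borel_measurable borel"
  by (rule borel_measurable_indicator, simp)+

lemma sets_N [measurable_cong, simp]: "sets N = sets borel"
  by (simp add: N_def)

lemma space_N [simp]: "space N = UNIV"
  by (simp add: N_def)

sublocale N: finite_measure N
proof
  have "emeasure N (space N) = emeasure lborel (cball (0::real^2) R)"
    by (simp add: N_def emeasure_density)
  then show "emeasure N (space N) \<noteq> \<infinity>"
    using emeasure_bounded_finite[of "cball (0::real^2) R"] by (simp add: less_top)
qed

lemma Y_measurable: "(\<lambda>(x, \<omega>). Y x \<omega>) \<in> borel_measurable (N \<Otimes>\<^sub>M M)"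
proof -
  have "(\<lambda>(x, \<omega>). Y x \<omega>) \<in> borel_measurable (lborel \<Otimes>\<^sub>M M)"
    unfolding Y_def by measurable
  then show ?thesis
    by (subst measurable_cong_sets[OF sets_pair_measure_cong[of N lborel M M] refl]) auto
qed

lemma W_meas: "W x \<in> borel_measurable M"
  using measurable_Pair2[OF W, of x] by simp

lemma W_AE: "Qi x \<noteq> 0 \<Longrightarrow> AE \<omega> in M. W x \<omega> = B (rect0 (\<chi> i. \<bar>x $ i\<bar>)) \<omega>"
  using W_B[of x] by (auto simp: Qi_def split: if_splits)

lemma Y_L4: "L4 M (Y x)"
proof (cases "Qi x = 0")
  case True
  then show ?thesis using L4_const[of 0] by (simp add: Y_def[abs_def])
next
  case False
  define g where "g = B (rect0 (\<chi> i. \<bar>x $ i\<bar>))"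
  have g: "L4 M g" unfolding g_def by (rule B_L4[OF rect0_in_fin_borel_pos])
  then have "L4 M (\<lambda>\<omega>. Qi x * f x * g \<omega>)"
    by (auto simp: L4_def power_mult_distrib)
  then show ?thesis
  proof (rule L4_bound)
    show "Y x \<in> borel_measurable M" using W_meas by (simp add: Y_def[abs_def])
    show "AE \<omega> in M. \<bar>Y x \<omega>\<bar> \<le> \<bar>Qi x * f x * g \<omega>\<bar>"
      using W_AE[OF False] by eventually_elim (simp add: Y_def g_def)
  qed
qed

lemma Y_wick:
  "expectation (\<lambda>\<omega>. Y a \<omega> * Y b \<omega> * Y c \<omega> * Y d \<omega>) = k a b * k c d + k a c * k b d + k a d * k b c"
proof (cases "Qi a = 0 \<or> Qi b = 0 \<or> Qi c = 0 \<or> Qi d = 0")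
  case True
  then show ?thesis by (auto simp: Y_def k_def)
next
  case False
  then have nz: "Qi a \<noteq> 0" "Qi b \<noteq> 0" "Qi c \<noteq> 0" "Qi d \<noteq> 0" by auto
  define r where "r x = rect0 (\<chi> i. \<bar>x $ i\<bar>)" for x :: "real^2"
  define F where "F = Qi a * f a * (Qi b * f b) * (Qi c * f c) * (Qi d * f d)"
  have fin: "r x \<in> fin_borel_pos" for x unfolding r_def by (rule rect0_in_fin_borel_pos)
  note [measurable] = W_meas B_measurable[OF fin]
  have "expectation (\<lambda>\<omega>. Y a \<omega> * Y b \<omega> * Y c \<omega> * Y d \<omega>)
      = expectation (\<lambda>\<omega>. F * (B (r a) \<omega> * B (r b) \<omega> * B (r c) \<omega> * B (r d) \<omega>))"
  proof (rule integral_cong_AE)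
    show "AE \<omega> in M. Y a \<omega> * Y b \<omega> * Y c \<omega> * Y d \<omega> = F * (B (r a) \<omega> * B (r b) \<omega> * B (r c) \<omega> * B (r d) \<omega>)"
      using W_AE[OF nz(1)] W_AE[OF nz(2)] W_AE[OF nz(3)] W_AE[OF nz(4)]
      by eventually_elim (simp add: Y_def F_def r_def mult_ac)
  qed (unfold Y_def, measurable)
  also have "\<dots> = F * (measure lborel (r a \<inter> r b) * measure lborel (r c \<inter> r d)
      + measure lborel (r a \<inter> r c) * measure lborel (r b \<inter> r d)
      + measure lborel (r a \<inter> r d) * measure lborel (r b \<inter> r c))"
    by (simp add: B_wick[OF fin fin fin fin])
  also have "\<dots> = k a b * k c d + k a c * k b d + k a d * k b c"
  proof -
    have m: "measure lborel (r x \<inter> r y) = min \<bar>x $ 1\<bar> \<bar>y $ 1\<bar> * min \<bar>x $ 2\<bar> \<bar>y $ 2\<bar>" for x y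
      unfolding r_def by (subst measure_rect0_Int) auto
    show ?thesis
      unfolding m F_def k_def by (simp only: distrib_left mult_ac)
  qed
  finally show ?thesis .
qed

lemma Qi_le: "0 \<le> Qi x" "Qi x \<le> 1"
  by (auto simp: Qi_def)

lemma Cf_nonneg: "0 \<le> Cf"
  using f_le[of 0] by linarith

lemma k_le: "\<bar>k a b\<bar> \<le> Cf * Cf * (R * R)"
proof (cases "norm a > R")
  case True
  then show ?thesis using Cf_nonneg R by (simp add: k_def f_0)
next
  case False
  have R12: "\<bar>a $ i\<bar> \<le> R" for i
    using component_le_norm_cart[of a i] False by linarith
  have m: "\<bar>min \<bar>a $ i\<bar> \<bar>b $ i\<bar>\<bar> \<le> R" for i using R12[of i] by linarith
  have F: "\<bar>Qi x * f x\<bar> \<le> Cf" for x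
    using f_le[of x] Qi_le[of x] mult_mono[of "Qi x" 1 "\<bar>f x\<bar>" Cf] by (simp add: abs_mult)
  show ?thesis
    unfolding k_def abs_mult[of _ "_ * min _ _"] abs_mult[of "Qi a * f a"] abs_mult[of "min _ _"]
    using R Cf_nonneg by (intro mult_mono F m) auto
qed

sublocale fmf: fourth_moment_field N M Y "3 * (Cf * Cf * (R * R))\<^sup>2"
proof
  show "(\<lambda>(z, x). Y z x) \<in> borel_measurable (N \<Otimes>\<^sub>M M)" by (rule Y_measurable)
  show "L4 M (Y z)" for z by (rule Y_L4)
  fix z
  have "expectation (\<lambda>x. Y z x ^ 4) = 3 * (k z z)\<^sup>2"
    using Y_wick[of z z z z] by (simp add: power4_eq_xxxx power2_eq_square mult.assoc)
  also have "\<dots> \<le> 3 * (Cf * Cf * (R * R))\<^sup>2"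
    using power_mono[OF k_le[of z z], of 2] by simp
  finally show "expectation (\<lambda>x. Y z x ^ 4) \<le> 3 * (Cf * Cf * (R * R))\<^sup>2" .
qed

definition h :: "real^2 \<Rightarrow> real^2 \<Rightarrow> real" where
  "h x r = quad_ind q1 q2 x r * f x"

lemma h_measurable [measurable (raw)]:
  "u \<in> borel_measurable M' \<Longrightarrow> v \<in> borel_measurable M' \<Longrightarrow> (\<lambda>x. h (u x) (v x)) \<in> borel_measurable M'"
  unfolding h_def
  by (intro borel_measurable_times quad_ind_measurable measurable_compose[OF _ f])

lemma h_le: "\<bar>h x r\<bar> \<le> Cf"
  unfolding h_def abs_mult using quad_ind_le[of q1 q2 x r] f_le[of x] mult_mono[of "\<bar>quad_ind q1 q2 x r\<bar>" 1 "\<bar>f x\<bar>" Cf]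
  by simp

lemma h_0: "h x r \<noteq> 0 \<Longrightarrow> x \<in> cball 0 R \<and> r \<in> cball 0 R"
  using quad_ind_norm[of q1 q2 x r] f_0[of x] by (cases "norm x > R") (auto simp: h_def)

lemma integral_N: "g \<in> borel_measurable borel \<Longrightarrow> (\<And>x. x \<notin> cball 0 R \<Longrightarrow> g x = 0) \<Longrightarrow>
    (\<integral>x. g x \<partial>N) = (\<integral>x. (g x :: real) \<partial>lborel)"
proof -
  assume [measurable]: "g \<in> borel_measurable borel" and g: "\<And>x. x \<notin> cball 0 R \<Longrightarrow> g x = 0"
  have "N = density lborel (\<lambda>x. ennreal (indicator (cball 0 R) x))"
    by (simp add: N_def ennreal_indicator)
  then have "(\<integral>x. g x \<partial>N) = (\<integral>x. indicator (cball 0 R) x *\<^sub>R g x \<partial>lborel)"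
    by (simp only:) (rule integral_density; simp)
  also have "\<dots> = (\<integral>x. g x \<partial>lborel)"
    using g by (intro Bochner_Integration.integral_cong refl) (auto split: split_indicator)
  finally show ?thesis .
qed

text \<open>The twofold primitive of \<open>f\<close>, up to sign. It is the integrand with respect
  to white noise that the pairing with \<open>f\<close> represents.\<close>

definition G :: "real^2 \<Rightarrow> real" where "G r = (\<integral>x. h x r \<partial>N)"

lemma G_measurable [measurable]: "G \<in> borel_measurable borel"
proof -
  have "(\<lambda>r. \<integral>x. h x r \<partial>N) \<in> borel_measurable borel"
    by (rule N.borel_measurable_lebesgue_integral) measurable
  then show ?thesis by (simp add: G_def[abs_def])
qed

lemma G_le: "\<bar>G r\<bar> \<le> \<bar>p r\<bar>"
proof -
  have "G r = (\<integral>x. h x r \<partial>lborel)"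
    unfolding G_def using h_0 by (intro integral_N) auto
  then show ?thesis using G_p[of r] by (simp add: h_def)
qed

lemma G_bound: "\<bar>G r\<bar> \<le> Cf * measure N (space N)"
proof -
  have "\<bar>G r\<bar> \<le> (\<integral>x. \<bar>h x r\<bar> \<partial>N)" unfolding G_def by (rule integral_abs_bound)
  also have "\<dots> \<le> (\<integral>x. Cf \<partial>N)"
    using h_le Cf_nonneg by (intro integral_mono N.integrable_const_bound[where B=Cf] AE_I2) auto
  finally show ?thesis by (simp add: mult.commute)
qed

text \<open>The covariance of the sheet is the area of the overlap of two rectangles, hence an L^2
  product of their indicators; the values of \<open>f\<close> are carried along as factors.\<close>

lemma k_eq: "k a b = (\<integral>r. h a r * h b r \<partial>N)"
proof -
  have "(\<integral>r. h a r * h b r \<partial>N) = (\<integral>r. h a r * h b r \<partial>lborel)"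
    using h_0[of a] by (intro integral_N) auto
  also have "\<dots> = (\<integral>r. (f a * f b) * (quad_ind q1 q2 a r * quad_ind q1 q2 b r) \<partial>lborel)"
    by (simp add: h_def mult_ac)
  also have "\<dots> = (f a * f b) * (\<integral>r. quad_ind q1 q2 a r * quad_ind q1 q2 b r \<partial>lborel)"
    by simp
  also have "\<dots> = k a b"
  proof (cases "Qi a = 0 \<or> Qi b = 0")
    case True
    then have "quad_ind q1 q2 a r * quad_ind q1 q2 b r = 0" for r
      using quad_ind_imp_quadrant[of q1 q2 a r] quad_ind_imp_quadrant[of q1 q2 b r]
      by (auto simp: Qi_def split: if_splits)
    then have "(\<lambda>r. quad_ind q1 q2 a r * quad_ind q1 q2 b r) = (\<lambda>_. 0)" by (rule ext)
    then show ?thesis using True by (auto simp: k_def)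
  next
    case False
    then have q: "(0 \<le> a $ 1) = q1" "(0 \<le> a $ 2) = q2" "(0 \<le> b $ 1) = q1" "(0 \<le> b $ 2) = q2"
      by (auto simp: Qi_def split: if_splits)
    then have "Qi a = 1" "Qi b = 1" by (auto simp: Qi_def)
    then show ?thesis
      unfolding integral_quad_ind_overlap[OF q] by (simp add: k_def)
  qed
  finally show ?thesis by simp
qed

text \<open>The isometry behind the Wiener integral: by Fubini the doubly integrated covariance is
  the squared L^2 norm of the primitive.\<close>

lemma integral_k: "(\<integral>a. \<integral>b. k a b \<partial>N \<partial>N) = (\<integral>r. (G r)\<^sup>2 \<partial>N)"
proof -
  interpret NN: pair_sigma_finite N N ..
  interpret NN': finite_measure "N \<Otimes>\<^sub>M N"
    by (intro finite_measure_pair_measure N.finite_measure_axioms)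
  have "(\<integral>a. \<integral>b. k a b \<partial>N \<partial>N) = (\<integral>a. \<integral>r. h a r * G r \<partial>N \<partial>N)"
  proof (rule Bochner_Integration.integral_cong[OF refl])
    fix a
    have "integrable (N \<Otimes>\<^sub>M N) (\<lambda>(b, r). h a r * h b r)"
      by (rule NN'.integrable_const_bound[where B="Cf * Cf"])
         (auto intro!: AE_I2 mult_mono h_le Cf_nonneg simp: abs_mult)
    from NN.Fubini_integral[OF this] show "(\<integral>b. k a b \<partial>N) = (\<integral>r. h a r * G r \<partial>N)"
      by (simp add: k_eq G_def)
  qed
  also have "\<dots> = (\<integral>r. (G r)\<^sup>2 \<partial>N)"
  proof -
    have "integrable (N \<Otimes>\<^sub>M N) (\<lambda>(a, r). h a r * G r)"
      by (rule NN'.integrable_const_bound[where B="Cf * (Cf * measure N (space N))"])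
         (auto intro!: AE_I2 mult_mono h_le G_bound[simplified] Cf_nonneg simp: abs_mult)
    from NN.Fubini_integral[OF this] show ?thesis
      by (simp add: power2_eq_square G_def[symmetric])
  qed
  finally show ?thesis .
qed

text \<open>The pairing has the fourth moment of a centred Gaussian variable, 3 times the squared
  variance, and its variance is at most the squared L^2 norm of \<open>p\<close>.\<close>

lemma Z_fourth_moment: "expectation (\<lambda>\<omega>. fmf.Z \<omega> ^ 4) \<le> 3 * (\<integral>r. (p r)\<^sup>2 \<partial>lborel)\<^sup>2"
proof -
  have [measurable]: "(\<lambda>(a, b). k a b) \<in> borel_measurable (N \<Otimes>\<^sub>M N)"
    unfolding k_def by measurable
  have "expectation (\<lambda>\<omega>. fmf.Z \<omega> ^ 4) = 3 * (\<integral>r. (G r)\<^sup>2 \<partial>N)\<^sup>2"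
    unfolding integral_k[symmetric] by (rule fmf.expectation_Z4_wick) (use k_le Y_wick in auto)
  moreover have "(\<integral>r. (G r)\<^sup>2 \<partial>N) = (\<integral>r. (G r)\<^sup>2 \<partial>lborel)"
  proof (rule integral_N)
    fix x :: "real^2" assume "x \<notin> cball 0 R"
    then have "h y x = 0" for y using h_0[of y x] by blast
    then show "(G x)\<^sup>2 = 0" by (simp add: G_def)
  qed measurable
  moreover have "(\<integral>r. (G r)\<^sup>2 \<partial>lborel) \<le> (\<integral>r. (p r)\<^sup>2 \<partial>lborel)"
  proof (rule integral_mono')
    show "(G r)\<^sup>2 \<le> (p r)\<^sup>2" for r using G_le[of r] by (simp add: abs_le_square_iff)
  qed (use p in auto)
  moreover have "0 \<le> (\<integral>r. (G r)\<^sup>2 \<partial>lborel)" by simp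
  ultimately show ?thesis
    by (simp add: power_mono)
qed

lemma Z_eq: "\<omega> \<in> space M \<Longrightarrow> fmf.Z \<omega> = (\<integral>x. Qi x * f x * W x \<omega> \<partial>lborel)"
proof -
  assume "\<omega> \<in> space M"
  then have "(\<lambda>x. W x \<omega>) \<in> borel_measurable lborel"
    using measurable_Pair1[OF W] by simp
  then have "(\<lambda>x. Y x \<omega>) \<in> borel_measurable borel"
    unfolding Y_def by simp
  then have "fmf.Z \<omega> = (\<integral>x. Y x \<omega> \<partial>lborel)"
    unfolding fmf.Z_def using f_0 by (intro integral_N) (auto simp: Y_def)
  then show ?thesis by (simp add: Y_def)
qed

lemma AE_integrable: "AE \<omega> in M. integrable lborel (\<lambda>x. Qi x * f x * W x \<omega>)"
  using fmf.AE_integrable AE_space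
proof eventually_elim
  case (elim \<omega>)
  then have [measurable]: "(\<lambda>x. W x \<omega>) \<in> borel_measurable borel"
    using measurable_Pair1[OF W] by simp
  have [measurable]: "(\<lambda>x. Y x \<omega>) \<in> borel_measurable borel"
    unfolding Y_def by simp
  have "N = density lborel (\<lambda>x. ennreal (indicator (cball 0 R) x))"
    by (simp add: N_def ennreal_indicator)
  then have "integrable lborel (\<lambda>x. indicator (cball 0 R) x *\<^sub>R Y x \<omega>)"
    using elim(1) by (simp only:) (subst (asm) integrable_density; simp)
  moreover have "(\<lambda>x. indicator (cball 0 R) x *\<^sub>R Y x \<omega>) = (\<lambda>x. Qi x * f x * W x \<omega>)"
    using f_0 by (auto simp: Y_def fun_eq_iff split: split_indicator)
  ultimately show ?case by simp
qed

end

section \<open>Adding up the four quadrants and the real and imaginary parts\<close>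

definition sheet_pairing :: "(real^2 \<Rightarrow> 'a \<Rightarrow> real) \<Rightarrow> (real^2 \<Rightarrow> complex) \<Rightarrow> 'a \<Rightarrow> complex" where
  "sheet_pairing W \<psi> \<omega> = (\<integral>x. W x \<omega> *\<^sub>R partial_deriv (partial_deriv \<psi> 2) 1 x \<partial>lborel)"

definition quadrant_ind :: "bool \<Rightarrow> bool \<Rightarrow> real^2 \<Rightarrow> real" where
  "quadrant_ind q1 q2 x = of_bool ((0 \<le> x $ 1) = q1 \<and> (0 \<le> x $ 2) = q2)"

lemma sum_quadrant_ind:
  "c = quadrant_ind True True x * c + quadrant_ind True False x * c
    + quadrant_ind False True x * c + quadrant_ind False False x * c"
  by (auto simp: quadrant_ind_def)

lemma power4_sum4_le: "((a::real) + b + c + d) ^ 4 \<le> 64 * (a ^ 4 + b ^ 4 + c ^ 4 + d ^ 4)"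
proof -
  have "(a + b + c + d) ^ 4 \<le> 8 * ((a + b) ^ 4 + (c + d) ^ 4)"
    using power4_add_le[of "a + b" "c + d"] by (simp add: add.assoc)
  also have "\<dots> \<le> 8 * (8 * (a ^ 4 + b ^ 4) + 8 * (c ^ 4 + d ^ 4))"
    by (intro mult_left_mono add_mono power4_add_le) auto
  finally show ?thesis by simp
qed

context
  fixes M :: "'a measure" and W :: "real^2 \<Rightarrow> 'a \<Rightarrow> real" and B :: "bool \<Rightarrow> bool \<Rightarrow> (real^2) set \<Rightarrow> 'a \<Rightarrow> real"
    and \<psi> :: "real^2 \<Rightarrow> complex"
  assumes M: "prob_space M"
    and noise: "\<And>q1 q2. white_noise_pos M (B q1 q2)"
    and W [measurable]: "(\<lambda>(x, \<omega>). W x \<omega>) \<in> borel_measurable (lborel \<Otimes>\<^sub>M M)"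
    and W_B: "\<And>x. AE \<omega> in M. W x \<omega> = B (0 \<le> x $ 1) (0 \<le> x $ 2) (rect0 (\<chi> i. \<bar>x $ i\<bar>)) \<omega>"
    and \<psi>: "test_fun \<psi>"
begin

lemma quadrant_pairing:
  assumes f: "f = (\<lambda>x. Re (partial_deriv (partial_deriv \<psi> 2) 1 x)) \<or> f = (\<lambda>x. Im (partial_deriv (partial_deriv \<psi> 2) 1 x))"
  shows "AE \<omega> in M. integrable lborel (\<lambda>x. quadrant_ind q1 q2 x * (f x * W x \<omega>))"
    and "(\<integral>\<^sup>+\<omega>. ennreal ((\<integral>x. quadrant_ind q1 q2 x * (f x * W x \<omega>) \<partial>lborel) ^ 4) \<partial>M)
      \<le> 3 * (\<integral>\<^sup>+x. ennreal ((norm (\<psi> x))\<^sup>2) \<partial>lborel)\<^sup>2"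
    and "(\<lambda>\<omega>. \<integral>x. quadrant_ind q1 q2 x * (f x * W x \<omega>) \<partial>lborel) \<in> borel_measurable M"
proof -
  interpret prob_space M by (rule M)
  let ?F = "partial_deriv (partial_deriv \<psi> 2) 1"
  note facts = test_fun_facts[OF \<psi>]
  obtain R where R: "R > 0" "\<And>x. norm x > R \<Longrightarrow> \<psi> x = 0" "\<And>x. norm x > R \<Longrightarrow> ?F x = 0"
    using test_fun_support[OF \<psi>] by metis
  have cf: "continuous_on UNIV f"
    using f facts(5) by (auto intro!: continuous_intros)
  have f0: "f x = 0" if "norm x > R" for x
    using f R(3)[OF that] by auto
  have "bounded (f ` cball 0 R)"
    by (intro compact_imp_bounded compact_continuous_image) (auto intro: continuous_on_subset[OF cf])
  then obtain Cf where Cf: "Cf > 0" "\<And>x. x \<in> cball 0 R \<Longrightarrow> \<bar>f x\<bar> \<le> Cf"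
    by (auto simp: bounded_pos)
  have fle: "\<bar>f x\<bar> \<le> Cf" for x
    using Cf f0[of x] by (cases "norm x > R") auto
  have intF: "integrable lborel (\<lambda>x. quad_ind q1 q2 x r *\<^sub>R ?F x)" for r
  proof (rule Bochner_Integration.integrable_bound)
    have [measurable]: "?F \<in> borel_measurable borel"
      by (rule borel_measurable_continuous_onI) (rule facts)
    show "integrable lborel ?F" by (rule integrable_compact_support[OF facts(5) R(3)])
    show "AE x in lborel. norm (quad_ind q1 q2 x r *\<^sub>R ?F x) \<le> norm (?F x)"
      using quad_ind_le by (intro AE_I2) (auto intro!: mult_left_le_one_le)
    show "(\<lambda>x. quad_ind q1 q2 x r *\<^sub>R ?F x) \<in> borel_measurable lborel" by measurable
  qed
  \<comment> \<open>The integral against the full complex derivative has modulus at most that of the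
    test function; passing to the real or imaginary part only decreases it.\<close>
  have Gp: "\<bar>\<integral>x. quad_ind q1 q2 x r * f x \<partial>lborel\<bar> \<le> \<bar>norm (\<psi> r)\<bar>" for r
  proof -
    let ?I = "\<integral>x. quad_ind q1 q2 x r *\<^sub>R ?F x \<partial>lborel"
    have "(\<integral>x. quad_ind q1 q2 x r * f x \<partial>lborel) = Re ?I \<or> (\<integral>x. quad_ind q1 q2 x r * f x \<partial>lborel) = Im ?I"
      using f
    proof
      assume "f = (\<lambda>x. Re (?F x))"
      then show ?thesis using integral_Re[OF intF[of r]] by simp
    next
      assume "f = (\<lambda>x. Im (?F x))"
      then show ?thesis using integral_Im[OF intF[of r]] by simp
    qed
    then have "\<bar>\<integral>x. quad_ind q1 q2 x r * f x \<partial>lborel\<bar> \<le> norm ?I"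
      using abs_Re_le_cmod[of ?I] abs_Im_le_cmod[of ?I] by auto
    also have "\<dots> = \<bar>half_sgn q1 (r $ 1)\<bar> * \<bar>half_sgn q2 (r $ 2)\<bar> * norm (\<psi> r)"
      unfolding integral_quad_ind_deriv[OF \<psi>] by (simp add: abs_mult)
    also have "\<dots> \<le> 1 * 1 * norm (\<psi> r)"
      by (intro mult_mono half_sgn_le) auto
    finally show ?thesis by simp
  qed
  have ip: "integrable lborel (\<lambda>x. (norm (\<psi> x))\<^sup>2)"
    by (rule integrable_compact_support[where R=R]) (use facts(3) R(2) in \<open>auto intro!: continuous_intros\<close>)
  interpret qs: quadrant_sheet M "B q1 q2" W q1 q2 f Cf R "\<lambda>x. norm (\<psi> x)"
  proof
    show "AE \<omega> in M. W x \<omega> = B q1 q2 (rect0 (\<chi> i. \<bar>x $ i\<bar>)) \<omega>" if "(0 \<le> x $ 1) = q1" "(0 \<le> x $ 2) = q2" for x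
      using W_B[of x] that by simp
    show "f \<in> borel_measurable borel" by (rule borel_measurable_continuous_onI) (rule cf)
  qed (use noise W fle f0 R Gp ip in auto)
  have Qi: "qs.Qi = quadrant_ind q1 q2"
    by (simp add: fun_eq_iff qs.Qi_def quadrant_ind_def)
  show "AE \<omega> in M. integrable lborel (\<lambda>x. quadrant_ind q1 q2 x * (f x * W x \<omega>))"
    using qs.AE_integrable by (simp add: Qi mult.assoc)
  have Z: "(\<integral>x. quadrant_ind q1 q2 x * (f x * W x \<omega>) \<partial>lborel) = qs.fmf.Z \<omega>" if "\<omega> \<in> space M" for \<omega>
    using qs.Z_eq[OF that] by (simp add: Qi mult.assoc)
  then show "(\<lambda>\<omega>. \<integral>x. quadrant_ind q1 q2 x * (f x * W x \<omega>) \<partial>lborel) \<in> borel_measurable M"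
    using qs.fmf.Z_measurable by (subst measurable_cong) auto
  have "(\<integral>\<^sup>+\<omega>. ennreal ((\<integral>x. quadrant_ind q1 q2 x * (f x * W x \<omega>) \<partial>lborel) ^ 4) \<partial>M)
      = (\<integral>\<^sup>+\<omega>. ennreal (qs.fmf.Z \<omega> ^ 4) \<partial>M)"
    by (intro nn_integral_cong) (simp add: Z)
  also have "\<dots> = ennreal (expectation (\<lambda>\<omega>. qs.fmf.Z \<omega> ^ 4))"
    using qs.fmf.Z_L4 by (intro nn_integral_eq_integral) (auto simp: L4_def)
  also have "\<dots> \<le> ennreal (3 * (\<integral>x. (norm (\<psi> x))\<^sup>2 \<partial>lborel)\<^sup>2)"
    by (intro ennreal_leI qs.Z_fourth_moment)
  also have "\<dots> = 3 * (\<integral>\<^sup>+x. ennreal ((norm (\<psi> x))\<^sup>2) \<partial>lborel)\<^sup>2"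
    by (subst nn_integral_eq_integral[OF ip]) (auto simp: ennreal_mult' ennreal_power)
  finally show "(\<integral>\<^sup>+\<omega>. ennreal ((\<integral>x. quadrant_ind q1 q2 x * (f x * W x \<omega>) \<partial>lborel) ^ 4) \<partial>M)
      \<le> 3 * (\<integral>\<^sup>+x. ennreal ((norm (\<psi> x))\<^sup>2) \<partial>lborel)\<^sup>2" .
qed

text \<open>\<open>768 = 64 * 4 * 3\<close>: convexity over four summands costs 64 = 4^3, and each
  quadrant contributes the Gaussian factor 3.\<close>

lemma real_pairing:
  assumes f: "f = (\<lambda>x. Re (partial_deriv (partial_deriv \<psi> 2) 1 x)) \<or> f = (\<lambda>x. Im (partial_deriv (partial_deriv \<psi> 2) 1 x))"
  shows "AE \<omega> in M. integrable lborel (\<lambda>x. f x * W x \<omega>)"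
    and "(\<lambda>\<omega>. \<integral>x. f x * W x \<omega> \<partial>lborel) \<in> borel_measurable M"
    and "(\<integral>\<^sup>+\<omega>. ennreal ((\<integral>x. f x * W x \<omega> \<partial>lborel) ^ 4) \<partial>M)
      \<le> 768 * (\<integral>\<^sup>+x. ennreal ((norm (\<psi> x))\<^sup>2) \<partial>lborel)\<^sup>2"
proof -
  let ?Z = "\<lambda>q1 q2 \<omega>. \<integral>x. quadrant_ind q1 q2 x * (f x * W x \<omega>) \<partial>lborel"
  let ?P = "(\<integral>\<^sup>+x. ennreal ((norm (\<psi> x))\<^sup>2) \<partial>lborel)\<^sup>2"
  note q = quadrant_pairing[OF f]
  note [measurable] = q(3)
  interpret prob_space M by (rule M)
  have fm [measurable]: "f \<in> borel_measurable borel"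
    using f test_fun_facts(5)[OF \<psi>] by (auto intro!: borel_measurable_continuous_onI continuous_intros)
  show "(\<lambda>\<omega>. \<integral>x. f x * W x \<omega> \<partial>lborel) \<in> borel_measurable M"
  proof (rule lborel.borel_measurable_lebesgue_integral)
    have "(\<lambda>(\<omega>, x). W x \<omega>) \<in> borel_measurable (M \<Otimes>\<^sub>M lborel)"
      using measurable_compose[OF measurable_pair_swap' W] by (simp add: split_def)
    then show "(\<lambda>(\<omega>, x). f x * W x \<omega>) \<in> borel_measurable (M \<Otimes>\<^sub>M lborel)"
      by (simp add: split_def)
  qed
  have ae: "AE \<omega> in M. integrable lborel (\<lambda>x. f x * W x \<omega>) \<and>
      (\<integral>x. f x * W x \<omega> \<partial>lborel) = ?Z True True \<omega> + ?Z True False \<omega> + ?Z False True \<omega> + ?Z False False \<omega>"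
    using q(1)[of True True] q(1)[of True False] q(1)[of False True] q(1)[of False False]
  proof eventually_elim
    case (elim \<omega>)
    have eq: "(\<lambda>x. f x * W x \<omega>) = (\<lambda>x. quadrant_ind True True x * (f x * W x \<omega>)
        + quadrant_ind True False x * (f x * W x \<omega>)
        + quadrant_ind False True x * (f x * W x \<omega>) + quadrant_ind False False x * (f x * W x \<omega>))"
      by (rule ext) (rule sum_quadrant_ind)
    show ?case
      using elim by (subst (1 2) eq) simp
  qed
  then show "AE \<omega> in M. integrable lborel (\<lambda>x. f x * W x \<omega>)"
    by eventually_elim simp
  have "(\<integral>\<^sup>+\<omega>. ennreal ((\<integral>x. f x * W x \<omega> \<partial>lborel) ^ 4) \<partial>M)
     \<le> (\<integral>\<^sup>+\<omega>. 64 * (ennreal (?Z True True \<omega> ^ 4) + ennreal (?Z True False \<omega> ^ 4)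
        + ennreal (?Z False True \<omega> ^ 4) + ennreal (?Z False False \<omega> ^ 4)) \<partial>M)"
  proof (rule nn_integral_mono_AE)
    show "AE \<omega> in M. ennreal ((\<integral>x. f x * W x \<omega> \<partial>lborel) ^ 4) \<le> 64 * (ennreal (?Z True True \<omega> ^ 4) + ennreal (?Z True False \<omega> ^ 4)
        + ennreal (?Z False True \<omega> ^ 4) + ennreal (?Z False False \<omega> ^ 4))"
      using ae
    proof eventually_elim
      case (elim \<omega>)
      have "ennreal ((\<integral>x. f x * W x \<omega> \<partial>lborel) ^ 4)
         \<le> ennreal (64 * (?Z True True \<omega> ^ 4 + ?Z True False \<omega> ^ 4 + ?Z False True \<omega> ^ 4 + ?Z False False \<omega> ^ 4))"
        unfolding elim[THEN conjunct2] by (intro ennreal_leI power4_sum4_le)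
      then show ?case by (simp add: ennreal_mult' ennreal_plus)
    qed
  qed
  also have "\<dots> = 64 * ((\<integral>\<^sup>+\<omega>. ennreal (?Z True True \<omega> ^ 4) \<partial>M) + (\<integral>\<^sup>+\<omega>. ennreal (?Z True False \<omega> ^ 4) \<partial>M)
       + (\<integral>\<^sup>+\<omega>. ennreal (?Z False True \<omega> ^ 4) \<partial>M) + (\<integral>\<^sup>+\<omega>. ennreal (?Z False False \<omega> ^ 4) \<partial>M))"
    by (simp add: nn_integral_cmult nn_integral_add)
  also have "\<dots> \<le> 64 * (3 * ?P + 3 * ?P + 3 * ?P + 3 * ?P)"
    by (intro mult_left_mono add_mono q(2)) auto
  also have "\<dots> = 64 * (12 * ?P)"
    by (simp add: distrib_right[symmetric])
  also have "\<dots> = 768 * ?P"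
    by (simp add: mult.assoc[symmetric])
  finally show "(\<integral>\<^sup>+\<omega>. ennreal ((\<integral>x. f x * W x \<omega> \<partial>lborel) ^ 4) \<partial>M) \<le> 768 * ?P" .
qed

text \<open>\<open>3072 = 2 * (768 + 768)\<close>: the real and imaginary parts are combined through
  (a^2 + b^2)^2 \<le> 2 (a^4 + b^4).\<close>

lemma sheet_pairing_moment:
  shows "AE \<omega> in M. integrable lborel (\<lambda>x. W x \<omega> *\<^sub>R partial_deriv (partial_deriv \<psi> 2) 1 x)"
    and "sheet_pairing W \<psi> \<in> borel_measurable M"
    and "(\<integral>\<^sup>+\<omega>. ennreal (norm (sheet_pairing W \<psi> \<omega>) ^ 4) \<partial>M)
      \<le> 3072 * (\<integral>\<^sup>+x. ennreal ((norm (\<psi> x))\<^sup>2) \<partial>lborel)\<^sup>2"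
proof -
  interpret prob_space M by (rule M)
  let ?F = "partial_deriv (partial_deriv \<psi> 2) 1"
  let ?A = "\<lambda>\<omega>. \<integral>x. Re (?F x) * W x \<omega> \<partial>lborel" and ?B = "\<lambda>\<omega>. \<integral>x. Im (?F x) * W x \<omega> \<partial>lborel"
  let ?P = "(\<integral>\<^sup>+x. ennreal ((norm (\<psi> x))\<^sup>2) \<partial>lborel)\<^sup>2"
  have ae: "AE \<omega> in M. integrable lborel (\<lambda>x. W x \<omega> *\<^sub>R ?F x) \<and> sheet_pairing W \<psi> \<omega> = Complex (?A \<omega>) (?B \<omega>)"
    using real_pairing(1)[OF disjI1[OF refl]] real_pairing(1)[OF disjI2[OF refl]]
  proof eventually_elim
    case (elim \<omega>)
    have eq: "(\<lambda>x. W x \<omega> *\<^sub>R ?F x)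
        = (\<lambda>x. complex_of_real (Re (?F x) * W x \<omega>) + \<i> * complex_of_real (Im (?F x) * W x \<omega>))"
      by (auto simp: fun_eq_iff complex_eq_iff)
    from elim have i: "integrable lborel (\<lambda>x. complex_of_real (Re (?F x) * W x \<omega>))"
      "integrable lborel (\<lambda>x. \<i> * complex_of_real (Im (?F x) * W x \<omega>))"
      by (auto intro!: integrable_of_real simp del: of_real_mult)
    show ?case
      unfolding sheet_pairing_def eq using i
      by (simp add: integral_of_real[symmetric] complex_eq_iff del: of_real_mult)
  qed
  then show "AE \<omega> in M. integrable lborel (\<lambda>x. W x \<omega> *\<^sub>R ?F x)"
    by eventually_elim simp
  have Fm: "?F \<in> borel_measurable borel"
    by (rule borel_measurable_continuous_onI) (rule test_fun_facts(5)[OF \<psi>])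
  show "sheet_pairing W \<psi> \<in> borel_measurable M"
    unfolding sheet_pairing_def[abs_def]
  proof (rule lborel.borel_measurable_lebesgue_integral)
    have "(\<lambda>(\<omega>, x). W x \<omega>) \<in> borel_measurable (M \<Otimes>\<^sub>M lborel)"
      using measurable_compose[OF measurable_pair_swap' W] by (simp add: split_def)
    then show "(\<lambda>(\<omega>, x). W x \<omega> *\<^sub>R ?F x) \<in> borel_measurable (M \<Otimes>\<^sub>M lborel)"
      using Fm by (simp add: split_def)
  qed
  have norm4: "norm (Complex a b) ^ 4 \<le> 2 * (a ^ 4 + b ^ 4)" for a b
  proof -
    have "norm (Complex a b) ^ 4 = ((norm (Complex a b))\<^sup>2)\<^sup>2" by simp
    also have "\<dots> = (a\<^sup>2 + b\<^sup>2)\<^sup>2" by (simp add: cmod_power2)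
    also have "\<dots> \<le> 2 * ((a\<^sup>2)\<^sup>2 + (b\<^sup>2)\<^sup>2)"
      using sum_squares_bound[of "a\<^sup>2" "b\<^sup>2"] by (simp add: power2_sum)
    finally show ?thesis by simp
  qed
  note [measurable] = real_pairing(2)[OF disjI1[OF refl]] real_pairing(2)[OF disjI2[OF refl]]
  have "(\<integral>\<^sup>+\<omega>. ennreal (norm (sheet_pairing W \<psi> \<omega>) ^ 4) \<partial>M)
      \<le> (\<integral>\<^sup>+\<omega>. 2 * (ennreal (?A \<omega> ^ 4) + ennreal (?B \<omega> ^ 4)) \<partial>M)"
  proof (rule nn_integral_mono_AE)
    show "AE \<omega> in M. ennreal (norm (sheet_pairing W \<psi> \<omega>) ^ 4) \<le> 2 * (ennreal (?A \<omega> ^ 4) + ennreal (?B \<omega> ^ 4))"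
      using ae
    proof eventually_elim
      case (elim \<omega>)
      have "ennreal (norm (sheet_pairing W \<psi> \<omega>) ^ 4) \<le> ennreal (2 * (?A \<omega> ^ 4 + ?B \<omega> ^ 4))"
        unfolding elim[THEN conjunct2] by (intro ennreal_leI norm4)
      then show ?case by (simp add: ennreal_mult' ennreal_plus)
    qed
  qed
  also have "\<dots> = 2 * ((\<integral>\<^sup>+\<omega>. ennreal (?A \<omega> ^ 4) \<partial>M) + (\<integral>\<^sup>+\<omega>. ennreal (?B \<omega> ^ 4) \<partial>M))"
    by (simp add: nn_integral_cmult nn_integral_add)
  also have "\<dots> \<le> 2 * (768 * ?P + 768 * ?P)"
    by (intro mult_left_mono add_mono real_pairing(3)) auto
  also have "\<dots> = 3072 * ?P"
    by (simp add: distrib_right[symmetric] mult.assoc[symmetric])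
  finally show "(\<integral>\<^sup>+\<omega>. ennreal (norm (sheet_pairing W \<psi> \<omega>) ^ 4) \<partial>M) \<le> 3072 * ?P" .
qed

end

section \<open>The Wiener integral\<close>

lemma AE_summable_of_geometric_bound:
  fixes f :: "nat \<Rightarrow> 'a \<Rightarrow> real"
  assumes [measurable]: "\<And>n. f n \<in> borel_measurable M" and nn: "\<And>n x. 0 \<le> f n x"
    and le: "\<And>n. (\<integral>\<^sup>+x. ennreal (f n x) \<partial>M) \<le> ennreal (C * q ^ n)" and q: "0 \<le> q" "q < 1" and C: "0 \<le> C"
  shows "AE x in M. summable (\<lambda>n. f n x)"
proof -
  have "summable (\<lambda>n. C * q ^ n)"
    using q by (intro summable_mult summable_geometric) auto
  have "(\<integral>\<^sup>+x. (\<Sum>n. ennreal (f n x)) \<partial>M) = (\<Sum>n. \<integral>\<^sup>+x. ennreal (f n x) \<partial>M)"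
    by (rule nn_integral_suminf) measurable
  also have "\<dots> \<le> (\<Sum>n. ennreal (C * q ^ n))"
    by (intro suminf_le le) auto
  also have "\<dots> = ennreal (\<Sum>n. C * q ^ n)"
    using q C \<open>summable _\<close> by (intro suminf_ennreal2) auto
  also have "\<dots> < \<infinity>" by simp
  finally have "AE x in M. (\<Sum>n. ennreal (f n x)) \<noteq> \<infinity>"
    by (intro nn_integral_PInf_AE) auto
  then show ?thesis
    by eventually_elim (use nn in \<open>auto intro: summable_suminf_not_top\<close>)
qed

text \<open>Since \<open>f \<le> r\<^sup>n + f\<^sup>4 r\<^sup>-\<^sup>3\<^sup>n\<close>, fourth moments of order \<open>2\<^sup>-\<^sup>n\<close> force summability as soon as \<open>2 r\<^sup>3 > 1\<close>.\<close>

lemma AE_summable_fourth_moment: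
  fixes f :: "nat \<Rightarrow> 'a \<Rightarrow> real"
  assumes [measurable]: "\<And>n. f n \<in> borel_measurable M" and nn: "\<And>n x. 0 \<le> f n x"
    and le: "\<And>n. (\<integral>\<^sup>+x. ennreal (f n x ^ 4) \<partial>M) \<le> ennreal (C * (1/2) ^ n)" and C: "0 \<le> C"
  shows "AE x in M. summable (\<lambda>n. f n x)"
proof -
  \<comment> \<open>Any number below 1 whose cube exceeds 1/2 is suitable; here 2 r^3 =
    1.458.\<close>
  define r :: real where "r = 9 / 10"
  have "AE x in M. summable (\<lambda>n. (1 / r ^ 3) ^ n * f n x ^ 4)"
  proof (rule AE_summable_of_geometric_bound[where C=C and q="(1 / r ^ 3) * (1/2)"])
    fix n
    have "(\<integral>\<^sup>+x. ennreal ((1 / r ^ 3) ^ n * f n x ^ 4) \<partial>M) = ennreal ((1 / r ^ 3) ^ n) * (\<integral>\<^sup>+x. ennreal (f n x ^ 4) \<partial>M)"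
      by (simp add: ennreal_mult' r_def nn_integral_cmult)
    also have "\<dots> \<le> ennreal ((1 / r ^ 3) ^ n) * ennreal (C * (1/2) ^ n)"
      by (intro mult_left_mono le) auto
    also have "\<dots> = ennreal (C * ((1 / r ^ 3) * (1/2)) ^ n)"
      by (simp add: ennreal_mult'[symmetric] r_def power_mult_distrib[symmetric] mult.left_commute)
    finally show "(\<integral>\<^sup>+x. ennreal ((1 / r ^ 3) ^ n * f n x ^ 4) \<partial>M) \<le> \<dots>" .
  qed (use C in \<open>auto simp: r_def power3_eq_cube\<close>)
  then show ?thesis
  proof eventually_elim
    case (elim x)
    have "summable (\<lambda>n. r ^ n + (1 / r ^ 3) ^ n * f n x ^ 4)"
      by (intro summable_add elim summable_geometric) (simp add: r_def)
    then show ?case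
    proof (rule summable_comparison_test')
      fix n :: nat
      have r: "r ^ n > 0" by (simp add: r_def)
      have "f n x \<le> r ^ n + (1 / r ^ 3) ^ n * f n x ^ 4"
      proof (cases "f n x \<le> r ^ n")
        case True
        moreover have "0 \<le> (1 / r ^ 3) ^ n * f n x ^ 4" by (simp add: r_def)
        ultimately show ?thesis by linarith
      next
        case False
        then have "(r ^ n) ^ 3 \<le> f n x ^ 3" using r by (intro power_mono) auto
        then have "f n x * (r ^ n) ^ 3 \<le> f n x * f n x ^ 3" using nn by (intro mult_left_mono) auto
        also have "f n x * f n x ^ 3 = f n x ^ 4" by (simp add: numeral_eq_Suc)
        finally have "f n x \<le> f n x ^ 4 / (r ^ n) ^ 3" using r by (simp add: pos_le_divide_eq)
        also have "\<dots> = (1 / r ^ 3) ^ n * f n x ^ 4"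
          by (simp add: power_divide power_mult[symmetric] mult.commute)
        finally show ?thesis using r by linarith
      qed
      then show "norm (f n x) \<le> r ^ n + (1 / r ^ 3) ^ n * f n x ^ 4" using nn by simp
    qed
  qed
qed

lemma fatou_fourth_moment:
  fixes f :: "nat \<Rightarrow> 'a \<Rightarrow> 'b::real_normed_vector"
  assumes [measurable]: "\<And>n. f n \<in> borel_measurable M" "g \<in> borel_measurable M"
    and lim: "AE x in M. (\<lambda>n. f n x) \<longlonglongrightarrow> g x"
    and le: "\<And>n. n \<ge> m \<Longrightarrow> (\<integral>\<^sup>+x. ennreal (norm (f n x) ^ 4) \<partial>M) \<le> K"
  shows "(\<integral>\<^sup>+x. ennreal (norm (g x) ^ 4) \<partial>M) \<le> K"
proof -
  have "(\<integral>\<^sup>+x. ennreal (norm (g x) ^ 4) \<partial>M) \<le> (\<integral>\<^sup>+x. liminf (\<lambda>n. ennreal (norm (f n x) ^ 4)) \<partial>M)"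
  proof (rule nn_integral_mono_AE)
    show "AE x in M. ennreal (norm (g x) ^ 4) \<le> liminf (\<lambda>n. ennreal (norm (f n x) ^ 4))"
      using lim
    proof eventually_elim
      case (elim x)
      have "(\<lambda>n. ennreal (norm (f n x) ^ 4)) \<longlonglongrightarrow> ennreal (norm (g x) ^ 4)"
        by (intro tendsto_intros elim)
      then show ?case by (simp only: lim_imp_Liminf[OF trivial_limit_sequentially])
    qed
  qed
  also have "\<dots> \<le> liminf (\<lambda>n. \<integral>\<^sup>+x. ennreal (norm (f n x) ^ 4) \<partial>M)"
    by (rule nn_integral_liminf) measurable
  also have "\<dots> \<le> K"
    using le by (intro Liminf_le) (auto simp: eventually_sequentially)
  finally show ?thesis .
qed

section \<open>Wiener integrals as limits of pairings with test functions\<close>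

lemma test_fun_diff:
  assumes f: "test_fun f" and g: "test_fun g"
  shows "test_fun (\<lambda>x. f x - g x)"
    and "partial_deriv (partial_deriv (\<lambda>x. f x - g x) 2) 1
      = (\<lambda>x. partial_deriv (partial_deriv f 2) 1 x - partial_deriv (partial_deriv g 2) 1 x)"
proof -
  have df: "iter_partial js f differentiable (at x)" and dg: "iter_partial js g differentiable (at x)" for js x
    using f g by (auto simp: test_fun_def smooth_fun_def)
  have eq: "iter_partial js (\<lambda>x. f x - g x) = (\<lambda>x. iter_partial js f x - iter_partial js g x)" for js
  proof (induction js)
    case (Cons j js)
    have "partial_deriv (\<lambda>x. iter_partial js f x - iter_partial js g x) j x
        = partial_deriv (iter_partial js f) j x - partial_deriv (iter_partial js g) j x" for x
    proof -
      have "((\<lambda>t. iter_partial js f (x + t *\<^sub>R axis j 1) - iter_partial js g (x + t *\<^sub>R axis j 1))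
          has_vector_derivative (partial_deriv (iter_partial js f) j x - partial_deriv (iter_partial js g) j x)) (at 0)"
        using has_vector_derivative_partial[of "iter_partial js f" x 0 j]
          has_vector_derivative_partial[of "iter_partial js g" x 0 j] df dg
        by (intro has_vector_derivative_diff) auto
      then show ?thesis
        unfolding partial_deriv_def[of "\<lambda>x. iter_partial js f x - iter_partial js g x"]
        by (rule vector_derivative_at)
    qed
    then show ?case by (simp add: Cons.IH fun_eq_iff)
  qed simp
  obtain K1 K2 where "compact K1" "\<And>x. x \<notin> K1 \<Longrightarrow> f x = 0" "compact K2" "\<And>x. x \<notin> K2 \<Longrightarrow> g x = 0"
    using f g by (auto simp: test_fun_def compact_support_in_def)
  then have "compact_support_in UNIV (\<lambda>x. f x - g x)"
    unfolding compact_support_in_def by (intro exI[of _ "K1 \<union> K2"]) (auto intro: compact_Un)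
  then show "test_fun (\<lambda>x. f x - g x)"
    using df dg by (simp add: test_fun_def smooth_fun_def eq)
  show "partial_deriv (partial_deriv (\<lambda>x. f x - g x) 2) 1
      = (\<lambda>x. partial_deriv (partial_deriv f 2) 1 x - partial_deriv (partial_deriv g 2) 1 x)"
    using eq[of "[1, 2]"] by simp
qed

definition sqnorm :: "(real^2 \<Rightarrow> complex) \<Rightarrow> ennreal" where
  "sqnorm f = (\<integral>\<^sup>+x. ennreal ((norm (f x))\<^sup>2) \<partial>lebesgue)"

lemma test_fun_measurable: "test_fun \<psi> \<Longrightarrow> \<psi> \<in> borel_measurable lebesgue"
  using borel_measurable_continuous_onI[OF test_fun_facts(3)] by (intro measurable_completion) simp

lemma ennreal_norm_diff_square_le:
  "ennreal ((norm (a - b))\<^sup>2) \<le> 2 * (ennreal ((norm (a - c))\<^sup>2) + ennreal ((norm (c - b :: 'a::real_normed_vector))\<^sup>2))"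
proof -
  have "norm (a - b) \<le> norm (a - c) + norm (c - b)"
    using norm_triangle_ineq[of "a - c" "c - b"] by simp
  then have "(norm (a - b))\<^sup>2 \<le> (norm (a - c) + norm (c - b))\<^sup>2"
    by (intro power_mono) auto
  also have "\<dots> \<le> 2 * ((norm (a - c))\<^sup>2 + (norm (c - b))\<^sup>2)"
    using sum_squares_bound[of "norm (a - c)" "norm (c - b)"] by (simp add: power2_sum)
  finally have "ennreal ((norm (a - b))\<^sup>2) \<le> ennreal (2 * ((norm (a - c))\<^sup>2 + (norm (c - b))\<^sup>2))"
    by (rule ennreal_leI)
  then show ?thesis by (simp add: ennreal_mult' ennreal_plus)
qed

lemma nn_integral_norm_diff_square_le:
  fixes f g h :: "'a \<Rightarrow> 'b::{real_normed_vector, second_countable_topology}"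
  assumes [measurable]: "f \<in> borel_measurable M" "g \<in> borel_measurable M" "h \<in> borel_measurable M"
  shows "(\<integral>\<^sup>+x. ennreal ((norm (f x - g x))\<^sup>2) \<partial>M)
    \<le> 2 * ((\<integral>\<^sup>+x. ennreal ((norm (f x - h x))\<^sup>2) \<partial>M) + (\<integral>\<^sup>+x. ennreal ((norm (h x - g x))\<^sup>2) \<partial>M))"
proof -
  have "(\<integral>\<^sup>+x. ennreal ((norm (f x - g x))\<^sup>2) \<partial>M)
      \<le> (\<integral>\<^sup>+x. 2 * (ennreal ((norm (f x - h x))\<^sup>2) + ennreal ((norm (h x - g x))\<^sup>2)) \<partial>M)"
    by (intro nn_integral_mono ennreal_norm_diff_square_le)
  then show ?thesis by (simp add: nn_integral_cmult nn_integral_add)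
qed

lemma sqnorm_diff_le:
  assumes "f \<in> borel_measurable lebesgue" "g \<in> borel_measurable lebesgue" "h \<in> borel_measurable lebesgue"
  shows "sqnorm (\<lambda>x. f x - g x) \<le> 2 * (sqnorm (\<lambda>x. f x - h x) + sqnorm (\<lambda>x. h x - g x))"
  unfolding sqnorm_def by (rule nn_integral_norm_diff_square_le[OF assms])

lemma sqnorm_commute: "sqnorm (\<lambda>x. f x - g x) = sqnorm (\<lambda>x. g x - f x)"
  unfolding sqnorm_def by (simp add: norm_minus_commute)

text \<open>The square of 1 - b a^2, divided by \<open>b\<close>, is nonnegative. The free weight
  \<open>b\<close> turns a small fourth moment into a small second moment without taking roots of
  integrals.\<close>

lemma two_square_le:
  assumes "0 < (b::real)"
  shows "2 * a\<^sup>2 \<le> 1 / b + b * a ^ 4"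
proof -
  have "(1 - b * a\<^sup>2)\<^sup>2 = 1 - 2 * (b * a\<^sup>2) + b * (b * a ^ 4)"
    by (simp add: power2_eq_square power4_eq_xxxx algebra_simps)
  then have "0 \<le> (1 - 2 * (b * a\<^sup>2) + b * (b * a ^ 4)) / b"
    using assms by (metis divide_nonneg_pos zero_le_power2)
  also have "\<dots> = 1 / b - 2 * a\<^sup>2 + b * a ^ 4"
    using assms by (simp add: add_divide_distrib diff_divide_distrib)
  finally show ?thesis by linarith
qed

locale planar_sheet = prob_space M for M :: "'a measure" +
  fixes W :: "real^2 \<Rightarrow> 'a \<Rightarrow> real" and B :: "bool \<Rightarrow> bool \<Rightarrow> (real^2) set \<Rightarrow> 'a \<Rightarrow> real"
  assumes noise: "\<And>q1 q2. white_noise_pos M (B q1 q2)"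
    and W_meas: "(\<lambda>(x, \<omega>). W x \<omega>) \<in> borel_measurable (lborel \<Otimes>\<^sub>M M)"
    and W_B: "\<And>x. AE \<omega> in M. W x \<omega> = B (0 \<le> x $ 1) (0 \<le> x $ 2) (rect0 (\<chi> i. \<bar>x $ i\<bar>)) \<omega>"
begin

lemmas pairing = sheet_pairing_moment[OF prob_space_axioms noise W_meas W_B]

lemma pairing_moment_le:
  assumes "test_fun \<psi>" "sqnorm \<psi> \<le> ennreal d" "0 \<le> d"
  shows "(\<integral>\<^sup>+\<omega>. ennreal (norm (sheet_pairing W \<psi> \<omega>) ^ 4) \<partial>M) \<le> ennreal (3072 * d\<^sup>2)"
proof -
  have "(\<integral>\<^sup>+\<omega>. ennreal (norm (sheet_pairing W \<psi> \<omega>) ^ 4) \<partial>M) \<le> 3072 * (sqnorm \<psi>)\<^sup>2"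
    using pairing(3)[OF assms(1)] by (simp add: sqnorm_def nn_integral_completion)
  also have "\<dots> \<le> 3072 * (ennreal d)\<^sup>2"
    by (intro mult_left_mono power_mono assms) auto
  finally show ?thesis using assms(3) by (simp add: ennreal_mult' ennreal_power)
qed

lemma pairing_diff:
  assumes "test_fun f" "test_fun g"
  shows "AE \<omega> in M. sheet_pairing W (\<lambda>x. f x - g x) \<omega> = sheet_pairing W f \<omega> - sheet_pairing W g \<omega>"
  using pairing(1)[OF assms(1)] pairing(1)[OF assms(2)]
  by eventually_elim (simp add: sheet_pairing_def test_fun_diff(2)[OF assms] scaleR_diff_right)

lemma pairing_diff_moment_le:
  assumes "test_fun f" "test_fun g" "sqnorm (\<lambda>x. f x - g x) \<le> ennreal d" "0 \<le> d"
  shows "(\<integral>\<^sup>+\<omega>. ennreal (norm (sheet_pairing W f \<omega> - sheet_pairing W g \<omega>) ^ 4) \<partial>M) \<le> ennreal (3072 * d\<^sup>2)"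
proof -
  have "(\<integral>\<^sup>+\<omega>. ennreal (norm (sheet_pairing W f \<omega> - sheet_pairing W g \<omega>) ^ 4) \<partial>M)
     = (\<integral>\<^sup>+\<omega>. ennreal (norm (sheet_pairing W (\<lambda>x. f x - g x) \<omega>) ^ 4) \<partial>M)"
    by (rule nn_integral_cong_AE) (use pairing_diff[OF assms(1,2)] in \<open>auto elim: eventually_mono\<close>)
  also have "\<dots> \<le> ennreal (3072 * d\<^sup>2)"
    by (rule pairing_moment_le) (use assms test_fun_diff in auto)
  finally show ?thesis .
qed

lemma wiener_integral_iff:
  "wiener_integral M W \<phi> I \<longleftrightarrow> \<phi> \<in> borel_measurable lebesgue \<and> I \<in> borel_measurable M \<and>
    (\<exists>\<psi>. (\<forall>n. test_fun (\<psi> n)) \<and> (\<lambda>n. sqnorm (\<lambda>x. \<psi> n x - \<phi> x)) \<longlonglongrightarrow> 0 \<and>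
      (\<lambda>n. \<integral>\<^sup>+\<omega>. ennreal ((norm (sheet_pairing W (\<psi> n) \<omega> - I \<omega>))\<^sup>2) \<partial>M) \<longlonglongrightarrow> 0)"
  by (simp add: wiener_integral_def sqnorm_def sheet_pairing_def)

text \<open>Along a subsequence with squared L^2 errors at most 2^(-n), the fourth moments of
  successive differences decay fast enough for almost sure convergence. The pointwise limit is
  measurable, and Fatou's lemma passes the moment bounds on to it.\<close>

lemma ex_wiener_integral:
  assumes \<phi>: "\<phi> \<in> borel_measurable lebesgue" and test: "\<And>n. test_fun (\<psi> n)"
    and lim: "(\<lambda>n. sqnorm (\<lambda>x. \<psi> n x - \<phi> x)) \<longlonglongrightarrow> 0"
  shows "\<exists>I. wiener_integral M W \<phi> I"
proof -
  have "\<exists>m. sqnorm (\<lambda>x. \<psi> m x - \<phi> x) \<le> ennreal ((1/2) ^ n)" for n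
    using order_tendstoD(2)[OF lim, of "ennreal ((1/2) ^ n)"]
    by (auto simp: eventually_sequentially intro: less_imp_le)
  then obtain r where r: "\<And>n. sqnorm (\<lambda>x. \<psi> (r n) x - \<phi> x) \<le> ennreal ((1/2) ^ n)" by metis
  define X where "X n = sheet_pairing W (\<psi> (r n))" for n
  have [measurable]: "X n \<in> borel_measurable M" for n
    unfolding X_def by (rule pairing(2)[OF test])
  \<comment> \<open>The triangle inequality bounds the squared distance of the test functions by 4 /
    2^n, and \<open>49152 = 3072 * 16\<close>.\<close>
  have m4: "(\<integral>\<^sup>+\<omega>. ennreal (norm (X m \<omega> - X n \<omega>) ^ 4) \<partial>M) \<le> ennreal (49152 * ((1/2) ^ n)\<^sup>2)" if "n \<le> m" for m n
  proof -
    have "sqnorm (\<lambda>x. \<psi> (r m) x - \<psi> (r n) x) \<le> 2 * (sqnorm (\<lambda>x. \<psi> (r m) x - \<phi> x) + sqnorm (\<lambda>x. \<phi> x - \<psi> (r n) x))"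
      by (intro sqnorm_diff_le test_fun_measurable test \<phi>)
    also have "\<dots> \<le> 2 * (ennreal ((1/2) ^ m) + ennreal ((1/2) ^ n))"
      using r[of m] r[of n] by (intro mult_left_mono add_mono) (auto simp: sqnorm_commute[of \<phi>])
    also have "\<dots> \<le> 2 * (ennreal ((1/2) ^ n) + ennreal ((1/2) ^ n))"
      using that by (intro mult_left_mono add_mono ennreal_leI power_decreasing) auto
    also have "\<dots> = ennreal (4 * (1/2) ^ n)"
      by (simp add: ennreal_mult' flip: ennreal_plus)
    finally have "(\<integral>\<^sup>+\<omega>. ennreal (norm (X m \<omega> - X n \<omega>) ^ 4) \<partial>M) \<le> ennreal (3072 * (4 * (1/2) ^ n)\<^sup>2)"
      unfolding X_def by (intro pairing_diff_moment_le test) auto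
    then show ?thesis by (simp add: power_mult_distrib)
  qed
  have "AE \<omega> in M. summable (\<lambda>n. norm (X (Suc n) \<omega> - X n \<omega>))"
  proof (rule AE_summable_fourth_moment[where C=49152])
    fix n
    have "(\<integral>\<^sup>+\<omega>. ennreal (norm (X (Suc n) \<omega> - X n \<omega>) ^ 4) \<partial>M) \<le> ennreal (49152 * ((1/2) ^ n)\<^sup>2)"
      by (rule m4) simp
    also have "\<dots> \<le> ennreal (49152 * (1/2) ^ n)"
      by (intro ennreal_leI mult_left_mono) (auto simp: power2_eq_square intro!: mult_left_le power_le_one)
    finally show "(\<integral>\<^sup>+\<omega>. ennreal (norm (X (Suc n) \<omega> - X n \<omega>) ^ 4) \<partial>M) \<le> \<dots>" .
  qed auto
  then have conv: "AE \<omega> in M. (\<lambda>n. X n \<omega>) \<longlonglongrightarrow> lim (\<lambda>n. X n \<omega>)"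
  proof eventually_elim
    case (elim \<omega>)
    then have "summable (\<lambda>n. X (Suc n) \<omega> - X n \<omega>)" by (rule summable_norm_cancel)
    then have "convergent (\<lambda>n. \<Sum>i<n. X (Suc i) \<omega> - X i \<omega>)" by (simp add: summable_iff_convergent)
    then have "convergent (\<lambda>n. (\<Sum>i<n. X (Suc i) \<omega> - X i \<omega>) + X 0 \<omega>)"
      by (intro convergent_add convergent_const)
    moreover have "(\<lambda>n. (\<Sum>i<n. X (Suc i) \<omega> - X i \<omega>) + X 0 \<omega>) = (\<lambda>n. X n \<omega>)"
      by (rule ext) (simp only: sum_lessThan_telescope[of "\<lambda>n. X n \<omega>"] diff_add_cancel)
    ultimately show ?case by (simp only: convergent_LIMSEQ_iff)
  qed
  define I where "I \<omega> = lim (\<lambda>n. X n \<omega>)" for \<omega>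
  have [measurable]: "I \<in> borel_measurable M"
    unfolding I_def by (rule borel_measurable_lim_metric) measurable
  have I4: "(\<integral>\<^sup>+\<omega>. ennreal (norm (X n \<omega> - I \<omega>) ^ 4) \<partial>M) \<le> ennreal (49152 * ((1/2) ^ n)\<^sup>2)" for n
  proof (rule fatou_fourth_moment[where f="\<lambda>m \<omega>. X n \<omega> - X m \<omega>" and m=n])
    show "AE \<omega> in M. (\<lambda>m. X n \<omega> - X m \<omega>) \<longlonglongrightarrow> X n \<omega> - I \<omega>"
      using conv by eventually_elim (auto intro!: tendsto_intros simp: I_def)
    show "(\<integral>\<^sup>+\<omega>. ennreal (norm (X n \<omega> - X m \<omega>) ^ 4) \<partial>M) \<le> ennreal (49152 * ((1/2) ^ n)\<^sup>2)" if "n \<le> m" for m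
      using m4[OF that] by (simp add: norm_minus_commute)
  qed measurable
  \<comment> \<open>Weight 2^n in \<open>two_square_le\<close> balances the constant term 2^(-n)
    against a fourth moment of order 4^(-n); the sum is (1 + 49152) / 2^n.\<close>
  have I2: "(\<integral>\<^sup>+\<omega>. ennreal ((norm (X n \<omega> - I \<omega>))\<^sup>2) \<partial>M) \<le> ennreal (49153 * (1/2) ^ n)" for n
  proof -
    have "(\<integral>\<^sup>+\<omega>. ennreal ((norm (X n \<omega> - I \<omega>))\<^sup>2) \<partial>M)
       \<le> (\<integral>\<^sup>+\<omega>. ennreal ((1/2) ^ n) + ennreal (2 ^ n) * ennreal (norm (X n \<omega> - I \<omega>) ^ 4) \<partial>M)"
    proof (rule nn_integral_mono)
      fix \<omega>
      let ?a = "norm (X n \<omega> - I \<omega>)"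
      have "2 * ?a\<^sup>2 \<le> (1/2) ^ n + 2 ^ n * ?a ^ 4"
        using two_square_le[of "2 ^ n" ?a] by (simp add: power_divide)
      moreover have "0 \<le> ?a\<^sup>2" by simp
      ultimately have "?a\<^sup>2 \<le> (1/2) ^ n + 2 ^ n * ?a ^ 4" by linarith
      then show "ennreal (?a\<^sup>2) \<le> ennreal ((1/2) ^ n) + ennreal (2 ^ n) * ennreal (?a ^ 4)"
        by (simp flip: ennreal_mult ennreal_plus add: ennreal_leI)
    qed
    also have "\<dots> = ennreal ((1/2) ^ n) + ennreal (2 ^ n) * (\<integral>\<^sup>+\<omega>. ennreal (norm (X n \<omega> - I \<omega>) ^ 4) \<partial>M)"
      by (simp add: nn_integral_add nn_integral_cmult emeasure_space_1)
    also have "\<dots> \<le> ennreal ((1/2) ^ n) + ennreal (2 ^ n) * ennreal (49152 * ((1/2) ^ n)\<^sup>2)"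
      by (intro add_mono mult_left_mono I4) auto
    also have "\<dots> = ennreal (49153 * (1/2) ^ n)"
    proof -
      have "(1/2) ^ n + 2 ^ n * (49152 * ((1/2) ^ n)\<^sup>2) = 49153 * (1/2 :: real) ^ n"
        by (simp add: power_divide power2_eq_square)
      then show ?thesis by (simp flip: ennreal_mult ennreal_plus)
    qed
    finally show ?thesis .
  qed
  have to0: "(\<lambda>n. ennreal (c * (1/2) ^ n)) \<longlonglongrightarrow> 0" for c :: real
  proof -
    have "(\<lambda>n. c * (1/2) ^ n) \<longlonglongrightarrow> c * 0"
      by (intro tendsto_intros LIMSEQ_realpow_zero) auto
    then show ?thesis using tendsto_ennrealI by fastforce
  qed
  have "wiener_integral M W \<phi> I"
    unfolding wiener_integral_iff
  proof (intro conjI exI[of _ "\<lambda>n. \<psi> (r n)"])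
    show "(\<lambda>n. sqnorm (\<lambda>x. \<psi> (r n) x - \<phi> x)) \<longlonglongrightarrow> 0"
      by (rule tendsto_sandwich[OF _ _ tendsto_const to0[of 1]]) (use r in auto)
    show "(\<lambda>n. \<integral>\<^sup>+\<omega>. ennreal ((norm (sheet_pairing W (\<psi> (r n)) \<omega> - I \<omega>))\<^sup>2) \<partial>M) \<longlonglongrightarrow> 0"
      by (rule tendsto_sandwich[OF _ _ tendsto_const to0[of 49153]]) (use I2 in \<open>auto simp: X_def\<close>)
  qed (use \<phi> test in auto)
  then show ?thesis by blast
qed

text \<open>The two integrals come with unrelated approximating sequences. Along a common choice of
  indices the pairings converge almost surely to both, and Fatou's lemma carries over the bound for
  the pairing of the difference.\<close>

lemma wiener_integral_diff_moment:
  assumes I: "wiener_integral M W \<phi> I" and I': "wiener_integral M W \<phi>' I'"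
    and d: "sqnorm (\<lambda>x. \<phi> x - \<phi>' x) \<le> ennreal d" "0 < d"
  shows "(\<integral>\<^sup>+\<omega>. ennreal (norm (I \<omega> - I' \<omega>) ^ 4) \<partial>M) \<le> ennreal (3072 * (10 * d)\<^sup>2)"
proof -
  obtain \<psi> \<psi>' where test: "\<And>n. test_fun (\<psi> n)" "\<And>n. test_fun (\<psi>' n)"
    and l: "(\<lambda>n. sqnorm (\<lambda>x. \<psi> n x - \<phi> x)) \<longlonglongrightarrow> 0"
      "(\<lambda>n. \<integral>\<^sup>+\<omega>. ennreal ((norm (sheet_pairing W (\<psi> n) \<omega> - I \<omega>))\<^sup>2) \<partial>M) \<longlonglongrightarrow> 0"
      "(\<lambda>n. sqnorm (\<lambda>x. \<psi>' n x - \<phi>' x)) \<longlonglongrightarrow> 0"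
      "(\<lambda>n. \<integral>\<^sup>+\<omega>. ennreal ((norm (sheet_pairing W (\<psi>' n) \<omega> - I' \<omega>))\<^sup>2) \<partial>M) \<longlonglongrightarrow> 0"
    and m: "\<phi> \<in> borel_measurable lebesgue" "\<phi>' \<in> borel_measurable lebesgue"
    and [measurable]: "I \<in> borel_measurable M" "I' \<in> borel_measurable M"
    using I[unfolded wiener_integral_iff] I'[unfolded wiener_integral_iff] by blast
  \<comment> \<open>All four errors are pushed below the same geometric tolerance. It is positive
    since \<open>d\<close> is, so convergence to 0 supplies a suitable index for every
    \<open>n\<close>.\<close>
  define e where "e n = ennreal (d * (1/2) ^ n)" for n :: nat
  define Q where "Q n m \<longleftrightarrow> sqnorm (\<lambda>x. \<psi> m x - \<phi> x) < e n
     \<and> (\<integral>\<^sup>+\<omega>. ennreal ((norm (sheet_pairing W (\<psi> m) \<omega> - I \<omega>))\<^sup>2) \<partial>M) < e n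
     \<and> sqnorm (\<lambda>x. \<psi>' m x - \<phi>' x) < e n
     \<and> (\<integral>\<^sup>+\<omega>. ennreal ((norm (sheet_pairing W (\<psi>' m) \<omega> - I' \<omega>))\<^sup>2) \<partial>M) < e n" for n m
  have "\<exists>m. Q n m" for n
  proof -
    have p: "0 < e n" using d by (simp add: e_def)
    have "eventually (Q n) sequentially"
      unfolding Q_def by (intro eventually_conj order_tendstoD(2)[OF l(1) p] order_tendstoD(2)[OF l(2) p]
          order_tendstoD(2)[OF l(3) p] order_tendstoD(2)[OF l(4) p])
    from eventually_happens'[OF sequentially_bot this] show ?thesis .
  qed
  then obtain r where "\<And>n. Q n (r n)" by metis
  then have r: "\<And>n. sqnorm (\<lambda>x. \<psi> (r n) x - \<phi> x) \<le> ennreal (d * (1/2) ^ n)"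
     "\<And>n. (\<integral>\<^sup>+\<omega>. ennreal ((norm (sheet_pairing W (\<psi> (r n)) \<omega> - I \<omega>))\<^sup>2) \<partial>M) \<le> ennreal (d * (1/2) ^ n)"
     "\<And>n. sqnorm (\<lambda>x. \<psi>' (r n) x - \<phi>' x) \<le> ennreal (d * (1/2) ^ n)"
     "\<And>n. (\<integral>\<^sup>+\<omega>. ennreal ((norm (sheet_pairing W (\<psi>' (r n)) \<omega> - I' \<omega>))\<^sup>2) \<partial>M) \<le> ennreal (d * (1/2) ^ n)"
    unfolding Q_def e_def by (simp_all add: less_imp_le)
  define X where "X n = sheet_pairing W (\<psi> (r n))" for n
  define X' where "X' n = sheet_pairing W (\<psi>' (r n))" for n
  have [measurable]: "X n \<in> borel_measurable M" "X' n \<in> borel_measurable M" for n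
    unfolding X_def X'_def by (rule pairing(2)[OF test(1)], rule pairing(2)[OF test(2)])
  have ae: "AE \<omega> in M. (\<lambda>n. Z n \<omega>) \<longlonglongrightarrow> J \<omega>"
    if [measurable]: "\<And>n. Z n \<in> borel_measurable M" "J \<in> borel_measurable M"
      and b: "\<And>n. (\<integral>\<^sup>+\<omega>. ennreal ((norm (Z n \<omega> - J \<omega>))\<^sup>2) \<partial>M) \<le> ennreal (d * (1/2) ^ n)"
    for Z :: "nat \<Rightarrow> 'a \<Rightarrow> complex" and J
  proof -
    have "AE \<omega> in M. summable (\<lambda>n. (norm (Z n \<omega> - J \<omega>))\<^sup>2)"
      by (rule AE_summable_of_geometric_bound[OF _ _ b]) (use d in auto)
    then show ?thesis
    proof eventually_elim
      case (elim \<omega>)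
      from summable_LIMSEQ_zero[OF this] have "(\<lambda>n. sqrt ((norm (Z n \<omega> - J \<omega>))\<^sup>2)) \<longlonglongrightarrow> sqrt 0"
        by (intro tendsto_intros)
      then have "(\<lambda>n. Z n \<omega> - J \<omega>) \<longlonglongrightarrow> 0"
        by (simp add: tendsto_norm_zero_iff)
      then show ?case by (rule LIM_zero_cancel)
    qed
  qed
  have aeX: "AE \<omega> in M. (\<lambda>n. X n \<omega>) \<longlonglongrightarrow> I \<omega>" "AE \<omega> in M. (\<lambda>n. X' n \<omega>) \<longlonglongrightarrow> I' \<omega>"
    by (rule ae[OF _ _ r(2)[folded X_def]], measurable) (rule ae[OF _ _ r(4)[folded X'_def]], measurable)
  show ?thesis
  proof (rule fatou_fourth_moment[where f="\<lambda>n \<omega>. X n \<omega> - X' n \<omega>" and m=0])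
    show "AE \<omega> in M. (\<lambda>n. X n \<omega> - X' n \<omega>) \<longlonglongrightarrow> I \<omega> - I' \<omega>"
      using aeX by eventually_elim (intro tendsto_intros)
    fix n
    \<comment> \<open>From here on each approximation error is merely bounded by \<open>d\<close>;
      the triangle inequality for squared norms, used twice, gives 2 (d + 2 (d + d)) = 10 d.\<close>
    have one: "ennreal (d * (1/2) ^ n) \<le> ennreal d"
      using d by (intro ennreal_leI mult_left_le power_le_one) auto
    have "sqnorm (\<lambda>x. \<psi> (r n) x - \<psi>' (r n) x)
      \<le> 2 * (sqnorm (\<lambda>x. \<psi> (r n) x - \<phi> x) + sqnorm (\<lambda>x. \<phi> x - \<psi>' (r n) x))"
      by (intro sqnorm_diff_le test_fun_measurable test m)
    also have "\<dots> \<le> 2 * (sqnorm (\<lambda>x. \<psi> (r n) x - \<phi> x) + 2 * (sqnorm (\<lambda>x. \<phi> x - \<phi>' x) + sqnorm (\<lambda>x. \<phi>' x - \<psi>' (r n) x)))"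
      by (intro mult_left_mono add_mono order_refl sqnorm_diff_le test_fun_measurable test m) auto
    also have "\<dots> \<le> 2 * (ennreal d + 2 * (ennreal d + ennreal d))"
      using order_trans[OF r(1) one] order_trans[OF r(3) one] d(1)
      by (intro mult_left_mono add_mono) (auto simp: sqnorm_commute[of \<phi>'])
    also have "\<dots> = ennreal (10 * d)"
    proof -
      have "2 * (D + 2 * (D + D)) = 10 * D" for D :: ennreal
      proof -
        have "2 * (D + 2 * (D + D)) = 2 * ((1 + 4) * D)"
          by (simp only: distrib_right mult_1 mult_2[symmetric] mult.assoc[symmetric]) simp
        then show ?thesis by (simp add: mult.assoc[symmetric])
      qed
      then show ?thesis by (simp add: ennreal_mult')
    qed
    finally show "(\<integral>\<^sup>+\<omega>. ennreal (norm (X n \<omega> - X' n \<omega>) ^ 4) \<partial>M) \<le> ennreal (3072 * (10 * d)\<^sup>2)"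
      unfolding X_def X'_def by (intro pairing_diff_moment_le test) (use d in auto)
  qed measurable
qed

text \<open>With equal integrands the squared distance is 0, so the moment bound is available for
  every positive \<open>d\<close> and the fourth moment of the difference vanishes.\<close>

lemma wiener_integral_unique:
  assumes I: "wiener_integral M W \<phi> I" and I': "wiener_integral M W \<phi> I'"
  shows "AE \<omega> in M. I \<omega> = I' \<omega>"
proof -
  have [measurable]: "I \<in> borel_measurable M" "I' \<in> borel_measurable M"
    using I I' by (auto simp: wiener_integral_def)
  have "(\<integral>\<^sup>+\<omega>. ennreal (norm (I \<omega> - I' \<omega>) ^ 4) \<partial>M) \<le> 0"
  proof (rule ennreal_le_epsilon)
    \<comment> \<open>The \<open>d\<close> below solves 3072 (10 d)^2 = e.\<close>
    fix e :: real assume e: "0 < e"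
    have "(\<integral>\<^sup>+\<omega>. ennreal (norm (I \<omega> - I' \<omega>) ^ 4) \<partial>M) \<le> ennreal (3072 * (10 * sqrt (e / 307200))\<^sup>2)"
      by (rule wiener_integral_diff_moment[OF I I']) (use e in \<open>auto simp: sqnorm_def\<close>)
    also have "3072 * (10 * sqrt (e / 307200))\<^sup>2 = e"
      using e by (simp add: power_mult_distrib real_sqrt_pow2)
    finally show "(\<integral>\<^sup>+\<omega>. ennreal (norm (I \<omega> - I' \<omega>) ^ 4) \<partial>M) \<le> 0 + ennreal e" by simp
  qed
  then have "AE \<omega> in M. ennreal (norm (I \<omega> - I' \<omega>) ^ 4) = 0"
    by (subst (asm) le_zero_eq, subst (asm) nn_integral_0_iff_AE) auto
  then show ?thesis
    by eventually_elim (simp add: ennreal_eq_0_iff)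
qed

end

section \<open>A continuity criterion in the plane\<close>

lemma norm_vec2_le: "norm (vec2 s t) \<le> \<bar>s\<bar> + \<bar>t\<bar>"
  using norm_le_l1_cart[of "vec2 s t"] by (simp add: sum_2)

definition grid :: "nat \<Rightarrow> int \<Rightarrow> int \<Rightarrow> real^2" where
  "grid n i j = vec2 (of_int i / 2 ^ n) (of_int j / 2 ^ n)"

definition dyadic_round :: "nat \<Rightarrow> real^2 \<Rightarrow> real^2" where
  "dyadic_round n x = grid n \<lfloor>2 ^ n * x $ 1\<rfloor> \<lfloor>2 ^ n * x $ 2\<rfloor>"

lemma grid_add: "grid n i j + grid n k l = grid n (i + k) (j + l)"
  by (simp add: grid_def vec_eq_iff forall_2 add_divide_distrib)

lemma grid_Suc: "grid n i j = grid (Suc n) (2 * i) (2 * j)"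
  by (simp add: grid_def)

lemma dyadic_round_dist: "norm (dyadic_round n x - x) \<le> 2 / 2 ^ n"
proof -
  have c: "\<bar>of_int \<lfloor>2 ^ n * t\<rfloor> / 2 ^ n - t\<bar> \<le> 1 / 2 ^ n" for t :: real
  proof -
    have "of_int \<lfloor>2 ^ n * t\<rfloor> / 2 ^ n - t = (of_int \<lfloor>2 ^ n * t\<rfloor> - 2 ^ n * t) / 2 ^ n"
      by (simp add: diff_divide_distrib)
    moreover have "\<bar>of_int \<lfloor>2 ^ n * t\<rfloor> - 2 ^ n * t\<bar> \<le> 1" by linarith
    ultimately show ?thesis by (simp add: abs_divide divide_right_mono)
  qed
  have "dyadic_round n x - x = vec2 (of_int \<lfloor>2 ^ n * x $ 1\<rfloor> / 2 ^ n - x $ 1) (of_int \<lfloor>2 ^ n * x $ 2\<rfloor> / 2 ^ n - x $ 2)"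
    by (simp add: dyadic_round_def grid_def vec_eq_iff forall_2)
  then show ?thesis
    using norm_vec2_le[of "of_int \<lfloor>2 ^ n * x $ 1\<rfloor> / 2 ^ n - x $ 1" "of_int \<lfloor>2 ^ n * x $ 2\<rfloor> / 2 ^ n - x $ 2"]
      c[of "x $ 1"] c[of "x $ 2"] by simp
qed

text \<open>The piecewise constant interpolants on the dyadic grids change from one level to the next, and
  across neighbouring cells, by at most the fourth root of the sum of all increments of the current
  level; these fourth roots are almost surely summable.\<close>

theorem kolmogorov_continuity_plane:
  fixes X :: "real^2 \<Rightarrow> 'a \<Rightarrow> 'b::{banach, second_countable_topology}"
  assumes X [measurable]: "\<And>x. X x \<in> borel_measurable M"
    and mom: "\<And>r. \<exists>C\<ge>0. \<forall>x z. norm x \<le> r \<longrightarrow> norm z \<le> r \<longrightarrow>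
        (\<integral>\<^sup>+\<omega>. ennreal (norm (X x \<omega> - X z \<omega>) ^ 4) \<partial>M) \<le> ennreal (C * norm (x - z) ^ 3)"
    and S: "bounded S"
  shows "\<exists>Y. (\<forall>x. Y x \<in> borel_measurable M) \<and> (\<forall>\<omega>\<in>space M. continuous_on S (\<lambda>x. Y x \<omega>)) \<and>
    (\<forall>x\<in>S. AE \<omega> in M. Y x \<omega> = X x \<omega>)"
proof -
  obtain b where b: "\<And>x. x \<in> S \<Longrightarrow> norm x \<le> b" using S by (auto simp: bounded_iff)
  \<comment> \<open>The added 1 ensures \<open>N \<ge> 1\<close>, by which the count of grid points
    in \<open>cardJ\<close> absorbs its own extra 1.\<close>
  define N :: nat where "N = nat \<lceil>b\<rceil> + 1"
  have N: "N \<ge> 1" by (simp add: N_def)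
  have SN: "\<bar>x $ i\<bar> \<le> real N" if "x \<in> S" for x i
    using b[OF that] component_le_norm_cart[of x i] unfolding N_def by linarith
  \<comment> \<open>Grid points over \<open>J n\<close> have norm at most 2 N, and a displacement
    from \<open>E\<close> adds at most 2.\<close>
  define r where "r = 2 * real N + 4"
  obtain C where C: "C \<ge> 0" and mC: "\<And>x z. norm x \<le> r \<Longrightarrow> norm z \<le> r \<Longrightarrow>
        (\<integral>\<^sup>+\<omega>. ennreal (norm (X x \<omega> - X z \<omega>) ^ 4) \<partial>M) \<le> ennreal (C * norm (x - z) ^ 3)"
    using mom[of r] by blast
  define J where "J n = {- int N * 2 ^ n .. int N * 2 ^ n}" for n :: nat
  \<comment> \<open>Displacements are measured in units of 2^(-n-1). Refining a point moves it by 0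
    or 1 of them per coordinate, passing to a neighbouring cell of the same level by 2, so one
    family of increments covers both.\<close>
  define E :: "int set" where "E = {-2..2}"
  define D where "D n i j a b \<omega> = norm (X (grid n i j) \<omega> - X (grid n i j + grid (Suc n) a b) \<omega>) ^ 4" for n i j a b \<omega>
  define F where "F n \<omega> = (\<Sum>i\<in>J n. \<Sum>j\<in>J n. \<Sum>a\<in>E. \<Sum>b\<in>E. D n i j a b \<omega>)" for n \<omega>
  define f where "f n \<omega> = root 4 (F n \<omega>)" for n \<omega>
  have [measurable]: "D n i j a b \<in> borel_measurable M" for n i j a b
    unfolding D_def by measurable
  have [measurable]: "F n \<in> borel_measurable M" for n unfolding F_def by measurable
  have F0: "0 \<le> F n \<omega>" for n \<omega> unfolding F_def D_def by (intro sum_nonneg) auto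
  have f0: "0 \<le> f n \<omega>" for n \<omega> unfolding f_def using F0 by simp
  have [measurable]: "f n \<in> borel_measurable M" for n
    unfolding f_def by (rule borel_measurable_continuous_on[of "root 4"]) (auto intro!: continuous_intros)
  have f4: "f n \<omega> ^ 4 = F n \<omega>" for n \<omega>
    unfolding f_def using F0 by (simp add: real_root_pow_pos2)
  have Df: "norm (X (grid n i j) \<omega> - X (grid n i j + grid (Suc n) a b) \<omega>) \<le> f n \<omega>"
    if "i \<in> J n" "j \<in> J n" "a \<in> E" "b \<in> E" for n i j a b \<omega>
  proof (rule power_le_imp_le_base[where n=3])
    have nn: "0 \<le> D n i j a b \<omega>" for n i j a b \<omega> by (simp add: D_def)
    have "D n i j a b \<omega> \<le> (\<Sum>b\<in>E. D n i j a b \<omega>)"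
      using that by (intro member_le_sum nn) (auto simp: E_def)
    also have "\<dots> \<le> (\<Sum>a\<in>E. \<Sum>b\<in>E. D n i j a b \<omega>)"
      using that by (intro member_le_sum[where f="\<lambda>a. \<Sum>b\<in>E. D n i j a b \<omega>"] sum_nonneg nn) (auto simp: E_def)
    also have "\<dots> \<le> (\<Sum>j\<in>J n. \<Sum>a\<in>E. \<Sum>b\<in>E. D n i j a b \<omega>)"
      using that by (intro member_le_sum[where f="\<lambda>j. \<Sum>a\<in>E. \<Sum>b\<in>E. D n i j a b \<omega>"] sum_nonneg nn) (auto simp: J_def)
    also have "\<dots> \<le> F n \<omega>"
      unfolding F_def using that
      by (intro member_le_sum[where f="\<lambda>i. \<Sum>j\<in>J n. \<Sum>a\<in>E. \<Sum>b\<in>E. D n i j a b \<omega>"] sum_nonneg nn) (auto simp: J_def)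
    finally show "norm (X (grid n i j) \<omega> - X (grid n i j + grid (Suc n) a b) \<omega>) ^ Suc 3 \<le> f n \<omega> ^ Suc 3"
      using f4[of n \<omega>] by (simp add: D_def)
  qed (rule f0)
  have gridJ: "norm (grid n i j) \<le> 2 * real N" if "i \<in> J n" "j \<in> J n" for n i j
  proof -
    have "\<bar>of_int i / 2 ^ n\<bar> \<le> real N" if "i \<in> J n" for i :: int
    proof -
      have "\<bar>i\<bar> \<le> int N * 2 ^ n" using that by (auto simp: J_def)
      then have "real_of_int \<bar>i\<bar> \<le> real_of_int (int N * 2 ^ n)" by (rule of_int_le_iff[THEN iffD2])
      then show ?thesis by (simp add: abs_divide pos_divide_le_eq)
    qed
    from this[OF that(1)] this[OF that(2)] show ?thesis
      unfolding grid_def using norm_vec2_le[of "of_int i / 2 ^ n" "of_int j / 2 ^ n"] by linarith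
  qed
  have gridE: "norm (grid (Suc n) a b) \<le> 2 / 2 ^ n" if "a \<in> E" "b \<in> E" for n a b
  proof -
    have "\<bar>of_int a / 2 ^ Suc n\<bar> \<le> 1 / (2 ^ n :: real)" if "a \<in> E" for a :: int
    proof -
      have "real_of_int \<bar>a\<bar> \<le> 2" using that by (auto simp: E_def)
      then show ?thesis by (simp add: abs_divide divide_simps)
    qed
    from this[OF that(1)] this[OF that(2)] show ?thesis
      unfolding grid_def using norm_vec2_le[of "of_int a / 2 ^ Suc n" "of_int b / 2 ^ Suc n"] by linarith
  qed
  have D4: "(\<integral>\<^sup>+\<omega>. ennreal (D n i j a b \<omega>) \<partial>M) \<le> ennreal (8 * C / 8 ^ n)"
    if "i \<in> J n" "j \<in> J n" "a \<in> E" "b \<in> E" for n i j a b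
  proof -
    have "2 / (2::real) ^ n \<le> 2" by (simp add: divide_simps)
    then have "norm (grid (Suc n) a b) \<le> 2" using gridE[OF that(3,4), of n] by linarith
    then have "norm (grid n i j) \<le> r" "norm (grid n i j + grid (Suc n) a b) \<le> r"
      using gridJ[OF that(1,2)] norm_triangle_ineq[of "grid n i j" "grid (Suc n) a b"] unfolding r_def by linarith+
    from mC[OF this] have "(\<integral>\<^sup>+\<omega>. ennreal (D n i j a b \<omega>) \<partial>M) \<le> ennreal (C * norm (grid (Suc n) a b) ^ 3)"
      by (simp add: D_def)
    also have "\<dots> \<le> ennreal (C * (2 / 2 ^ n) ^ 3)"
      using C gridE[OF that(3,4)] by (intro ennreal_leI mult_left_mono power_mono) auto
    also have "C * (2 / 2 ^ n) ^ 3 = 8 * C / 8 ^ n"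
      by (simp add: power_divide power_mult[symmetric] mult.commute[of n])
         (simp add: power_mult)
    finally show ?thesis .
  qed
  have cardJ: "real (card (J n)) \<le> 3 * real N * 2 ^ n" for n
  proof -
    have "card (J n) = nat (2 * int N * 2 ^ n + 1)" by (simp add: J_def)
    then have "real (card (J n)) = 2 * real N * 2 ^ n + 1"
      by (simp add: nat_add_distrib nat_mult_distrib nat_power_eq)
    moreover have "1 \<le> real N * 2 ^ n" using N mult_mono[of 1 "real N" 1 "2 ^ n"] by simp
    ultimately show ?thesis by linarith
  qed
  \<comment> \<open>At most (3 N 2^n)^2 grid points with 25 displacements each, every increment with
    moment at most 8 C / 8^n. This gives 9 * 25 * 8 = 1800 and the rate 4^n / 8^n = 2^(-n); the cube
    in the moment hypothesis beats the number of points.\<close>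
  have F4: "(\<integral>\<^sup>+\<omega>. ennreal (f n \<omega> ^ 4) \<partial>M) \<le> ennreal (1800 * (real N)\<^sup>2 * C * (1/2) ^ n)" for n
  proof -
    have "(\<integral>\<^sup>+\<omega>. ennreal (f n \<omega> ^ 4) \<partial>M) = (\<integral>\<^sup>+\<omega>. (\<Sum>i\<in>J n. \<Sum>j\<in>J n. \<Sum>a\<in>E. \<Sum>b\<in>E. ennreal (D n i j a b \<omega>)) \<partial>M)"
      unfolding f4 F_def by (simp add: sum_ennreal sum_nonneg D_def)
    also have "\<dots> = (\<Sum>i\<in>J n. \<Sum>j\<in>J n. \<Sum>a\<in>E. \<Sum>b\<in>E. \<integral>\<^sup>+\<omega>. ennreal (D n i j a b \<omega>) \<partial>M)"
      by (simp add: nn_integral_sum)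
    also have "\<dots> \<le> (\<Sum>i\<in>J n. \<Sum>j\<in>J n. \<Sum>a\<in>E. \<Sum>b\<in>E. ennreal (8 * C / 8 ^ n))"
      by (intro sum_mono D4)
    also have "\<dots> = ennreal (\<Sum>i\<in>J n. \<Sum>j\<in>J n. \<Sum>a\<in>E. \<Sum>b\<in>E. 8 * C / 8 ^ n)"
      using C by (simp add: sum_ennreal sum_nonneg del: sum_constant)
    also have "\<dots> \<le> ennreal (1800 * (real N)\<^sup>2 * C * (1/2) ^ n)"
    proof (rule ennreal_leI)
      have "(\<Sum>i\<in>J n. \<Sum>j\<in>J n. \<Sum>a\<in>E. \<Sum>b\<in>E. 8 * C / 8 ^ n) = (real (card (J n)))\<^sup>2 * (200 * C / 8 ^ n)"
        by (simp add: E_def power2_eq_square)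
      also have "\<dots> \<le> (3 * real N * 2 ^ n)\<^sup>2 * (200 * C / 8 ^ n)"
        using C by (intro mult_right_mono power_mono cardJ) auto
      also have "\<dots> = 1800 * (real N)\<^sup>2 * C * ((2 ^ n)\<^sup>2 / 8 ^ n)"
        by (simp add: power_mult_distrib)
      also have "((2::real) ^ n)\<^sup>2 / 8 ^ n = (1/2) ^ n"
      proof -
        have "((2::real) ^ n)\<^sup>2 = 4 ^ n" by (simp add: power2_eq_square power_mult_distrib[symmetric])
        then show ?thesis by (simp add: power_divide[symmetric])
      qed
      finally show "(\<Sum>i\<in>J n. \<Sum>j\<in>J n. \<Sum>a\<in>E. \<Sum>b\<in>E. 8 * C / 8 ^ n) \<le> 1800 * (real N)\<^sup>2 * C * (1/2) ^ n" .
    qed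
    finally show ?thesis .
  qed
  have AEf: "AE \<omega> in M. summable (\<lambda>n. f n \<omega>)"
    by (rule AE_summable_fourth_moment[OF _ f0 F4]) (use C in auto)
  have floorJ: "\<lfloor>2 ^ n * x $ i\<rfloor> \<in> J n" if "x \<in> S" for x n i
  proof -
    have "- real N \<le> x $ i" "x $ i \<le> real N" using SN[OF that, of i] by linarith+
    then have "2 ^ n * (- real N) \<le> 2 ^ n * x $ i" "2 ^ n * x $ i \<le> 2 ^ n * real N"
      by (intro mult_left_mono; simp)+
    then have "real_of_int (- int N * 2 ^ n) \<le> 2 ^ n * x $ i" "2 ^ n * x $ i \<le> real_of_int (int N * 2 ^ n)"
      by (simp_all add: mult.commute)
    then show ?thesis unfolding J_def atLeastAtMost_iff by linarith
  qed
  have nb: "norm (X (dyadic_round n x) \<omega> - X (grid (Suc n) k l) \<omega>) \<le> f n \<omega>"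
    if "x \<in> S" "\<bar>k - 2 * \<lfloor>2 ^ n * x $ 1\<rfloor>\<bar> \<le> 2" "\<bar>l - 2 * \<lfloor>2 ^ n * x $ 2\<rfloor>\<bar> \<le> 2" for n x k l \<omega>
  proof -
    have "dyadic_round n x + grid (Suc n) (k - 2 * \<lfloor>2 ^ n * x $ 1\<rfloor>) (l - 2 * \<lfloor>2 ^ n * x $ 2\<rfloor>) = grid (Suc n) k l"
      unfolding dyadic_round_def grid_Suc[of n] grid_add by simp
    then show ?thesis
      using Df[OF floorJ[OF that(1)] floorJ[OF that(1)], of "k - 2 * \<lfloor>2 ^ n * x $ 1\<rfloor>" "l - 2 * \<lfloor>2 ^ n * x $ 2\<rfloor>" n 1 2 \<omega>]
        that(2,3) by (simp add: E_def abs_le_iff dyadic_round_def[symmetric])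
  qed
  have up: "norm (X (dyadic_round n x) \<omega> - X (dyadic_round (Suc n) x) \<omega>) \<le> f n \<omega>" if "x \<in> S" for n x \<omega>
  proof -
    have "\<bar>\<lfloor>2 ^ Suc n * t\<rfloor> - 2 * \<lfloor>2 ^ n * t\<rfloor>\<bar> \<le> 2" for t :: real
    proof -
      have "2 ^ Suc n * t = 2 * (2 ^ n * t)" by simp
      then show ?thesis by linarith
    qed
    then show ?thesis unfolding dyadic_round_def[of "Suc n"] using that by (intro nb) auto
  qed
  have side: "norm (X (dyadic_round n x) \<omega> - X (dyadic_round n z) \<omega>) \<le> f n \<omega>"
    if "x \<in> S" "norm (x - z) < 1 / 2 ^ n" for n x z \<omega>
  proof -
    have "\<bar>2 * \<lfloor>2 ^ n * z $ i\<rfloor> - 2 * \<lfloor>2 ^ n * x $ i\<rfloor>\<bar> \<le> 2" for i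
    proof -
      have "\<bar>x $ i - z $ i\<bar> < 1 / 2 ^ n"
        using component_le_norm_cart[of "x - z" i] that(2) by simp
      then have "2 ^ n * \<bar>x $ i - z $ i\<bar> < 2 ^ n * (1 / 2 ^ n)" by (intro mult_strict_left_mono) auto
      moreover have "2 ^ n * \<bar>x $ i - z $ i\<bar> = \<bar>2 ^ n * x $ i - 2 ^ n * z $ i\<bar>"
        by (simp add: abs_mult flip: right_diff_distrib)
      ultimately have "\<bar>2 ^ n * x $ i - 2 ^ n * z $ i\<bar> < 1" by simp
      then have "\<lfloor>2 ^ n * z $ i\<rfloor> \<le> \<lfloor>2 ^ n * x $ i\<rfloor> + 1" "\<lfloor>2 ^ n * x $ i\<rfloor> \<le> \<lfloor>2 ^ n * z $ i\<rfloor> + 1"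
        by linarith+
      then show ?thesis by simp
    qed
    then show ?thesis
      unfolding dyadic_round_def[of n z] grid_Suc[of n] using that by (intro nb) auto
  qed
  \<comment> \<open>Finiteness of an extended nonnegative series expresses summability in a form
    whose measurability is immediate.\<close>
  define G where "G \<omega> \<longleftrightarrow> (\<Sum>n. ennreal (f n \<omega>)) \<noteq> \<infinity>" for \<omega>
  have G: "G \<omega> \<longleftrightarrow> summable (\<lambda>n. f n \<omega>)" for \<omega>
  proof
    assume "G \<omega>" then show "summable (\<lambda>n. f n \<omega>)"
      unfolding G_def using f0 by (auto intro: summable_suminf_not_top)
  next
    assume "summable (\<lambda>n. f n \<omega>)"
    then have "(\<Sum>n. ennreal (f n \<omega>)) = ennreal (\<Sum>n. f n \<omega>)" using f0 by (intro suminf_ennreal2) auto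
    then show "G \<omega>" by (simp add: G_def)
  qed
  have [measurable]: "Measurable.pred M G" unfolding G_def by measurable
  \<comment> \<open>The value 0 off the good event makes every path continuous, not merely almost
    every one.\<close>
  define Y where "Y x \<omega> = (if G \<omega> then lim (\<lambda>n. X (dyadic_round n x) \<omega>) else 0)" for x \<omega>
  have Ym: "Y x \<in> borel_measurable M" for x
    unfolding Y_def by measurable
  have Ylim: "(\<lambda>n. X (dyadic_round n x) \<omega>) \<longlonglongrightarrow> Y x \<omega>"
    and Ytail: "norm (X (dyadic_round n x) \<omega> - Y x \<omega>) \<le> (\<Sum>k. f (k + n) \<omega>)"
    if g: "G \<omega>" and x: "x \<in> S" for x \<omega> n
  proof -
    let ?X = "\<lambda>n. X (dyadic_round n x) \<omega>"
    have sf: "summable (\<lambda>n. f n \<omega>)" using g G by simp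
    then have sfn: "summable (\<lambda>k. f (k + n) \<omega>)" for n using summable_iff_shift[of "\<lambda>n. f n \<omega>"] by blast
    have s: "summable (\<lambda>k. norm (?X (Suc (k + n)) - ?X (k + n)))" for n
      using up[OF x] by (intro summable_comparison_test'[OF sfn[of n]]) (auto simp: norm_minus_commute)
    have tele: "(\<lambda>m. (\<Sum>i<m. ?X (Suc (i + n)) - ?X (i + n)) + ?X n) = (\<lambda>m. ?X (m + n))" for n
      using sum_lessThan_telescope[of "\<lambda>m. ?X (m + n)"] by (auto simp: fun_eq_iff)
    have "(\<lambda>m. (\<Sum>i<m. ?X (Suc (i + n)) - ?X (i + n)) + ?X n) \<longlonglongrightarrow> (\<Sum>i. ?X (Suc (i + n)) - ?X (i + n)) + ?X n" for n
      by (intro tendsto_intros summable_LIMSEQ summable_norm_cancel[OF s])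
    then have L: "(\<lambda>m. ?X (m + n)) \<longlonglongrightarrow> (\<Sum>i. ?X (Suc (i + n)) - ?X (i + n)) + ?X n" for n
      unfolding tele .
    from L[of 0] have "convergent ?X" by (intro convergentI) simp
    then show lim: "?X \<longlonglongrightarrow> Y x \<omega>" unfolding Y_def using g by (simp add: convergent_LIMSEQ_iff)
    have "Y x \<omega> = (\<Sum>i. ?X (Suc (i + n)) - ?X (i + n)) + ?X n"
      using LIMSEQ_unique[OF LIMSEQ_ignore_initial_segment[OF lim] L] .
    then have "norm (?X n - Y x \<omega>) = norm (\<Sum>i. ?X (Suc (i + n)) - ?X (i + n))"
      by (simp add: norm_minus_commute)
    also have "\<dots> \<le> (\<Sum>i. norm (?X (Suc (i + n)) - ?X (i + n)))" by (rule summable_norm[OF s])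
    also have "\<dots> \<le> (\<Sum>k. f (k + n) \<omega>)"
      using up[OF x] by (intro suminf_le s sfn) (auto simp: norm_minus_commute)
    finally show "norm (?X n - Y x \<omega>) \<le> (\<Sum>k. f (k + n) \<omega>)" .
  qed
  have Yc: "continuous_on S (\<lambda>x. Y x \<omega>)" for \<omega>
  proof (cases "G \<omega>")
    case True
    then have sf: "summable (\<lambda>n. f n \<omega>)" using G by simp
    show ?thesis
      unfolding continuous_on_iff
    proof (intro ballI allI impI)
      fix x :: "real^2" and e :: real assume x: "x \<in> S" and e: "0 < e"
      have "(\<lambda>n. \<Sum>k. f (k + n) \<omega>) \<longlonglongrightarrow> 0" by (rule suminf_exist_split2[OF sf])
      then have "eventually (\<lambda>n. (\<Sum>k. f (k + n) \<omega>) < e / 3) sequentially"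
        by (rule order_tendstoD) (use e in simp)
      moreover have "eventually (\<lambda>n. f n \<omega> < e / 3) sequentially"
        by (rule order_tendstoD[OF summable_LIMSEQ_zero[OF sf]]) (use e in simp)
      ultimately have "eventually (\<lambda>n. (\<Sum>k. f (k + n) \<omega>) < e / 3 \<and> f n \<omega> < e / 3) sequentially"
        by (rule eventually_conj)
      from eventually_happens'[OF sequentially_bot this]
      obtain n where n: "(\<Sum>k. f (k + n) \<omega>) < e / 3" "f n \<omega> < e / 3" by blast
      show "\<exists>d>0. \<forall>x'\<in>S. dist x' x < d \<longrightarrow> dist (Y x' \<omega>) (Y x \<omega>) < e"
      proof (intro exI[of _ "1 / 2 ^ n"] conjI ballI impI)
        fix z assume z: "z \<in> S" and "dist z x < 1 / 2 ^ n"
        then have zx: "norm (x - z) < 1 / 2 ^ n" by (simp add: dist_norm norm_minus_commute)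
        have "dist (Y z \<omega>) (Y x \<omega>) \<le> dist (Y z \<omega>) (X (dyadic_round n z) \<omega>)
            + dist (X (dyadic_round n z) \<omega>) (X (dyadic_round n x) \<omega>) + dist (X (dyadic_round n x) \<omega>) (Y x \<omega>)"
          using dist_triangle[of "Y z \<omega>" "Y x \<omega>" "X (dyadic_round n z) \<omega>"]
            dist_triangle[of "X (dyadic_round n z) \<omega>" "Y x \<omega>" "X (dyadic_round n x) \<omega>"] by linarith
        then show "dist (Y z \<omega>) (Y x \<omega>) < e"
          using Ytail[OF True z, of n] Ytail[OF True x, of n] side[OF x zx, of \<omega>] n
          by (simp add: dist_norm norm_minus_commute)
      qed simp
    qed
  qed (simp add: Y_def)
  have YX: "AE \<omega> in M. Y x \<omega> = X x \<omega>" if x: "x \<in> S" for x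
  proof -
    have "norm x \<le> real (nat \<lceil>b\<rceil>)"
      using b[OF x] real_nat_ceiling_ge[of b] by (rule order_trans)
    also have "\<dots> \<le> r"
      by (simp add: r_def N_def)
    finally have xr: "norm x \<le> r" .
    have "norm (dyadic_round n x) \<le> r" for n
      using gridJ[OF floorJ[OF x] floorJ[OF x], of n 1 2] by (simp add: dyadic_round_def r_def)
    then have "(\<integral>\<^sup>+\<omega>. ennreal (norm (X (dyadic_round n x) \<omega> - X x \<omega>) ^ 4) \<partial>M) \<le> ennreal (C * norm (dyadic_round n x - x) ^ 3)" for n
      using mC xr by blast
    also have "ennreal (C * norm (dyadic_round n x - x) ^ 3) \<le> ennreal (C * (2 / 2 ^ n) ^ 3)" for n
      using C by (intro ennreal_leI mult_left_mono power_mono dyadic_round_dist) auto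
    \<comment> \<open>The decay 8^(-n) is weakened to 2^(-n), the form that the summability
      criterion expects.\<close>
    also have "ennreal (C * (2 / 2 ^ n) ^ 3) \<le> ennreal (8 * C * (1/2) ^ n)" for n
    proof (rule ennreal_leI)
      have "(2 / 2 ^ n) ^ 3 = 8 * (((1/2::real) ^ n) ^ 3)" by (simp add: power_divide)
      also have "((1/2::real) ^ n) ^ 3 \<le> (1/2) ^ n"
        using power_decreasing[of 1 3 "(1/2::real) ^ n"] by (simp add: power_le_one)
      finally have "(2 / 2 ^ n) ^ 3 \<le> 8 * (1/2 :: real) ^ n" by simp
      from mult_left_mono[OF this C] show "C * (2 / 2 ^ n) ^ 3 \<le> 8 * C * (1/2) ^ n"
        by (simp only: mult_ac)
    qed
    finally have le: "(\<integral>\<^sup>+\<omega>. ennreal (norm (X (dyadic_round n x) \<omega> - X x \<omega>) ^ 4) \<partial>M) \<le> ennreal (8 * C * (1/2) ^ n)" for n .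
    have "AE \<omega> in M. summable (\<lambda>n. norm (X (dyadic_round n x) \<omega> - X x \<omega>))"
      by (rule AE_summable_fourth_moment[OF _ _ le]) (use C in auto)
    with AEf show ?thesis
    proof eventually_elim
      case (elim \<omega>)
      have "(\<lambda>n. X (dyadic_round n x) \<omega> - X x \<omega>) \<longlonglongrightarrow> 0"
        using summable_LIMSEQ_zero[OF elim(2)] by (simp add: tendsto_norm_zero_iff)
      then have "(\<lambda>n. X (dyadic_round n x) \<omega>) \<longlonglongrightarrow> X x \<omega>" by (rule LIM_zero_cancel)
      moreover have "(\<lambda>n. X (dyadic_round n x) \<omega>) \<longlonglongrightarrow> Y x \<omega>"
        using Ylim[OF _ x] elim(1) G by simp
      ultimately show ?case by (rule LIMSEQ_unique[symmetric])
    qed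
  qed
  show ?thesis using Ym Yc YX by blast
qed

section \<open>The Green tensor near its singularity\<close>

text \<open>Convergence is required at every complex point, although only real arguments are
  evaluated: termwise differentiation and boundedness on discs are then available.\<close>

definition entire_coeffs :: "(nat \<Rightarrow> complex) \<Rightarrow> bool" where
  "entire_coeffs c \<longleftrightarrow> (\<forall>z::complex. summable (\<lambda>k. c k * z ^ k))"

definition powser :: "(nat \<Rightarrow> complex) \<Rightarrow> real \<Rightarrow> complex" where
  "powser c t = (\<Sum>k. c k * of_real t ^ k)"

lemma entire_coeffs_diffs: "entire_coeffs c \<Longrightarrow> entire_coeffs (diffs c)"
  unfolding entire_coeffs_def using termdiff_converges_all by blast

lemma entire_coeffs_add: "entire_coeffs c \<Longrightarrow> entire_coeffs d \<Longrightarrow> entire_coeffs (\<lambda>k. c k + d k)"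
  unfolding entire_coeffs_def by (simp add: distrib_right summable_add)

lemma entire_coeffs_diff: "entire_coeffs c \<Longrightarrow> entire_coeffs d \<Longrightarrow> entire_coeffs (\<lambda>k. c k - d k)"
  unfolding entire_coeffs_def by (simp add: left_diff_distrib summable_diff)

lemma entire_coeffs_mult: "entire_coeffs c \<Longrightarrow> entire_coeffs (\<lambda>k. a * c k)"
  unfolding entire_coeffs_def by (simp add: mult.assoc summable_mult)

lemma entire_coeffs_shift: "entire_coeffs c \<Longrightarrow> entire_coeffs (\<lambda>k. c (Suc k))"
  unfolding entire_coeffs_def
proof (intro allI)
  fix z :: complex assume c: "\<forall>z::complex. summable (\<lambda>k. c k * z ^ k)"
  show "summable (\<lambda>k. c (Suc k) * z ^ k)"
  proof (cases "z = 0")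
    case True
    then show ?thesis by (intro summable_finite[of "{0}"]) auto
  next
    case False
    have "summable (\<lambda>k. c (Suc k) * z ^ Suc k)" using c summable_Suc_iff[of "\<lambda>k. c k * z ^ k"] by blast
    then have "summable (\<lambda>k. c (Suc k) * z ^ Suc k * (1 / z))" by (rule summable_mult2)
    then show ?thesis using False by simp
  qed
qed

lemma powser_diff: "entire_coeffs c \<Longrightarrow> entire_coeffs d \<Longrightarrow> powser (\<lambda>k. c k - d k) t = powser c t - powser d t"
  unfolding entire_coeffs_def powser_def by (simp add: left_diff_distrib suminf_diff)

lemma powser_split_head: "entire_coeffs c \<Longrightarrow> powser c t = c 0 + of_real t * powser (\<lambda>k. c (Suc k)) t"
  using suminf_split_head[of "\<lambda>k. c k * of_real t ^ k"] entire_coeffs_shift[of c]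
    suminf_mult[of "\<lambda>k. c (Suc k) * of_real t ^ k" "of_real t"]
  unfolding entire_coeffs_def powser_def by (simp add: algebra_simps)

lemma powser_vector_derivative:
  "entire_coeffs c \<Longrightarrow> (powser c has_vector_derivative powser (diffs c) t) (at t)"
  unfolding entire_coeffs_def powser_def[abs_def]
  by (rule has_vector_derivative_real_field) (rule termdiffs_strong_converges_everywhere, blast)

text \<open>The differentiated series is again entire, hence bounded on the closed disc of radius
  \<open>T\<close>, and a bounded derivative on a convex set gives the Lipschitz constant.\<close>

lemma powser_lipschitz:
  assumes c: "entire_coeffs c"
  shows "\<exists>C\<ge>0. \<forall>s t. \<bar>s\<bar> \<le> T \<longrightarrow> \<bar>t\<bar> \<le> T \<longrightarrow> norm (powser c s) \<le> C \<and> norm (powser c s - powser c t) \<le> C * \<bar>s - t\<bar>"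
proof -
  let ?F = "\<lambda>c (z::complex). \<Sum>k. c k * z ^ k"
  have deriv: "(?F c has_field_derivative ?F (diffs c) z) (at z)" if "entire_coeffs c" for c z
    using that unfolding entire_coeffs_def by (intro termdiffs_strong_converges_everywhere) blast
  have bdd: "\<exists>B\<ge>0. \<forall>z\<in>cball 0 T. norm (?F c z) \<le> B" if c: "entire_coeffs c" for c
  proof -
    have "continuous_on (cball 0 T) (?F c)"
      using deriv[OF c] by (intro continuous_at_imp_continuous_on ballI) (rule DERIV_isCont)
    then have "bounded (?F c ` cball 0 T)"
      by (intro compact_imp_bounded compact_continuous_image) auto
    then obtain B where "B > 0" "\<forall>x\<in>?F c ` cball 0 T. norm x \<le> B"
      unfolding bounded_pos by blast
    then show ?thesis by (intro exI[of _ B]) auto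
  qed
  obtain B0 B1 where B: "B0 \<ge> 0" "\<And>z. z \<in> cball 0 T \<Longrightarrow> norm (?F c z) \<le> B0"
    "B1 \<ge> 0" "\<And>z. z \<in> cball 0 T \<Longrightarrow> norm (?F (diffs c) z) \<le> B1"
    using bdd[OF c] bdd[OF entire_coeffs_diffs[OF c]] by blast
  show ?thesis
  proof (intro exI[of _ "max B0 B1"] conjI allI impI)
    fix s t assume st: "\<bar>s\<bar> \<le> T" "\<bar>t\<bar> \<le> T"
    show "norm (powser c s) \<le> max B0 B1"
      using B(2)[of "of_real s"] st by (simp add: powser_def)
    have "norm (?F c (of_real s) - ?F c (of_real t)) \<le> B1 * norm (of_real s - of_real t :: complex)"
      by (rule field_differentiable_bound[OF convex_cball[of 0 T]])
         (use st B(4) deriv[OF c] in \<open>auto intro: has_field_derivative_at_within\<close>)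
    also have "\<dots> = B1 * \<bar>s - t\<bar>"
      by (simp flip: of_real_diff)
    also have "\<dots> \<le> max B0 B1 * \<bar>s - t\<bar>" by (intro mult_right_mono) auto
    finally show "norm (powser c s - powser c t) \<le> max B0 B1 * \<bar>s - t\<bar>" by (simp add: powser_def)
  qed (use B in auto)
qed

text \<open>Series for \<open>H\<^sub>0\<^sup>(\<^sup>1\<^sup>)(\<kappa>r)\<close> in powers of \<open>r\<^sup>2\<close>, with the logarithm split off.\<close>

definition J0_coeff :: "real \<Rightarrow> nat \<Rightarrow> real" where
  "J0_coeff \<kappa> k = (-1) ^ k * (\<kappa> / 2) ^ (2 * k) / (fact k)\<^sup>2"

text \<open>The series in \<open>bessel_Y0\<close> starts at k + 1. Here it is indexed from 0, where
  \<open>harm 0 = 0\<close> provides the additional term, and the outer minus sign makes up for the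
  shifted alternating sign.\<close>

definition Y0_coeff :: "real \<Rightarrow> nat \<Rightarrow> real" where
  "Y0_coeff \<kappa> k = - ((-1) ^ k * harm k * (\<kappa> / 2) ^ (2 * k) / (fact k)\<^sup>2)"

definition hankel_coeff :: "real \<Rightarrow> nat \<Rightarrow> complex" where
  "hankel_coeff \<kappa> k = of_real (J0_coeff \<kappa> k)
    + \<i> * of_real ((2 / pi) * (ln (\<kappa> / 2) + euler_mascheroni) * J0_coeff \<kappa> k + (2 / pi) * Y0_coeff \<kappa> k)"

definition hankel_ln_coeff :: "real \<Rightarrow> nat \<Rightarrow> complex" where
  "hankel_ln_coeff \<kappa> k = \<i> / of_real pi * of_real (J0_coeff \<kappa> k)"

text \<open>Crude, but it leaves one of the two factorials in the denominator, so the exponential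
  series remains a majorant.\<close>

lemma harm_le_fact: "harm k \<le> (fact k :: real)"
proof -
  have "harm k \<le> real k"
    unfolding harm_def using sum_bounded_above[of "{1..k}" "\<lambda>k. inverse (real k)" 1]
    by (simp add: inverse_le_1_iff)
  also have "real k \<le> fact k" using fact_ge_self[of k] by (metis of_nat_fact of_nat_le_iff)
  finally show ?thesis .
qed

lemma entire_coeffs_bounded:
  assumes "\<And>k. \<bar>c k\<bar> \<le> (\<kappa> / 2) ^ (2 * k) / fact k"
  shows "entire_coeffs (\<lambda>k. of_real (c k))"
  unfolding entire_coeffs_def
proof
  fix z :: complex
  have "summable (\<lambda>k. ((\<kappa> / 2)\<^sup>2 * norm z) ^ k /\<^sub>R fact k)"
    using summable_exp_generic[of "(\<kappa> / 2)\<^sup>2 * norm z"] by simp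
  then show "summable (\<lambda>k. complex_of_real (c k) * z ^ k)"
  proof (rule summable_comparison_test')
    fix k
    have "norm (complex_of_real (c k) * z ^ k) = \<bar>c k\<bar> * norm z ^ k"
      by (simp add: norm_mult norm_power)
    also have "\<dots> \<le> (\<kappa> / 2) ^ (2 * k) / fact k * norm z ^ k"
      by (intro mult_right_mono assms) auto
    also have "\<dots> = ((\<kappa> / 2)\<^sup>2 * norm z) ^ k /\<^sub>R fact k"
      unfolding power_mult power_mult_distrib divide_inverse real_scaleR_def by (simp only: mult_ac)
    finally show "norm (complex_of_real (c k) * z ^ k) \<le> ((\<kappa> / 2)\<^sup>2 * norm z) ^ k /\<^sub>R fact k" .
  qed
qed

lemma entire_J0_coeff: "entire_coeffs (\<lambda>k. of_real (J0_coeff \<kappa> k))"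
proof (rule entire_coeffs_bounded)
  fix k
  have "\<bar>J0_coeff \<kappa> k\<bar> = (\<kappa> / 2) ^ (2 * k) / (fact k)\<^sup>2"
    by (simp add: J0_coeff_def abs_mult power_mult)
  also have "\<dots> \<le> (\<kappa> / 2) ^ (2 * k) / fact k"
    by (intro divide_left_mono) (auto simp: power2_eq_square power_mult fact_ge_1)
  finally show "\<bar>J0_coeff \<kappa> k\<bar> \<le> (\<kappa> / 2) ^ (2 * k) / fact k" .
qed

lemma entire_Y0_coeff: "entire_coeffs (\<lambda>k. of_real (Y0_coeff \<kappa> k))"
proof (rule entire_coeffs_bounded)
  fix k
  have "\<bar>Y0_coeff \<kappa> k\<bar> = (\<kappa> / 2) ^ (2 * k) * (harm k / (fact k)\<^sup>2)"
    by (simp add: Y0_coeff_def abs_mult power_mult harm_nonneg)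
  also have "harm k / (fact k)\<^sup>2 \<le> fact k / (fact k :: real)\<^sup>2"
    by (intro divide_right_mono harm_le_fact) auto
  also have "fact k / (fact k :: real)\<^sup>2 = 1 / fact k" by (simp add: power2_eq_square)
  finally show "\<bar>Y0_coeff \<kappa> k\<bar> \<le> (\<kappa> / 2) ^ (2 * k) / fact k"
    by (simp add: power_mult mult_left_mono)
qed

lemma entire_hankel_coeffs: "entire_coeffs (hankel_coeff \<kappa>)" "entire_coeffs (hankel_ln_coeff \<kappa>)"
proof -
  have "hankel_coeff \<kappa> = (\<lambda>k. of_real (J0_coeff \<kappa> k) + (\<i> * of_real ((2 / pi) * (ln (\<kappa> / 2) + euler_mascheroni)) * of_real (J0_coeff \<kappa> k)
       + \<i> * of_real (2 / pi) * of_real (Y0_coeff \<kappa> k)))"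
    by (rule ext) (simp only: hankel_coeff_def of_real_add of_real_mult distrib_left distrib_right mult.assoc)
  then show "entire_coeffs (hankel_coeff \<kappa>)"
    by (simp only:) (intro entire_coeffs_add entire_coeffs_mult entire_J0_coeff entire_Y0_coeff)
  have "hankel_ln_coeff \<kappa> = (\<lambda>k. \<i> / of_real pi * of_real (J0_coeff \<kappa> k))"
    by (rule ext) (simp only: hankel_ln_coeff_def of_real_mult of_real_power mult.assoc)
  then show "entire_coeffs (hankel_ln_coeff \<kappa>)"
    by (simp only:) (intro entire_coeffs_mult entire_J0_coeff)
qed

lemma hankel_ln_coeff_0: "hankel_ln_coeff \<kappa> 0 = \<i> / of_real pi"
  by (simp add: hankel_ln_coeff_def J0_coeff_def)

lemma Complex_log_split:
  "Complex J ((2 / pi) * (g + L / 2 + e) * J + (2 / pi) * Y)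
    = of_real J + \<i> * (of_real ((2 / pi) * (g + e)) * of_real J + of_real (2 / pi) * of_real Y)
      + of_real L * (\<i> / of_real pi * of_real J)"
  by (simp add: complex_eq_iff Re_divide_of_real Im_divide_of_real field_simps)

text \<open>The logarithm is taken of \<open>r\<^sup>2\<close> so that everything depends on the
  single variable t = r^2, which is a polynomial in the coordinates; no square root has to be
  differentiated later.\<close>

lemma hankel0_eq_powser:
  assumes \<kappa>: "\<kappa> > 0" and r: "r > 0"
  shows "hankel0 (\<kappa> * r) = powser (hankel_coeff \<kappa>) (r\<^sup>2) + of_real (ln (r\<^sup>2)) * powser (hankel_ln_coeff \<kappa>) (r\<^sup>2)"
proof -
  have real_summable: "summable (\<lambda>k. c k * (r\<^sup>2) ^ k)" if "entire_coeffs (\<lambda>k. of_real (c k))" for c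
  proof -
    have "summable (\<lambda>k. complex_of_real (c k) * of_real (r\<^sup>2) ^ k)"
      using that unfolding entire_coeffs_def by blast
    then have "summable (\<lambda>k. complex_of_real (c k * (r\<^sup>2) ^ k))" by simp
    then show ?thesis by (rule summable_of_real_iff[THEN iffD1])
  qed
  define J where "J = (\<Sum>k. J0_coeff \<kappa> k * (r\<^sup>2) ^ k)"
  define Y where "Y = (\<Sum>k. Y0_coeff \<kappa> k * (r\<^sup>2) ^ k)"
  have sJ: "(\<lambda>k. J0_coeff \<kappa> k * (r\<^sup>2) ^ k) sums J" and sY: "(\<lambda>k. Y0_coeff \<kappa> k * (r\<^sup>2) ^ k) sums Y"
    unfolding J_def Y_def by (intro summable_sums real_summable entire_J0_coeff entire_Y0_coeff)+
  have pow: "(\<kappa> * r / 2) ^ (2 * k) = (\<kappa> / 2) ^ (2 * k) * (r\<^sup>2) ^ k" for k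
  proof -
    have "(\<kappa> * r / 2) ^ (2 * k) = ((\<kappa> / 2 * r)\<^sup>2) ^ k" by (simp only: power_mult times_divide_eq_left)
    also have "\<dots> = ((\<kappa> / 2)\<^sup>2) ^ k * (r\<^sup>2) ^ k" by (simp only: power_mult_distrib)
    finally show ?thesis by (simp only: power_mult)
  qed
  have J: "bessel_J0 (\<kappa> * r) = J"
    unfolding bessel_J0_def J_def J0_coeff_def
    by (intro suminf_cong) (simp only: pow times_divide_eq_left times_divide_eq_right mult.assoc)
  have Y: "(\<Sum>k. (-1) ^ k * harm (k + 1) * (\<kappa> * r / 2) ^ (2 * (k + 1)) / (fact (k + 1))\<^sup>2) = Y"
  proof -
    have "(\<lambda>k. Y0_coeff \<kappa> (Suc k) * (r\<^sup>2) ^ Suc k) sums Y"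
      using sY by (subst sums_Suc_iff) (simp add: Y0_coeff_def harm_def)
    moreover have "Y0_coeff \<kappa> (Suc k) * (r\<^sup>2) ^ Suc k
       = (-1) ^ k * harm (k + 1) * (\<kappa> * r / 2) ^ (2 * (k + 1)) / (fact (k + 1))\<^sup>2" for k
    proof -
      have "(\<kappa> * r / 2) ^ (2 * (k + 1)) = (\<kappa> / 2) ^ (2 * Suc k) * (r\<^sup>2) ^ Suc k"
        using pow[of "Suc k"] by (simp only: Suc_eq_plus1)
      moreover have "- ((-1) ^ Suc k * h * P / F) * Q = (-1) ^ k * h * (P * Q) / F" for h P Q F :: real
        by simp
      ultimately show ?thesis
        unfolding Y0_coeff_def Suc_eq_plus1[symmetric] by (simp only:)
    qed
    ultimately show ?thesis by (simp add: sums_iff)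
  qed
  have ln: "ln (\<kappa> * r / 2) = ln (\<kappa> / 2) + ln (r\<^sup>2) / 2"
    using \<kappa> r ln_mult_pos[of "\<kappa> / 2" r] by (simp add: ln_realpow mult.commute)
  have cJ: "(\<lambda>k. complex_of_real (J0_coeff \<kappa> k * (r\<^sup>2) ^ k)) sums of_real J"
    and cY: "(\<lambda>k. complex_of_real (Y0_coeff \<kappa> k * (r\<^sup>2) ^ k)) sums of_real Y"
    using sJ sY by (auto simp only: sums_of_real_iff)
  have A: "powser (hankel_coeff \<kappa>) (r\<^sup>2) = of_real J + \<i> * (of_real ((2 / pi) * (ln (\<kappa> / 2) + euler_mascheroni)) * of_real J + of_real (2 / pi) * of_real Y)"
  proof -
    have "(\<lambda>k. complex_of_real (J0_coeff \<kappa> k * (r\<^sup>2) ^ k) + \<i> * (of_real ((2 / pi) * (ln (\<kappa> / 2) + euler_mascheroni)) * complex_of_real (J0_coeff \<kappa> k * (r\<^sup>2) ^ k)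
        + of_real (2 / pi) * complex_of_real (Y0_coeff \<kappa> k * (r\<^sup>2) ^ k)))
      sums (of_real J + \<i> * (of_real ((2 / pi) * (ln (\<kappa> / 2) + euler_mascheroni)) * of_real J + of_real (2 / pi) * of_real Y))"
      by (intro sums_add sums_mult cJ cY)
    moreover have "(\<lambda>k. complex_of_real (J0_coeff \<kappa> k * (r\<^sup>2) ^ k) + \<i> * (of_real ((2 / pi) * (ln (\<kappa> / 2) + euler_mascheroni)) * complex_of_real (J0_coeff \<kappa> k * (r\<^sup>2) ^ k)
        + of_real (2 / pi) * complex_of_real (Y0_coeff \<kappa> k * (r\<^sup>2) ^ k))) = (\<lambda>k. hankel_coeff \<kappa> k * of_real (r\<^sup>2) ^ k)"
      by (rule ext) (simp only: hankel_coeff_def of_real_add of_real_mult of_real_power distrib_left distrib_right mult.assoc)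
    ultimately show ?thesis unfolding powser_def by (simp only: sums_iff)
  qed
  have B: "powser (hankel_ln_coeff \<kappa>) (r\<^sup>2) = \<i> / of_real pi * of_real J"
  proof -
    have "(\<lambda>k. \<i> / of_real pi * complex_of_real (J0_coeff \<kappa> k * (r\<^sup>2) ^ k)) sums (\<i> / of_real pi * of_real J)"
      by (intro sums_mult cJ)
    moreover have "(\<lambda>k. \<i> / of_real pi * complex_of_real (J0_coeff \<kappa> k * (r\<^sup>2) ^ k)) = (\<lambda>k. hankel_ln_coeff \<kappa> k * of_real (r\<^sup>2) ^ k)"
      by (rule ext) (simp only: hankel_ln_coeff_def of_real_mult of_real_power mult.assoc)
    ultimately show ?thesis unfolding powser_def by (simp only: sums_iff)
  qed
  have "bessel_Y0 (\<kappa> * r) = (2 / pi) * (ln (\<kappa> / 2) + ln (r\<^sup>2) / 2 + euler_mascheroni) * J + (2 / pi) * Y"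
    unfolding bessel_Y0_def Y J ln ..
  then show ?thesis
    unfolding hankel0_def J A B by (simp only: Complex_log_split)
qed

section \<open>Radial functions with a logarithmic singularity\<close>

definition logser :: "(nat \<Rightarrow> complex) \<Rightarrow> (nat \<Rightarrow> complex) \<Rightarrow> real \<Rightarrow> complex" where
  "logser c d t = powser c t + of_real (ln t) * powser d t"

text \<open>The last summand is \<open>powser d t / t\<close> for \<open>d 0 = 0\<close>: the pole
  produced by differentiating the logarithm is removed by the vanishing leading coefficient.\<close>

definition logser1 :: "(nat \<Rightarrow> complex) \<Rightarrow> (nat \<Rightarrow> complex) \<Rightarrow> real \<Rightarrow> complex" where
  "logser1 c d t = powser (diffs c) t + of_real (ln t) * powser (diffs d) t + powser (\<lambda>k. d (Suc k)) t"

text \<open>The factor 1 / t cannot be removed here. In the Hessian it is multiplied by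
  \<open>z $ i * z $ j\<close>, which makes it bounded.\<close>

definition logser2 :: "(nat \<Rightarrow> complex) \<Rightarrow> (nat \<Rightarrow> complex) \<Rightarrow> real \<Rightarrow> complex" where
  "logser2 c d t = powser (diffs (diffs c)) t + of_real (ln t) * powser (diffs (diffs d)) t
     + of_real (1 / t) * powser (diffs d) t + powser (diffs (\<lambda>k. d (Suc k))) t"

lemma ln_of_real_vector_derivative:
  "t > 0 \<Longrightarrow> ((\<lambda>t. complex_of_real (ln t)) has_vector_derivative of_real (1 / t)) (at t)"
  by (intro has_vector_derivative_of_real)
     (auto simp: has_real_derivative_iff_has_vector_derivative[symmetric] intro!: derivative_eq_intros)

lemma logser_derivative:
  assumes c: "entire_coeffs c" and d: "entire_coeffs d" and d0: "d 0 = 0" and t: "t > 0"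
  shows "(logser c d has_vector_derivative logser1 c d t) (at t)"
proof -
  have "((\<lambda>t. powser c t + of_real (ln t) * powser d t) has_vector_derivative
      powser (diffs c) t + (of_real (ln t) * powser (diffs d) t + of_real (1 / t) * powser d t)) (at t)"
    by (intro has_vector_derivative_add has_vector_derivative_mult powser_vector_derivative c d
        ln_of_real_vector_derivative t)
  moreover have "of_real (1 / t) * powser d t = powser (\<lambda>k. d (Suc k)) t"
    using powser_split_head[OF d, of t] d0 t by simp
  ultimately show ?thesis
    by (simp only: logser1_def logser_def[abs_def] add.assoc)
qed

lemma logser1_derivative:
  assumes c: "entire_coeffs c" and d: "entire_coeffs d" and t: "t > 0"
  shows "(logser1 c d has_vector_derivative logser2 c d t) (at t)"
proof -
  have "((\<lambda>t. powser (diffs c) t + of_real (ln t) * powser (diffs d) t + powser (\<lambda>k. d (Suc k)) t) has_vector_derivative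
      powser (diffs (diffs c)) t + (of_real (ln t) * powser (diffs (diffs d)) t + of_real (1 / t) * powser (diffs d) t)
        + powser (diffs (\<lambda>k. d (Suc k))) t) (at t)"
    by (intro has_vector_derivative_add has_vector_derivative_mult powser_vector_derivative
        entire_coeffs_diffs entire_coeffs_shift c d ln_of_real_vector_derivative t)
  then show ?thesis
    by (simp only: logser2_def logser1_def[abs_def] add.assoc)
qed

lemma inner_line_derivative:
  "((\<lambda>t. (z + t *\<^sub>R axis j 1) \<bullet> (z + t *\<^sub>R axis j 1)) has_vector_derivative 2 * z $ j) (at (0::real))"
  for z :: "real^2"
proof -
  have "(\<lambda>t. (z + t *\<^sub>R axis j 1) \<bullet> (z + t *\<^sub>R axis j 1)) = (\<lambda>t. z \<bullet> z + 2 * z $ j * t + t\<^sup>2)"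
    by (auto simp: fun_eq_iff inner_add_left inner_add_right inner_axis inner_axis' power2_eq_square algebra_simps)
  moreover have "((\<lambda>t. z \<bullet> z + 2 * z $ j * t + t\<^sup>2) has_vector_derivative 2 * z $ j) (at 0)"
    by (auto simp: has_real_derivative_iff_has_vector_derivative[symmetric] intro!: derivative_eq_intros)
  ultimately show ?thesis by simp
qed

lemma radial_line_derivative:
  fixes z :: "real^2"
  assumes "(f has_vector_derivative f') (at (z \<bullet> z))"
  shows "((\<lambda>t. f ((z + t *\<^sub>R axis j 1) \<bullet> (z + t *\<^sub>R axis j 1))) has_vector_derivative (2 * z $ j) *\<^sub>R f') (at 0)"
proof -
  have "(f \<circ> (\<lambda>t. (z + t *\<^sub>R axis j 1) \<bullet> (z + t *\<^sub>R axis j 1)) has_vector_derivative (2 * z $ j) *\<^sub>R f') (at 0)"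
    by (rule vector_diff_chain_at[OF inner_line_derivative]) (use assms in simp)
  then show ?thesis by (simp add: o_def)
qed

context
  fixes c d :: "nat \<Rightarrow> complex" and \<phi> :: "real^2 \<Rightarrow> complex" and y :: "real^2"
  assumes c: "entire_coeffs c" and d: "entire_coeffs d" and d0: "d 0 = 0"
    and \<phi>: "\<And>z. z \<noteq> y \<Longrightarrow> \<phi> z = logser c d ((z - y) \<bullet> (z - y))"
begin

lemma open_line: "open {t::real. x + t *\<^sub>R axis j (1::real) \<noteq> y}"
  by (intro open_Collect_neq continuous_intros)

lemma partial_deriv_radial:
  assumes x: "x \<noteq> y"
  shows "partial_deriv \<phi> j x = (2 * (x - y) $ j) *\<^sub>R logser1 c d ((x - y) \<bullet> (x - y))"
proof -
  have "(x - y) \<bullet> (x - y) > 0" using x by simp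
  from radial_line_derivative[OF logser_derivative[OF c d d0 this], of j]
  have "((\<lambda>t. logser c d ((x + t *\<^sub>R axis j 1 - y) \<bullet> (x + t *\<^sub>R axis j 1 - y)))
      has_vector_derivative (2 * (x - y) $ j) *\<^sub>R logser1 c d ((x - y) \<bullet> (x - y))) (at 0)"
    by (simp add: algebra_simps)
  then have "((\<lambda>t. \<phi> (x + t *\<^sub>R axis j 1)) has_vector_derivative (2 * (x - y) $ j) *\<^sub>R logser1 c d ((x - y) \<bullet> (x - y))) (at 0)"
    by (rule has_vector_derivative_transform_within_open[OF _ open_line[of x j]]) (use x \<phi> in auto)
  then show ?thesis
    unfolding partial_deriv_def by (rule vector_derivative_at)
qed

text \<open>The Hessian of f(|z|^2) is 2 f' on the diagonal plus 4 z_i z_j f''. The formula for the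
  first derivative holds off \<open>y\<close>, hence along a short piece of the axis line through
  \<open>x\<close>, where it may be differentiated again.\<close>

lemma partial_deriv2_radial:
  assumes x: "x \<noteq> y"
  shows "partial_deriv (partial_deriv \<phi> j) i x
    = (if i = j then 2 * logser1 c d ((x - y) \<bullet> (x - y)) else 0)
      + of_real (4 * (x - y) $ i * (x - y) $ j) * logser2 c d ((x - y) \<bullet> (x - y))"
proof -
  let ?t = "(x - y) \<bullet> (x - y)"
  have t: "?t > 0" using x by simp
  have A: "((\<lambda>t. 2 * ((x - y) $ j + t * (axis i 1 :: real^2) $ j)) has_field_derivative 2 * (axis i 1 :: real^2) $ j) (at 0)"
    by (auto intro!: derivative_eq_intros)
  have B: "((\<lambda>t. logser1 c d ((x + t *\<^sub>R axis i 1 - y) \<bullet> (x + t *\<^sub>R axis i 1 - y)))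
      has_vector_derivative (2 * (x - y) $ i) *\<^sub>R logser2 c d ?t) (at 0)"
    using radial_line_derivative[OF logser1_derivative[OF c d t], of i] by (simp add: algebra_simps)
  have "((\<lambda>t. (2 * ((x - y) $ j + t * (axis i 1 :: real^2) $ j)) *\<^sub>R logser1 c d ((x + t *\<^sub>R axis i 1 - y) \<bullet> (x + t *\<^sub>R axis i 1 - y)))
      has_vector_derivative ((2 * ((x - y) $ j + 0 * (axis i 1 :: real^2) $ j)) *\<^sub>R ((2 * (x - y) $ i) *\<^sub>R logser2 c d ?t)
        + (2 * (axis i 1 :: real^2) $ j) *\<^sub>R logser1 c d ((x + 0 *\<^sub>R axis i 1 - y) \<bullet> (x + 0 *\<^sub>R axis i 1 - y)))) (at 0)"
    by (rule has_vector_derivative_scaleR[OF A B])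
  then have "((\<lambda>t. partial_deriv \<phi> j (x + t *\<^sub>R axis i 1))
      has_vector_derivative ((2 * ((x - y) $ j + 0 * (axis i 1 :: real^2) $ j)) *\<^sub>R ((2 * (x - y) $ i) *\<^sub>R logser2 c d ?t)
        + (2 * (axis i 1 :: real^2) $ j) *\<^sub>R logser1 c d ((x + 0 *\<^sub>R axis i 1 - y) \<bullet> (x + 0 *\<^sub>R axis i 1 - y)))) (at 0)"
  proof (rule has_vector_derivative_transform_within_open[OF _ open_line[of x i]])
    fix t assume "t \<in> {t::real. x + t *\<^sub>R axis i (1::real) \<noteq> y}"
    then have ne: "x + t *\<^sub>R axis i 1 \<noteq> y" by simp
    have eq: "(x + t *\<^sub>R axis i 1 - y) $ j = (x - y) $ j + t * (axis i 1 :: real^2) $ j" by simp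
    show "(2 * ((x - y) $ j + t * (axis i 1 :: real^2) $ j)) *\<^sub>R
        logser1 c d ((x + t *\<^sub>R axis i 1 - y) \<bullet> (x + t *\<^sub>R axis i 1 - y))
      = partial_deriv \<phi> j (x + t *\<^sub>R axis i 1)"
      unfolding partial_deriv_radial[OF ne] eq ..
  qed (use x in simp)
  from vector_derivative_at[OF this] show ?thesis
    unfolding partial_deriv_def[of "partial_deriv \<phi> j"]
    by (auto simp: axis_def scaleR_conv_of_real algebra_simps)
qed

end

text \<open>The Green tensor with its derivatives carried out, as a function of z = x - y alone. It
  represents the tensor only away from \<open>z = 0\<close>.\<close>

definition green_kernel :: "real \<Rightarrow> real \<Rightarrow> real \<Rightarrow> 2 \<Rightarrow> 2 \<Rightarrow> real^2 \<Rightarrow> complex" where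
  "green_kernel lam mu om i j z =
    (let ks = om / sqrt mu; kp = om / sqrt (lam + 2 * mu); t = z \<bullet> z;
         c = (\<lambda>k. hankel_coeff ks k - hankel_coeff kp k); d = (\<lambda>k. hankel_ln_coeff ks k - hankel_ln_coeff kp k)
     in (if i = j then \<i> / (4 * of_real mu) * logser (hankel_coeff ks) (hankel_ln_coeff ks) t else 0)
       + \<i> / (4 * of_real (om\<^sup>2)) * ((if i = j then 2 * logser1 c d t else 0) + of_real (4 * z $ i * z $ j) * logser2 c d t))"

lemma green_navier_eq_kernel:
  assumes om: "om > 0" and mu: "mu > 0" and lm: "lam + mu > 0" and x: "x \<noteq> y"
  shows "green_navier lam mu om x y $ i $ j = green_kernel lam mu om i j (x - y)"
proof -
  define ks where "ks = om / sqrt mu"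
  define kp where "kp = om / sqrt (lam + 2 * mu)"
  have ks: "ks > 0" and kp: "kp > 0" using om mu lm by (auto simp: ks_def kp_def)
  define c where "c = (\<lambda>k. hankel_coeff ks k - hankel_coeff kp k)"
  define d where "d = (\<lambda>k. hankel_ln_coeff ks k - hankel_ln_coeff kp k)"
  define \<phi> where "\<phi> = (\<lambda>z. hankel0 (ks * norm (z - y)) - hankel0 (kp * norm (z - y)))"
  have h: "hankel0 (\<kappa> * norm (z - y)) = logser (hankel_coeff \<kappa>) (hankel_ln_coeff \<kappa>) ((z - y) \<bullet> (z - y))"
    if "\<kappa> > 0" "z \<noteq> y" for \<kappa> z
    using hankel0_eq_powser[OF that(1), of "norm (z - y)"] that(2)
    by (simp add: logser_def power2_norm_eq_inner)
  have c: "entire_coeffs c" and d: "entire_coeffs d"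
    unfolding c_def d_def by (intro entire_coeffs_diff entire_hankel_coeffs)+
  have d0: "d 0 = 0" by (simp add: d_def hankel_ln_coeff_0)
  have \<phi>: "\<phi> z = logser c d ((z - y) \<bullet> (z - y))" if "z \<noteq> y" for z
    unfolding \<phi>_def h[OF ks that] h[OF kp that] logser_def c_def d_def
    by (simp add: powser_diff entire_hankel_coeffs algebra_simps)
  show ?thesis
    unfolding green_navier_def green_kernel_def Let_def ks_def[symmetric] kp_def[symmetric]
      c_def[symmetric] d_def[symmetric] \<phi>_def[symmetric]
    by (simp add: partial_deriv2_radial[OF c d d0 \<phi> x] h[OF ks x])
qed

section \<open>Hoelder continuity with a singular weight\<close>

definition lipschitz_bdd :: "real \<Rightarrow> (real^2 \<Rightarrow> complex) \<Rightarrow> bool" where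
  "lipschitz_bdd R g \<longleftrightarrow> (\<exists>C\<ge>0. \<forall>z z'. norm z \<le> R \<longrightarrow> norm z' \<le> R \<longrightarrow>
      norm (g z) \<le> C \<and> norm (g z - g z') \<le> C * norm (z - z'))"

text \<open>The Green tensor is only logarithmically singular, but its gradient blows up like \<open>1/|z|\<close>. This class
  interpolates between the two; the exponent \<open>3/4\<close> is large enough for the continuity criterion
  and small enough for the weight to be square integrable in the plane.\<close>

definition sing_holder :: "real \<Rightarrow> (real^2 \<Rightarrow> complex) \<Rightarrow> bool" where
  "sing_holder R f \<longleftrightarrow> (\<exists>C\<ge>0. \<forall>z z'. z \<noteq> 0 \<longrightarrow> z' \<noteq> 0 \<longrightarrow> norm z \<le> R \<longrightarrow> norm z' \<le> R \<longrightarrow>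
      norm (f z) \<le> C * norm z powr (-3/4) \<and>
      norm (f z - f z') \<le> C * norm (z - z') powr (3/4) * (norm z powr (-3/4) + norm z' powr (-3/4)))"

lemma lipschitz_bddI:
  "0 \<le> C \<Longrightarrow> (\<And>z. norm z \<le> R \<Longrightarrow> norm (g z) \<le> C) \<Longrightarrow>
   (\<And>z z'. norm z \<le> R \<Longrightarrow> norm z' \<le> R \<Longrightarrow> norm (g z - g z') \<le> C * norm (z - z')) \<Longrightarrow> lipschitz_bdd R g"
  unfolding lipschitz_bdd_def by blast

lemma lipschitz_bddE:
  assumes "lipschitz_bdd R g"
  obtains C where "0 \<le> C" "\<And>z. norm z \<le> R \<Longrightarrow> norm (g z) \<le> C"
    "\<And>z z'. norm z \<le> R \<Longrightarrow> norm z' \<le> R \<Longrightarrow> norm (g z - g z') \<le> C * norm (z - z')"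
  using assms unfolding lipschitz_bdd_def by blast

lemma sing_holderE:
  assumes "sing_holder R g"
  obtains C where "0 \<le> C" "\<And>z. z \<noteq> 0 \<Longrightarrow> norm z \<le> R \<Longrightarrow> norm (g z) \<le> C * norm z powr (-3/4)"
    "\<And>z z'. z \<noteq> 0 \<Longrightarrow> z' \<noteq> 0 \<Longrightarrow> norm z \<le> R \<Longrightarrow> norm z' \<le> R \<Longrightarrow>
      norm (g z - g z') \<le> C * norm (z - z') powr (3/4) * (norm z powr (-3/4) + norm z' powr (-3/4))"
  using assms unfolding sing_holder_def by blast

text \<open>On the punctured ball of radius \<open>R\<close> the weight is bounded below, so
  constants can be absorbed into it.\<close>

lemma one_le_powr_weight:
  assumes "1 \<le> R" "z \<noteq> 0" "norm (z::real^2) \<le> R"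
  shows "1 \<le> R * norm z powr (-3/4)"
proof -
  have "1 = norm z powr (3/4) * norm z powr (-3/4)"
    using assms by (simp flip: powr_add)
  also have "\<dots> \<le> R * norm z powr (-3/4)"
  proof (rule mult_right_mono)
    have "norm z powr (3/4) \<le> R powr (3/4)" using assms by (intro powr_mono2) auto
    also have "\<dots> \<le> R powr 1" using assms by (intro powr_mono) auto
    finally show "norm z powr (3/4) \<le> R" using assms by simp
  qed simp
  finally show ?thesis .
qed

text \<open>Comparison with one reference point \<open>e\<close> of norm 1 turns the increment bound
  into the size bound, so only increments have to be checked.\<close>

lemma sing_holderI:
  assumes R: "1 \<le> R" and C: "0 \<le> C"
    and h: "\<And>z z'. z \<noteq> 0 \<Longrightarrow> z' \<noteq> 0 \<Longrightarrow> norm z \<le> R \<Longrightarrow> norm z' \<le> R \<Longrightarrow>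
      norm (f z - f z') \<le> C * norm (z - z') powr (3/4) * (norm z powr (-3/4) + norm z' powr (-3/4))"
  shows "sing_holder R f"
proof -
  define e :: "real^2" where "e = axis 1 1"
  have e: "norm e = 1" "e \<noteq> 0" by (auto simp: e_def axis_eq_0_iff)
  define K where "K = norm (f e) * R + C * (2 * R) powr (3/4) * (1 + R)"
  have KC: "0 \<le> K" unfolding K_def using R C by (intro add_nonneg_nonneg mult_nonneg_nonneg) auto
  have size: "norm (f z) \<le> K * norm z powr (-3/4)" if z: "z \<noteq> 0" "norm z \<le> R" for z
  proof -
    let ?w = "norm z powr (-3/4)"
    have w: "1 \<le> R * ?w" by (rule one_le_powr_weight[OF R z])
    have "norm (f z) \<le> norm (f e) + norm (f z - f e)"
      using norm_triangle_ineq[of "f e" "f z - f e"] by simp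
    also have "norm (f z - f e) \<le> C * norm (z - e) powr (3/4) * (?w + norm e powr (-3/4))"
      by (rule h) (use z e R in auto)
    also have "\<dots> \<le> C * (2 * R) powr (3/4) * (?w + R * ?w)"
    proof (rule mult_mono)
      have "norm (z - e) \<le> 2 * R" using norm_triangle_ineq4[of z e] z e R by linarith
      then show "C * norm (z - e) powr (3/4) \<le> C * (2 * R) powr (3/4)"
        using C by (intro mult_left_mono powr_mono2) auto
      show "?w + norm e powr (-3/4) \<le> ?w + R * ?w" using w e by simp
    qed (use C in auto)
    also have "norm (f e) \<le> norm (f e) * (R * ?w)"
      using w mult_left_mono[OF w, of "norm (f e)"] by simp
    finally show ?thesis
      by (simp add: K_def algebra_simps)
  qed
  show ?thesis
    unfolding sing_holder_def
  proof (intro exI[of _ "max K C"] conjI allI impI)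
    show "0 \<le> max K C" using C by simp
    fix z z' :: "real^2" assume z: "z \<noteq> 0" "z' \<noteq> 0" "norm z \<le> R" "norm z' \<le> R"
    have "norm (f z) \<le> K * norm z powr (-3/4)" by (rule size) fact+
    also have "\<dots> \<le> max K C * norm z powr (-3/4)" by (intro mult_right_mono) auto
    finally show "norm (f z) \<le> max K C * norm z powr (-3/4)" .
    have "norm (f z - f z') \<le> C * norm (z - z') powr (3/4) * (norm z powr (-3/4) + norm z' powr (-3/4))"
      by (rule h) fact+
    also have "\<dots> \<le> max K C * norm (z - z') powr (3/4) * (norm z powr (-3/4) + norm z' powr (-3/4))"
      by (intro mult_right_mono) auto
    finally show "norm (f z - f z') \<le> max K C * norm (z - z') powr (3/4) * (norm z powr (-3/4) + norm z' powr (-3/4))" .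
  qed
qed

lemma sing_holder_add:
  assumes R: "1 \<le> R" and "sing_holder R f" "sing_holder R g"
  shows "sing_holder R (\<lambda>z. f z + g z)"
proof -
  obtain A where A: "0 \<le> A" "\<And>z z'. z \<noteq> 0 \<Longrightarrow> z' \<noteq> 0 \<Longrightarrow> norm z \<le> R \<Longrightarrow> norm z' \<le> R \<Longrightarrow>
      norm (f z - f z') \<le> A * norm (z - z') powr (3/4) * (norm z powr (-3/4) + norm z' powr (-3/4))"
    using sing_holderE[OF assms(2)] by metis
  obtain B where B: "0 \<le> B" "\<And>z z'. z \<noteq> 0 \<Longrightarrow> z' \<noteq> 0 \<Longrightarrow> norm z \<le> R \<Longrightarrow> norm z' \<le> R \<Longrightarrow>
      norm (g z - g z') \<le> B * norm (z - z') powr (3/4) * (norm z powr (-3/4) + norm z' powr (-3/4))"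
    using sing_holderE[OF assms(3)] by metis
  show ?thesis
  proof (rule sing_holderI[OF R, of "A + B"])
    fix z z' :: "real^2" assume z: "z \<noteq> 0" "z' \<noteq> 0" "norm z \<le> R" "norm z' \<le> R"
    have "norm (f z + g z - (f z' + g z')) \<le> norm (f z - f z') + norm (g z - g z')"
      using norm_triangle_ineq[of "f z - f z'" "g z - g z'"] by (simp add: algebra_simps)
    with A(2)[OF z] B(2)[OF z]
    show "norm (f z + g z - (f z' + g z')) \<le> (A + B) * norm (z - z') powr (3/4) * (norm z powr (-3/4) + norm z' powr (-3/4))"
      by (simp add: distrib_right)
  qed (use A B in auto)
qed

lemma le_powr_three_quarters:
  assumes "0 \<le> u" "u \<le> (1::real)"
  shows "u \<le> u powr (3/4)"
proof (cases "u = 0")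
  case False
  then show ?thesis using assms powr_mono'[of "3/4" 1 u] by simp
qed simp

text \<open>Divided by 2 R the distance is at most 1, and there passing to the power 3/4 can only
  increase it. This turns Lipschitz bounds into Hoelder bounds.\<close>

lemma dist_le_powr:
  assumes "1 \<le> R" "norm (z::real^2) \<le> R" "norm z' \<le> R"
  shows "norm (z - z') \<le> 2 * R * norm (z - z') powr (3/4)"
proof -
  have le: "norm (z - z') \<le> 2 * R" using norm_triangle_ineq4[of z z'] assms by linarith
  then have "norm (z - z') / (2 * R) \<le> (norm (z - z') / (2 * R)) powr (3/4)"
    using assms by (intro le_powr_three_quarters) auto
  also have "\<dots> = norm (z - z') powr (3/4) / (2 * R) powr (3/4)"
    by (rule powr_divide)
  also have "\<dots> \<le> norm (z - z') powr (3/4) / 1"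
    using assms by (intro divide_left_mono) (auto intro: ge_one_powr_ge_zero)
  finally show ?thesis using assms by (simp add: pos_divide_le_eq mult.commute)
qed

text \<open>The second factor must be bounded and Lipschitz: two singular factors would multiply
  their weights, whose square need not be integrable.\<close>

lemma sing_holder_mult:
  assumes R: "1 \<le> R" and "sing_holder R f" "lipschitz_bdd R g"
  shows "sing_holder R (\<lambda>z. f z * g z)"
proof -
  obtain A where A: "0 \<le> A" "\<And>z. z \<noteq> 0 \<Longrightarrow> norm z \<le> R \<Longrightarrow> norm (f z) \<le> A * norm z powr (-3/4)"
     "\<And>z z'. z \<noteq> 0 \<Longrightarrow> z' \<noteq> 0 \<Longrightarrow> norm z \<le> R \<Longrightarrow> norm z' \<le> R \<Longrightarrow>
      norm (f z - f z') \<le> A * norm (z - z') powr (3/4) * (norm z powr (-3/4) + norm z' powr (-3/4))"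
    using sing_holderE[OF assms(2)] by metis
  obtain B where B: "0 \<le> B" "\<And>z. norm z \<le> R \<Longrightarrow> norm (g z) \<le> B"
    "\<And>z z'. norm z \<le> R \<Longrightarrow> norm z' \<le> R \<Longrightarrow> norm (g z - g z') \<le> B * norm (z - z')"
    using lipschitz_bddE[OF assms(3)] by metis
  show ?thesis
  proof (rule sing_holderI[OF R, of "A * B + A * B * (2 * R)"])
    show "0 \<le> A * B + A * B * (2 * R)" using A B R by simp
    fix z z' :: "real^2" assume z: "z \<noteq> 0" "z' \<noteq> 0" "norm z \<le> R" "norm z' \<le> R"
    let ?w = "norm z powr (-3/4)" and ?w' = "norm z' powr (-3/4)" and ?d = "norm (z - z') powr (3/4)"
    have "f z * g z - f z' * g z' = (f z - f z') * g z + f z' * (g z - g z')"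
      by (simp add: algebra_simps)
    then have "norm (f z * g z - f z' * g z') \<le> norm (f z - f z') * norm (g z) + norm (f z') * norm (g z - g z')"
      using norm_triangle_ineq[of "(f z - f z') * g z" "f z' * (g z - g z')"] by (simp add: norm_mult)
    also have "\<dots> \<le> (A * ?d * (?w + ?w')) * B + (A * ?w') * (B * (2 * R * ?d))"
    proof (intro add_mono mult_mono)
      have "norm (g z - g z') \<le> B * norm (z - z')" by (rule B(3)) fact+
      also have "\<dots> \<le> B * (2 * R * ?d)" using B z dist_le_powr[OF R] by (intro mult_left_mono) auto
      finally show "norm (g z - g z') \<le> B * (2 * R * ?d)" .
    qed (use A B z in auto)
    also have "\<dots> \<le> (A * ?d * (?w + ?w')) * B + (A * (?w + ?w')) * (B * (2 * R * ?d))"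
      using A B R by (intro add_left_mono mult_right_mono mult_left_mono) auto
    also have "\<dots> = (A * B + A * B * (2 * R)) * ?d * (?w + ?w')"
      by (simp add: algebra_simps)
    finally show "norm (f z * g z - f z' * g z') \<le> (A * B + A * B * (2 * R)) * ?d * (?w + ?w')" .
  qed
qed

lemma sing_holder_const: "1 \<le> R \<Longrightarrow> sing_holder R (\<lambda>_. c)"
  by (rule sing_holderI[where C=0]) auto

lemma lipschitz_bdd_mult:
  assumes "lipschitz_bdd R f" "lipschitz_bdd R g"
  shows "lipschitz_bdd R (\<lambda>z. f z * g z)"
proof -
  obtain A where A: "0 \<le> A" "\<And>z. norm z \<le> R \<Longrightarrow> norm (f z) \<le> A"
    "\<And>z z'. norm z \<le> R \<Longrightarrow> norm z' \<le> R \<Longrightarrow> norm (f z - f z') \<le> A * norm (z - z')"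
    using lipschitz_bddE[OF assms(1)] by metis
  obtain B where B: "0 \<le> B" "\<And>z. norm z \<le> R \<Longrightarrow> norm (g z) \<le> B"
    "\<And>z z'. norm z \<le> R \<Longrightarrow> norm z' \<le> R \<Longrightarrow> norm (g z - g z') \<le> B * norm (z - z')"
    using lipschitz_bddE[OF assms(2)] by metis
  show ?thesis
  proof (rule lipschitz_bddI[of "2 * (A * B)"])
    fix z z' :: "real^2" assume z: "norm z \<le> R" "norm z' \<le> R"
    have "norm (f z * g z) \<le> A * B" unfolding norm_mult using A B z by (intro mult_mono) auto
    then show "norm (f z * g z) \<le> 2 * (A * B)" using mult_nonneg_nonneg[OF A(1) B(1)] by linarith
    have "f z * g z - f z' * g z' = (f z - f z') * g z + f z' * (g z - g z')"
      by (simp add: algebra_simps)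
    then have "norm (f z * g z - f z' * g z') \<le> norm (f z - f z') * norm (g z) + norm (f z') * norm (g z - g z')"
      using norm_triangle_ineq[of "(f z - f z') * g z" "f z' * (g z - g z')"] by (simp add: norm_mult)
    also have "\<dots> \<le> (A * norm (z - z')) * B + A * (B * norm (z - z'))"
      using A B z by (intro add_mono mult_mono) auto
    finally show "norm (f z * g z - f z' * g z') \<le> 2 * (A * B) * norm (z - z')"
      by (simp add: algebra_simps)
  qed (use A B in auto)
qed

lemma lipschitz_bdd_const: "lipschitz_bdd R (\<lambda>_. c)"
  by (rule lipschitz_bddI[of "norm c"]) auto

lemma lipschitz_bdd_coord: "0 \<le> R \<Longrightarrow> lipschitz_bdd R (\<lambda>z. of_real (z $ i))"
proof (rule lipschitz_bddI[of "max R 1"])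
  fix z z' :: "real^2"
  show "norm (complex_of_real (z $ i)) \<le> max R 1" if "norm z \<le> R"
    using component_le_norm_cart[of z i] that by simp
  have "norm (complex_of_real (z $ i) - of_real (z' $ i)) = \<bar>(z - z') $ i\<bar>"
    by (simp flip: of_real_diff)
  also have "\<dots> \<le> 1 * norm (z - z')" using component_le_norm_cart[of "z - z'" i] by simp
  also have "\<dots> \<le> max R 1 * norm (z - z')" by (intro mult_right_mono) auto
  finally show "norm (complex_of_real (z $ i) - of_real (z' $ i)) \<le> max R 1 * norm (z - z')" .
qed auto

lemma lipschitz_bdd_powser:
  assumes c: "entire_coeffs c" and R: "0 \<le> R"
  shows "lipschitz_bdd R (\<lambda>z. powser c (z \<bullet> z))"
proof -
  obtain C where C: "C \<ge> 0" "\<And>s t. \<bar>s\<bar> \<le> R\<^sup>2 \<Longrightarrow> \<bar>t\<bar> \<le> R\<^sup>2 \<Longrightarrow> norm (powser c s) \<le> C"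
    "\<And>s t. \<bar>s\<bar> \<le> R\<^sup>2 \<Longrightarrow> \<bar>t\<bar> \<le> R\<^sup>2 \<Longrightarrow> norm (powser c s - powser c t) \<le> C * \<bar>s - t\<bar>"
    using powser_lipschitz[OF c, of "R\<^sup>2"] by blast
  have t: "\<bar>z \<bullet> z\<bar> \<le> R\<^sup>2" if "norm z \<le> R" for z :: "real^2"
    using that by (simp add: power2_norm_eq_inner[symmetric] power_mono)
  show ?thesis
  proof (rule lipschitz_bddI[of "max C (C * (2 * R))"])
    fix z z' :: "real^2" assume z: "norm z \<le> R" "norm z' \<le> R"
    have "z \<bullet> z - z' \<bullet> z' = (norm z + norm z') * (norm z - norm z')"
      by (simp add: power2_norm_eq_inner[symmetric] power2_eq_square algebra_simps)
    then have "\<bar>z \<bullet> z - z' \<bullet> z'\<bar> = \<bar>norm z + norm z'\<bar> * \<bar>norm z - norm z'\<bar>"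
      by (simp only: abs_mult)
    also have "\<dots> \<le> (2 * R) * norm (z - z')"
      using z norm_triangle_ineq3[of z z'] R by (intro mult_mono) auto
    finally have "C * \<bar>z \<bullet> z - z' \<bullet> z'\<bar> \<le> C * ((2 * R) * norm (z - z'))"
      using C(1) by (intro mult_left_mono)
    also have "\<dots> \<le> max C (C * (2 * R)) * norm (z - z')"
      by (simp only: mult.assoc[symmetric]) (intro mult_right_mono; simp)
    finally show "norm (powser c (z \<bullet> z) - powser c (z' \<bullet> z')) \<le> max C (C * (2 * R)) * norm (z - z')"
      using C(3)[OF t[OF z(1)] t[OF z(2)]] by linarith
  next
    fix z :: "real^2" assume "norm z \<le> R"
    then show "norm (powser c (z \<bullet> z)) \<le> max C (C * (2 * R))"
      using C(2)[OF t t, of z z] by simp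
  qed (use C in auto)
qed

text \<open>For u \<le> 1 the logarithm is at most u, hence at most u^(3/4). For u > 1 the general
  power bound for ln (2 u), together with 2^(3/4) \<le> 2, gives 8/3, rounded up to 4.\<close>

lemma ln_one_plus_le:
  assumes "0 \<le> (u::real)"
  shows "ln (1 + u) \<le> 4 * u powr (3/4)"
proof (cases "u \<le> 1")
  case True
  have "ln (1 + u) \<le> u" using ln_add_one_self_le_self[OF assms] .
  also have "\<dots> \<le> u powr (3/4)" using True assms by (rule le_powr_three_quarters[rotated])
  also have "\<dots> \<le> 4 * u powr (3/4)" by simp
  finally show ?thesis .
next
  case False
  then have u: "1 < u" by simp
  have "ln (1 + u) \<le> ln (2 * u)" using u by simp
  also have "\<dots> \<le> (2 * u) powr (3/4) / (3/4)" using u by (intro ln_powr_bound) auto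
  also have "(2 * u) powr (3/4) = 2 powr (3/4) * u powr (3/4)" using u by (simp add: powr_mult)
  also have "2 powr (3/4) * u powr (3/4) / (3/4) \<le> 2 * u powr (3/4) / (3/4)"
    using powr_mono[of "3/4" 1 "2::real"] by (intro divide_right_mono mult_right_mono) auto
  also have "\<dots> \<le> 4 * u powr (3/4)" by simp
  finally show ?thesis .
qed

text \<open>The quotient of the norms is at most 1 + u with u = |z - z'| / |z|, and u^(3/4) splits
  into the Hoelder factor and the weight at the smaller point.\<close>

lemma ln_norm_diff_le:
  assumes "z \<noteq> 0" "norm z \<le> norm (z'::real^2)"
  shows "ln (norm z') - ln (norm z) \<le> 4 * norm (z - z') powr (3/4) * norm z powr (-3/4)"
proof -
  let ?u = "norm (z - z') / norm z"
  have z': "z' \<noteq> 0" using assms by auto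
  have "norm z' \<le> norm z + norm (z - z')"
    using norm_triangle_ineq4[of z "z - z'"] by simp
  then have "norm z' / norm z \<le> 1 + ?u" using assms by (simp add: field_simps)
  moreover have "0 < norm z' / norm z" using assms by (auto intro!: divide_pos_pos simp: less_le_trans[of 0 "norm z"])
  ultimately have "ln (norm z' / norm z) \<le> ln (1 + ?u)" by (subst ln_le_cancel_iff) auto
  also have "\<dots> \<le> 4 * ?u powr (3/4)" by (intro ln_one_plus_le) simp
  also have "?u powr (3/4) = norm (z - z') powr (3/4) * norm z powr (-3/4)"
    using assms by (simp add: powr_divide powr_minus_divide)
  finally show ?thesis
    using assms z' by (simp add: ln_div mult.assoc)
qed

lemma sing_holder_ln: "1 \<le> R \<Longrightarrow> sing_holder R (\<lambda>z. of_real (ln (z \<bullet> z)))"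
proof (rule sing_holderI[of R 8])
  fix z z' :: "real^2" assume z: "z \<noteq> 0" "z' \<noteq> 0"
  let ?w = "norm z powr (-3/4)" and ?w' = "norm z' powr (-3/4)" and ?d = "norm (z - z') powr (3/4)"
  have ln: "ln (z \<bullet> z) = 2 * ln (norm z)" if "z \<noteq> 0" for z :: "real^2"
    using that by (simp add: power2_norm_eq_inner[symmetric] ln_realpow)
  have "\<bar>ln (norm z) - ln (norm z')\<bar> \<le> 4 * ?d * (?w + ?w')"
  proof (cases "norm z \<le> norm z'")
    case True
    then have "ln (norm z) \<le> ln (norm z')" using z by simp
    then have "\<bar>ln (norm z) - ln (norm z')\<bar> \<le> 4 * ?d * ?w"
      using ln_norm_diff_le[OF z(1) True] by simp
    also have "\<dots> \<le> 4 * ?d * (?w + ?w')" by (intro mult_left_mono) auto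
    finally show ?thesis .
  next
    case False
    then have "ln (norm z') \<le> ln (norm z)" using z by simp
    then have "\<bar>ln (norm z) - ln (norm z')\<bar> \<le> 4 * ?d * ?w'"
      using ln_norm_diff_le[OF z(2), of z] False by (simp add: norm_minus_commute)
    also have "\<dots> \<le> 4 * ?d * (?w + ?w')" by (intro mult_left_mono) auto
    finally show ?thesis .
  qed
  then show "norm (complex_of_real (ln (z \<bullet> z)) - of_real (ln (z' \<bullet> z'))) \<le> 8 * ?d * (?w + ?w')"
    by (simp add: ln[OF z(1)] ln[OF z(2)] flip: of_real_diff right_diff_distrib)
qed auto

text \<open>With u = |z - z'| / |z| the difference is at most 2 u and also at most 2. The first
  serves for u \<le> 1, the second for u \<ge> 1, and in both cases 2 u^(3/4) is an upper
  bound.\<close>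

lemma unit_vector_diff_le:
  fixes z z' :: "real^2"
  assumes z: "z \<noteq> 0" "z' \<noteq> 0"
  shows "\<bar>z $ i / norm z - z' $ i / norm z'\<bar> \<le> 2 * norm (z - z') powr (3/4) * norm z powr (-3/4)"
proof -
  let ?u = "norm (z - z') / norm z"
  have c: "\<bar>x $ i / norm x\<bar> \<le> 1" for x :: "real^2"
    using component_le_norm_cart[of x i] by (auto simp: abs_divide divide_le_eq_1)
  have "\<bar>z $ i / norm z - z' $ i / norm z'\<bar> \<le> 2 * ?u"
  proof -
    have "z $ i / norm z - z' $ i / norm z' = (z - z') $ i / norm z + (z' $ i / norm z') * ((norm z' - norm z) / norm z)"
      using z by (simp add: field_simps)
    then have "\<bar>z $ i / norm z - z' $ i / norm z'\<bar>
        \<le> \<bar>(z - z') $ i / norm z\<bar> + \<bar>z' $ i / norm z'\<bar> * \<bar>(norm z' - norm z) / norm z\<bar>"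
      by (metis abs_mult abs_triangle_ineq)
    also have "\<dots> \<le> ?u + 1 * ?u"
    proof (intro add_mono mult_mono c)
      show "\<bar>(z - z') $ i / norm z\<bar> \<le> ?u"
        using component_le_norm_cart[of "z - z'" i] by (simp add: abs_divide divide_right_mono)
      show "\<bar>(norm z' - norm z) / norm z\<bar> \<le> ?u"
        using norm_triangle_ineq3[of z' z] by (simp add: abs_divide divide_right_mono norm_minus_commute)
    qed auto
    finally show ?thesis by simp
  qed
  moreover have "\<bar>z $ i / norm z - z' $ i / norm z'\<bar> \<le> 2"
    using c[of z] c[of z'] by linarith
  moreover have "?u \<le> ?u powr (3/4) \<or> 1 \<le> ?u powr (3/4)"
    using le_powr_three_quarters[of ?u] ge_one_powr_ge_zero[of ?u "3/4"] by fastforce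
  ultimately have "\<bar>z $ i / norm z - z' $ i / norm z'\<bar> \<le> 2 * ?u powr (3/4)" by linarith
  also have "?u powr (3/4) = norm (z - z') powr (3/4) * norm z powr (-3/4)"
    using z by (simp add: powr_divide powr_minus_divide)
  finally show ?thesis by simp
qed

lemma sing_holder_angular: "1 \<le> R \<Longrightarrow> sing_holder R (\<lambda>z. of_real (z $ i * z $ j / (z \<bullet> z)))"
proof (rule sing_holderI[of R 4])
  fix z z' :: "real^2" assume z: "z \<noteq> 0" "z' \<noteq> 0"
  let ?w = "norm z powr (-3/4)" and ?w' = "norm z' powr (-3/4)" and ?d = "norm (z - z') powr (3/4)"
  define u where "u i = z $ i / norm z" for i
  define u' where "u' i = z' $ i / norm z'" for i
  have eq: "z $ i * z $ j / (z \<bullet> z) = u i * u j" "z' $ i * z' $ j / (z' \<bullet> z') = u' i * u' j"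
    by (simp_all add: u_def u'_def power2_norm_eq_inner[symmetric] power2_eq_square)
  have c: "\<bar>u i\<bar> \<le> 1" "\<bar>u' i\<bar> \<le> 1" for i
    using component_le_norm_cart[of z i] component_le_norm_cart[of z' i]
    by (auto simp: u_def u'_def abs_divide divide_le_eq_1)
  have d: "\<bar>u i - u' i\<bar> \<le> 2 * ?d * ?w" for i
    unfolding u_def u'_def by (rule unit_vector_diff_le[OF z])
  have "u i * u j - u' i * u' j = (u i - u' i) * u j + u' i * (u j - u' j)"
    by (simp add: algebra_simps)
  then have "\<bar>u i * u j - u' i * u' j\<bar> \<le> \<bar>u i - u' i\<bar> * \<bar>u j\<bar> + \<bar>u' i\<bar> * \<bar>u j - u' j\<bar>"
    by (metis abs_mult abs_triangle_ineq)
  also have "\<dots> \<le> (2 * ?d * ?w) * 1 + 1 * (2 * ?d * ?w)"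
    by (intro add_mono mult_mono c d) auto
  also have "\<dots> \<le> 4 * ?d * (?w + ?w')" by (simp add: algebra_simps)
  finally show "norm (complex_of_real (z $ i * z $ j / (z \<bullet> z)) - of_real (z' $ i * z' $ j / (z' \<bullet> z'))) \<le> 4 * ?d * (?w + ?w')"
    unfolding eq by (simp only: of_real_diff[symmetric] norm_of_real)
qed auto

lemma sing_holder_lipschitz: "1 \<le> R \<Longrightarrow> lipschitz_bdd R g \<Longrightarrow> sing_holder R g"
  using sing_holder_mult[OF _ sing_holder_const[of R 1], of g] by simp

lemma sing_holder_cmult: "1 \<le> R \<Longrightarrow> sing_holder R f \<Longrightarrow> sing_holder R (\<lambda>z. c * f z)"
  using sing_holder_mult[OF _ _ lipschitz_bdd_const[of R c], of f] by (simp add: mult.commute)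

lemma sing_holder_if: "sing_holder R f \<Longrightarrow> sing_holder R g \<Longrightarrow> sing_holder R (\<lambda>z. if P then f z else g z)"
  by (cases P) auto

lemma sing_holder_logser:
  assumes R: "1 \<le> R" and c: "entire_coeffs c" "entire_coeffs d"
  shows "sing_holder R (\<lambda>z. logser c d (z \<bullet> z))"
  unfolding logser_def
  by (intro sing_holder_add sing_holder_lipschitz lipschitz_bdd_powser sing_holder_mult sing_holder_ln c R)
     (use R in auto)

lemma sing_holder_green_kernel:
  assumes R: "1 \<le> R"
  shows "sing_holder R (green_kernel lam mu om i j)"
proof -
  define ks where "ks = om / sqrt mu"
  define kp where "kp = om / sqrt (lam + 2 * mu)"
  define c where "c = (\<lambda>k. hankel_coeff ks k - hankel_coeff kp k)"
  define d where "d = (\<lambda>k. hankel_ln_coeff ks k - hankel_ln_coeff kp k)"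
  have R0: "0 \<le> R" using R by simp
  have c: "entire_coeffs c" and d: "entire_coeffs d"
    unfolding c_def d_def by (intro entire_coeffs_diff entire_hankel_coeffs)+
  note ds = entire_coeffs_diffs entire_coeffs_shift c d
  have L: "lipschitz_bdd R (\<lambda>z. powser e (z \<bullet> z))" if "entire_coeffs e" for e
    by (rule lipschitz_bdd_powser[OF that R0])
  have l1: "sing_holder R (\<lambda>z. logser1 c d (z \<bullet> z))"
    unfolding logser1_def
    by (intro sing_holder_add[OF R] sing_holder_lipschitz[OF R] L sing_holder_mult[OF R] sing_holder_ln[OF R] ds)
  have zz: "lipschitz_bdd R (\<lambda>z. of_real (z $ i) * of_real (z $ j))"
    by (intro lipschitz_bdd_mult lipschitz_bdd_coord R0)
  \<comment> \<open>The factor \<open>z $ i * z $ j\<close> is distributed over the summands of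
    \<open>logser2\<close> so that 1 / t meets it and forms the angular term, while elsewhere it is
    a Lipschitz factor.\<close>
  define P where "P z = (powser (diffs (diffs c)) (z \<bullet> z) + of_real (ln (z \<bullet> z)) * powser (diffs (diffs d)) (z \<bullet> z)
     + powser (diffs (\<lambda>k. d (Suc k))) (z \<bullet> z)) * (of_real (z $ i) * of_real (z $ j))
     + of_real (z $ i * z $ j / (z \<bullet> z)) * powser (diffs d) (z \<bullet> z)" for z :: "real^2"
  have "sing_holder R P"
    unfolding P_def
    by (intro sing_holder_add[OF R] sing_holder_lipschitz[OF R] L sing_holder_mult[OF R] sing_holder_ln[OF R]
       sing_holder_angular[OF R] zz ds)
  then have "sing_holder R (\<lambda>z. 4 * P z)"
    by (rule sing_holder_cmult[OF R])
  moreover have "(\<lambda>z. 4 * P z) = (\<lambda>z. of_real (4 * z $ i * z $ j) * logser2 c d (z \<bullet> z))"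
    by (rule ext) (simp add: P_def logser2_def algebra_simps)
  ultimately have l2: "sing_holder R (\<lambda>z. of_real (4 * z $ i * z $ j) * logser2 c d (z \<bullet> z))"
    by simp
  have eq: "green_kernel lam mu om i j = (\<lambda>z. (if i = j then \<i> / (4 * of_real mu) * logser (hankel_coeff ks) (hankel_ln_coeff ks) (z \<bullet> z) else 0)
       + \<i> / (4 * of_real (om\<^sup>2)) * ((if i = j then 2 * logser1 c d (z \<bullet> z) else 0) + of_real (4 * z $ i * z $ j) * logser2 c d (z \<bullet> z)))"
    by (simp add: fun_eq_iff green_kernel_def Let_def ks_def kp_def c_def d_def)
  show ?thesis
    unfolding eq
    by (intro sing_holder_add[OF R] sing_holder_cmult[OF R] sing_holder_if sing_holder_logser[OF R]
        entire_hankel_coeffs l1 l2 sing_holder_const[OF R])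
qed

section \<open>Approximation by test functions\<close>

text \<open>The functions p(1/x) exp(-1/x) on the positive half-line, extended by 0, are closed
  under differentiation; one derivative formula therefore yields derivatives of every order.\<close>

definition flat_exp :: "real poly \<Rightarrow> real \<Rightarrow> real" where
  "flat_exp p x = (if 0 < x then poly p (1 / x) * exp (- (1 / x)) else 0)"

text \<open>With y = 1/x, the derivative of p(y) exp(-y) in x is y^2 (p - p')(y) exp(-y).\<close>

definition flat_deriv :: "real poly \<Rightarrow> real poly" where
  "flat_deriv p = [:0, 0, 1:] * (p - pderiv p)"

lemma poly_exp_tendsto_0: "((\<lambda>y. poly p y * exp (- y)) \<longlongrightarrow> (0::real)) at_top"
proof (induction p)
  case (pCons a p)
  have t: "((\<lambda>y::real. y ^ k * exp (- y)) \<longlongrightarrow> 0) at_top" for k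
    using tendsto_power_div_exp_0[of k] by (simp add: exp_minus divide_inverse)
  have "((\<lambda>y. \<Sum>i\<le>degree (pCons a p). coeff (pCons a p) i * (y ^ i * exp (- y))) \<longlongrightarrow> (\<Sum>i\<le>degree (pCons a p). coeff (pCons a p) i * 0)) at_top"
    by (intro tendsto_intros t)
  then show ?case
    by (simp add: poly_altdef sum_distrib_right mult.assoc del: poly_pCons)
qed simp

lemma flat_exp_deriv: "(flat_exp p has_real_derivative flat_exp (flat_deriv p) x) (at x)"
proof -
  consider "x > 0" | "x < 0" | "x = 0" by linarith
  then show ?thesis
  proof cases
    case 1
    have "((\<lambda>x. poly p (1 / x) * exp (- (1 / x))) has_real_derivative
        poly (flat_deriv p) (1 / x) * exp (- (1 / x))) (at x)"
      using 1 by (auto intro!: derivative_eq_intros DERIV_chain2[OF poly_DERIV]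
          simp: flat_deriv_def power2_eq_square divide_simps algebra_simps)
    then have "((\<lambda>x. poly p (1 / x) * exp (- (1 / x))) has_real_derivative flat_exp (flat_deriv p) x) (at x)"
      using 1 by (simp add: flat_exp_def)
    then show ?thesis
      by (rule has_field_derivative_transform_within_open[where S="{0<..}"])
         (use 1 in \<open>auto simp: flat_exp_def\<close>)
  next
    case 2
    have "((\<lambda>x. 0) has_real_derivative flat_exp (flat_deriv p) x) (at x)"
      using 2 by (simp add: flat_exp_def)
    then show ?thesis
      by (rule has_field_derivative_transform_within_open[where S="{..<0}"])
         (use 2 in \<open>auto simp: flat_exp_def\<close>)
  next
    case 3
    \<comment> \<open>At the origin the right difference quotient has an additional factor 1/h,
      which raises the polynomial from \<open>p\<close> to \<open>pCons 0 p\<close>.\<close>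
    have lim: "((\<lambda>h. poly (pCons 0 p) (inverse h) * exp (- inverse h)) \<longlongrightarrow> (0::real)) (at_right 0)"
      by (rule filterlim_compose[OF poly_exp_tendsto_0 filterlim_inverse_at_top_right])
    have "((\<lambda>h. (flat_exp p (0 + h) - flat_exp p 0) / h) \<longlongrightarrow> 0) (at 0)"
    proof (rule filterlim_split_at)
      show "((\<lambda>h. (flat_exp p (0 + h) - flat_exp p 0) / h) \<longlongrightarrow> 0) (at_left 0)"
        by (rule tendsto_eventually) (auto simp: flat_exp_def eventually_at_filter)
      show "((\<lambda>h. (flat_exp p (0 + h) - flat_exp p 0) / h) \<longlongrightarrow> 0) (at_right 0)"
        by (rule Lim_transform_eventually[OF lim])
           (auto simp: flat_exp_def eventually_at_filter divide_simps)
    qed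
    then show ?thesis
      using 3 by (simp add: DERIV_def flat_exp_def)
  qed
qed

text \<open>A class containing polynomials and cut-off functions that directional derivatives do not
  leave. Differentiability of all iterated partial derivatives follows by structural induction,
  without computing them.\<close>

inductive smooth_alg :: "(real^2 \<Rightarrow> complex) \<Rightarrow> bool" where
  const: "smooth_alg (\<lambda>_. c)"
| coord: "smooth_alg (\<lambda>x. of_real (x $ i))"
| flat: "smooth_alg (\<lambda>x. of_real (flat_exp p (u * x $ i + v)))"
| add: "smooth_alg f \<Longrightarrow> smooth_alg g \<Longrightarrow> smooth_alg (\<lambda>x. f x + g x)"
| mult: "smooth_alg f \<Longrightarrow> smooth_alg g \<Longrightarrow> smooth_alg (\<lambda>x. f x * g x)"

lemma smooth_alg_differentiable: "smooth_alg f \<Longrightarrow> f differentiable (at x)"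
proof (induction rule: smooth_alg.induct)
  case (coord i)
  have "((\<lambda>x. complex_of_real (x $ i)) has_derivative (\<lambda>x. complex_of_real (x $ i))) (at x)"
    by (intro bounded_linear_imp_has_derivative bounded_linear_compose[OF bounded_linear_of_real] bounded_linear_vec_nth)
  then show ?case by (auto simp: differentiable_def)
next
  case (flat p u i v)
  have "((\<lambda>x. u * x $ i + v) has_derivative (\<lambda>x. u * x $ i)) (at x)"
    by (auto intro!: derivative_eq_intros bounded_linear_imp_has_derivative bounded_linear_vec_nth)
  from has_derivative_compose[OF this flat_exp_deriv[unfolded has_field_derivative_def]]
  have "((\<lambda>x. complex_of_real (flat_exp p (u * x $ i + v))) has_derivative
      (\<lambda>h. complex_of_real (flat_exp (flat_deriv p) (u * x $ i + v) * (u * h $ i)))) (at x)"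
    by (rule has_derivative_of_real)
  then show ?case by (auto simp: differentiable_def)
next
  case (mult f g)
  then obtain f' g' where "(f has_derivative f') (at x)" "(g has_derivative g') (at x)"
    unfolding differentiable_def by blast
  from has_derivative_mult[OF this] show ?case unfolding differentiable_def by blast
qed auto

text \<open>The derivative is exhibited as a member of the class: a flat generator turns into one
  with polynomial \<open>flat_deriv p\<close> times a constant, and products follow the Leibniz
  rule.\<close>

lemma smooth_alg_directional:
  "smooth_alg f \<Longrightarrow> \<exists>g. smooth_alg g \<and> (\<forall>x. ((\<lambda>t. f (x + t *\<^sub>R axis j 1)) has_vector_derivative g x) (at 0))"
proof (induction rule: smooth_alg.induct)
  case (const c)
  show ?case by (intro exI[of _ "\<lambda>_. 0"] conjI smooth_alg.const) auto
next
  case (coord i)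
  have "((\<lambda>t. complex_of_real ((x + t *\<^sub>R axis j 1) $ i)) has_vector_derivative of_real ((axis j 1 :: real^2) $ i)) (at 0)" for x :: "real^2"
    by (intro has_vector_derivative_of_real)
       (auto simp: has_real_derivative_iff_has_vector_derivative[symmetric] intro!: derivative_eq_intros)
  then show ?case by (intro exI[of _ "\<lambda>_. of_real ((axis j 1 :: real^2) $ i)"] conjI smooth_alg.const) auto
next
  case (flat p u i v)
  have "((\<lambda>t. complex_of_real (flat_exp p (u * (x + t *\<^sub>R axis j 1) $ i + v))) has_vector_derivative
      of_real (flat_exp (flat_deriv p) (u * x $ i + v)) * of_real (u * (axis j 1 :: real^2) $ i)) (at 0)" for x :: "real^2"
  proof -
    have "((\<lambda>t. u * (x + t *\<^sub>R axis j 1) $ i + v) has_real_derivative u * (axis j 1 :: real^2) $ i) (at 0)"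
      by (auto intro!: derivative_eq_intros)
    from DERIV_chain2[OF flat_exp_deriv this]
    have "((\<lambda>t. flat_exp p (u * (x + t *\<^sub>R axis j 1) $ i + v)) has_real_derivative
      flat_exp (flat_deriv p) (u * x $ i + v) * (u * (axis j 1 :: real^2) $ i)) (at 0)" by simp
    from has_vector_derivative_of_real[OF this] show ?thesis by simp
  qed
  then show ?case
    by (intro exI[of _ "\<lambda>x. of_real (flat_exp (flat_deriv p) (u * x $ i + v)) * of_real (u * (axis j 1 :: real^2) $ i)"] conjI
        smooth_alg.mult smooth_alg.flat smooth_alg.const) auto
next
  case (add f g)
  then obtain f' g' where "smooth_alg f'" "\<And>x. ((\<lambda>t. f (x + t *\<^sub>R axis j 1)) has_vector_derivative f' x) (at 0)"
    "smooth_alg g'" "\<And>x. ((\<lambda>t. g (x + t *\<^sub>R axis j 1)) has_vector_derivative g' x) (at 0)" by metis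
  then show ?case
    by (intro exI[of _ "\<lambda>x. f' x + g' x"] conjI smooth_alg.add allI has_vector_derivative_add) auto
next
  case (mult f g)
  then obtain f' g' where fg: "smooth_alg f'" "\<And>x. ((\<lambda>t. f (x + t *\<^sub>R axis j 1)) has_vector_derivative f' x) (at 0)"
    "smooth_alg g'" "\<And>x. ((\<lambda>t. g (x + t *\<^sub>R axis j 1)) has_vector_derivative g' x) (at 0)" by metis
  have "((\<lambda>t. f (x + t *\<^sub>R axis j 1) * g (x + t *\<^sub>R axis j 1)) has_vector_derivative f x * g' x + f' x * g x) (at 0)" for x
    using has_vector_derivative_mult[OF fg(2)[of x] fg(4)[of x]] by simp
  with fg mult.hyps show ?case
    by (intro exI[of _ "\<lambda>x. f x * g' x + f' x * g x"] conjI smooth_alg.add smooth_alg.mult allI) auto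
qed

lemma smooth_alg_iter_partial: "smooth_alg f \<Longrightarrow> smooth_alg (iter_partial js f)"
proof (induction js)
  case (Cons j js)
  then obtain g where g: "smooth_alg g"
    "\<And>x. ((\<lambda>t. iter_partial js f (x + t *\<^sub>R axis j 1)) has_vector_derivative g x) (at 0)"
    using smooth_alg_directional by blast
  have "partial_deriv (iter_partial js f) j = g"
    unfolding partial_deriv_def fun_eq_iff using g(2) by (auto intro: vector_derivative_at)
  then show ?case using g(1) by simp
qed simp

lemma smooth_alg_smooth_fun: "smooth_alg f \<Longrightarrow> smooth_fun f"
  unfolding smooth_fun_def using smooth_alg_differentiable smooth_alg_iter_partial by blast

lemma real_polynomial_smooth_alg: "real_polynomial_function q \<Longrightarrow> smooth_alg (\<lambda>x. of_real (q x))"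
proof (induction rule: real_polynomial_function.induct)
  case (linear f)
  have lin: "f x = f (axis 1 1) * x $ 1 + f (axis 2 1) * x $ 2" for x
  proof -
    interpret bounded_linear f by fact
    have "x = x $ 1 *\<^sub>R axis 1 1 + x $ 2 *\<^sub>R axis 2 1" by (simp add: vec_eq_iff forall_2 axis_def)
    then have "f x = f (x $ 1 *\<^sub>R axis 1 1 + x $ 2 *\<^sub>R axis 2 1)" by (rule arg_cong)
    then show ?thesis by (simp add: add scaleR)
  qed
  have "(\<lambda>x. complex_of_real (f x)) = (\<lambda>x. of_real (f (axis 1 1)) * of_real (x $ 1) + of_real (f (axis 2 1)) * of_real (x $ 2))"
    by (rule ext, subst lin, simp only: of_real_add of_real_mult)
  then show ?case by (simp only:) (intro smooth_alg.intros)
qed (auto intro: smooth_alg.intros)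

lemma polynomial_smooth_alg:
  fixes p :: "real^2 \<Rightarrow> complex"
  assumes "polynomial_function p"
  shows "smooth_alg p"
proof -
  have "real_polynomial_function (Re \<circ> p)" "real_polynomial_function (Im \<circ> p)"
    using assms bounded_linear_Re bounded_linear_Im unfolding polynomial_function_def by blast+
  then have "smooth_alg (\<lambda>x. of_real (Re (p x)) + \<i> * of_real (Im (p x)))"
    using real_polynomial_smooth_alg[of "Re \<circ> p"] real_polynomial_smooth_alg[of "Im \<circ> p"]
    by (intro smooth_alg.add smooth_alg.mult smooth_alg.const) (simp_all add: o_def)
  moreover have "(\<lambda>x. of_real (Re (p x)) + \<i> * of_real (Im (p x))) = p"
    by (rule ext) (rule complex_eq[symmetric])
  ultimately show ?thesis by simp
qed

text \<open>The arguments have the shape \<open>u * x $ i + v\<close> of the generator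
  \<open>flat\<close>. What matters is only that the function is positive exactly inside the box and
  never exceeds 1.\<close>

definition bump :: "real^2 \<Rightarrow> real^2 \<Rightarrow> real^2 \<Rightarrow> real" where
  "bump a b x = flat_exp 1 (1 * x $ 1 + (- a $ 1)) * flat_exp 1 ((-1) * x $ 1 + b $ 1)
    * (flat_exp 1 (1 * x $ 2 + (- a $ 2)) * flat_exp 1 ((-1) * x $ 2 + b $ 2))"

lemma bump_smooth: "smooth_alg (\<lambda>x. of_real (bump a b x))"
  unfolding bump_def of_real_mult by (intro smooth_alg.mult smooth_alg.flat)

lemma flat_exp_1: "0 \<le> flat_exp 1 y" "flat_exp 1 y \<le> 1" "flat_exp 1 y > 0 \<longleftrightarrow> y > 0"
  by (auto simp: flat_exp_def)

lemma bump_le: "0 \<le> bump a b x" "bump a b x \<le> 1"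
  unfolding bump_def by (auto intro!: mult_nonneg_nonneg mult_le_one flat_exp_1)

lemma bump_pos: "bump a b x > 0 \<longleftrightarrow> x \<in> box a b"
proof -
  have "bump a b x > 0 \<longleftrightarrow> bump a b x \<noteq> 0" using bump_le(1)[of a b x] by linarith
  also have "\<dots> \<longleftrightarrow> flat_exp 1 (x $ 1 - a $ 1) > 0 \<and> flat_exp 1 (b $ 1 - x $ 1) > 0
      \<and> flat_exp 1 (x $ 2 - a $ 2) > 0 \<and> flat_exp 1 (b $ 2 - x $ 2) > 0"
    using flat_exp_1(1)[of "x $ 1 - a $ 1"] flat_exp_1(1)[of "b $ 1 - x $ 1"]
      flat_exp_1(1)[of "x $ 2 - a $ 2"] flat_exp_1(1)[of "b $ 2 - x $ 2"]
    by (auto simp: bump_def less_le)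
  also have "\<dots> \<longleftrightarrow> x \<in> box a b"
    unfolding flat_exp_1 by (auto simp: mem_box_cart forall_2)
  finally show ?thesis .
qed

section \<open>Density of test functions\<close>

lemma continuous_on_smooth_alg: "smooth_alg f \<Longrightarrow> continuous_on S f"
  by (intro differentiable_imp_continuous_on) (simp add: differentiable_on_def differentiable_at_withinI smooth_alg_differentiable)

text \<open>Weierstrass approximation takes the place of mollification: the quotient of
  \<open>\<phi>\<close> by the cut-off function is continuous on the closed box, and a polynomial
  close to it is multiplied back. As the cut-off is at most 1, the error does not grow.\<close>

lemma test_fun_uniform_approx:
  fixes \<phi> :: "real^2 \<Rightarrow> complex"
  assumes c: "continuous_on UNIV \<phi>" and K: "compact K" "K \<subseteq> box a b" "\<And>x. x \<notin> K \<Longrightarrow> \<phi> x = 0" and e: "0 < e"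
  shows "\<exists>\<psi>. test_fun \<psi> \<and> (\<forall>x. norm (\<psi> x - \<phi> x) \<le> e * indicator (box a b) x)"
proof -
  let ?\<chi> = "\<lambda>x. complex_of_real (bump a b x)"
  define h where "h x = \<phi> x / ?\<chi> x" for x
  \<comment> \<open>Inside the box the denominator is positive; off \<open>K\<close> the numerator
    is 0 and so is the quotient, whatever the denominator. Both sets are open and together cover the
    plane.\<close>
  have "continuous_on (box a b \<union> - K) h"
  proof (rule continuous_on_open_Un)
    show "continuous_on (box a b) h"
      unfolding h_def
      by (intro continuous_on_divide continuous_on_subset[OF c] continuous_on_smooth_alg bump_smooth)
         (use bump_pos[of a b] in \<open>auto simp: less_le\<close>)
    have "continuous_on (- K) (\<lambda>_. 0 :: complex)" by simp
    then show "continuous_on (- K) h"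
      by (rule continuous_on_eq) (use K in \<open>auto simp: h_def\<close>)
  qed (use K compact_imp_closed in auto)
  moreover have "box a b \<union> - K = UNIV" using K by auto
  ultimately have "continuous_on (cbox a b) h" using continuous_on_subset by blast
  then obtain p where p: "polynomial_function p" "\<And>x. x \<in> cbox a b \<Longrightarrow> norm (h x - p x) < e"
    using Stone_Weierstrass_polynomial_function[of "cbox a b" h e] e by auto
  define \<psi> where "\<psi> x = p x * ?\<chi> x" for x
  have out: "bump a b x = 0" if "x \<notin> box a b" for x
    using bump_pos[of a b x] bump_le(1)[of a b x] that by linarith
  have "smooth_alg \<psi>" unfolding \<psi>_def by (intro smooth_alg.mult polynomial_smooth_alg p bump_smooth)
  moreover have "compact_support_in UNIV \<psi>"
    unfolding compact_support_in_def
    by (intro exI[of _ "cbox a b"]) (use out box_subset_cbox in \<open>auto simp: \<psi>_def\<close>)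
  ultimately have "test_fun \<psi>" by (simp add: test_fun_def smooth_alg_smooth_fun)
  moreover have "norm (\<psi> x - \<phi> x) \<le> e * indicator (box a b) x" for x
  proof (cases "x \<in> box a b")
    case True
    then have b: "bump a b x > 0" using bump_pos by blast
    have "\<psi> x - \<phi> x = (p x - h x) * ?\<chi> x" using b by (simp add: \<psi>_def h_def left_diff_distrib)
    then have "norm (\<psi> x - \<phi> x) = norm (h x - p x) * bump a b x"
      using b by (simp add: norm_mult norm_minus_commute)
    also have "\<dots> \<le> e * 1"
      using p(2)[of x] True box_subset_cbox bump_le e by (intro mult_mono) (auto intro: less_imp_le)
    finally show ?thesis using True by simp
  next
    case False
    then have "\<phi> x = 0" using K by auto
    then show ?thesis using False out by (simp add: \<psi>_def)
  qed
  ultimately show ?thesis by blast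
qed

lemma test_fun_sqnorm_approx:
  fixes \<phi> :: "real^2 \<Rightarrow> complex"
  assumes c: "continuous_on UNIV \<phi>" and K: "compact K" "K \<subseteq> box a b" "\<And>x. x \<notin> K \<Longrightarrow> \<phi> x = 0" and e: "0 < e"
  shows "\<exists>\<psi>. test_fun \<psi> \<and> sqnorm (\<lambda>x. \<psi> x - \<phi> x) \<le> ennreal e"
proof -
  define V where "V = measure lborel (box a b)"
  have V: "emeasure lborel (box a b) = ennreal V"
    unfolding V_def by (rule emeasure_eq_ennreal_measure) (use emeasure_lborel_box_finite[of a b] in auto)
  have V0: "0 \<le> V" by (simp add: V_def)
  \<comment> \<open>Chosen so that \<open>d\<^sup>2 * V \<le> e\<close>; adding 1 to the volume
    covers an empty box.\<close>
  define d where "d = sqrt (e / (V + 1))"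
  have d: "0 < d" using e V0 by (simp add: d_def)
  obtain \<psi> where \<psi>: "test_fun \<psi>" "\<And>x. norm (\<psi> x - \<phi> x) \<le> d * indicator (box a b) x"
    using test_fun_uniform_approx[OF c K d] by blast
  have "sqnorm (\<lambda>x. \<psi> x - \<phi> x) \<le> (\<integral>\<^sup>+x. ennreal (d\<^sup>2) * indicator (box a b) x \<partial>lebesgue)"
    unfolding sqnorm_def
  proof (rule nn_integral_mono)
    fix x
    have "(norm (\<psi> x - \<phi> x))\<^sup>2 \<le> (d * indicator (box a b) x)\<^sup>2"
      by (intro power_mono \<psi>) auto
    then show "ennreal ((norm (\<psi> x - \<phi> x))\<^sup>2) \<le> ennreal (d\<^sup>2) * indicator (box a b) x"
      using ennreal_leI by (auto split: split_indicator)
  qed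
  also have "\<dots> = ennreal (d\<^sup>2) * ennreal V"
    by (simp add: nn_integral_completion nn_integral_cmult_indicator V)
  also have "\<dots> = ennreal (e / (V + 1) * V)"
    using e V0 by (simp add: d_def real_sqrt_pow2 ennreal_mult'[symmetric])
  also have "\<dots> \<le> ennreal e"
    using e V0 by (intro ennreal_leI) (simp add: field_simps)
  finally show ?thesis using \<psi>(1) by blast
qed

text \<open>A function with one square integrable singularity is first cut off near that point.\<close>

lemma test_fun_sqnorm_approx_singular:
  fixes \<phi> :: "real^2 \<Rightarrow> complex"
  assumes c: "continuous_on (- {x}) \<phi>" and K: "compact K" "K \<subseteq> box a b" "\<And>y. y \<notin> K \<Longrightarrow> \<phi> y = 0"
    and m: "\<phi> \<in> borel_measurable lebesgue" and fin: "sqnorm \<phi> < \<infinity>" and e: "0 < e"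
  shows "\<exists>\<psi>. test_fun \<psi> \<and> sqnorm (\<lambda>y. \<psi> y - \<phi> y) \<le> ennreal e"
proof -
  \<comment> \<open>Zero within distance 1/n of \<open>x\<close>, one beyond distance 2/n, and
    linear in the distance in between.\<close>
  define \<theta> where "\<theta> n y = max 0 (min 1 (real n * norm (x - y) - 1))" for n :: nat and y
  define \<phi>' where "\<phi>' n y = of_real (\<theta> n y) * \<phi> y" for n y
  have \<theta>c: "continuous_on S (\<theta> n)" for n S unfolding \<theta>_def by (intro continuous_intros)
  have \<theta>01: "0 \<le> \<theta> n y" "\<theta> n y \<le> 1" for n y by (auto simp: \<theta>_def)
  have \<theta>m [measurable]: "\<theta> n \<in> borel_measurable lebesgue" for n
    by (intro measurable_completion) (use borel_measurable_continuous_onI[OF \<theta>c] in simp)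
  note [measurable] = m
  have cont: "continuous_on UNIV (\<phi>' n)" if n: "n > 0" for n
  proof -
    have "continuous_on (- {x} \<union> ball x (1 / n)) (\<phi>' n)"
    proof (rule continuous_on_open_Un)
      show "continuous_on (- {x}) (\<phi>' n)"
        unfolding \<phi>'_def by (intro continuous_intros c \<theta>c)
      have "continuous_on (ball x (1 / n)) (\<lambda>_. 0 :: complex)" by simp
      then show "continuous_on (ball x (1 / n)) (\<phi>' n)"
      proof (rule continuous_on_eq)
        fix y assume "y \<in> ball x (1 / n)"
        then have "real n * norm (x - y) < 1" using n by (simp add: dist_norm field_simps)
        then show "0 = \<phi>' n y" by (simp add: \<phi>'_def \<theta>_def)
      qed
    qed auto
    moreover have "- {x} \<union> ball x (1 / n) = UNIV" using n by auto
    ultimately show ?thesis by simp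
  qed
  have "(\<lambda>n. sqnorm (\<lambda>y. \<phi>' n y - \<phi> y)) \<longlonglongrightarrow> (\<integral>\<^sup>+y. 0 \<partial>(lebesgue :: (real^2) measure))"
    unfolding sqnorm_def
  proof (rule nn_integral_dominated_convergence[where w="\<lambda>y. ennreal ((norm (\<phi> y))\<^sup>2)"])
    show "(\<lambda>y. ennreal ((norm (\<phi>' n y - \<phi> y))\<^sup>2)) \<in> borel_measurable lebesgue" for n
      unfolding \<phi>'_def by measurable
    have dist: "norm (\<phi>' n y - \<phi> y) = (1 - \<theta> n y) * norm (\<phi> y)" for n y
    proof -
      have "\<phi>' n y - \<phi> y = - (of_real (1 - \<theta> n y) * \<phi> y)" by (simp add: \<phi>'_def algebra_simps)
      then show ?thesis using \<theta>01[of n y] by (simp only: norm_minus_cancel norm_mult norm_of_real)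
    qed
    show "AE y in lebesgue. ennreal ((norm (\<phi>' n y - \<phi> y))\<^sup>2) \<le> ennreal ((norm (\<phi> y))\<^sup>2)" for n
    proof (intro AE_I2 ennreal_leI power_mono)
      fix y show "norm (\<phi>' n y - \<phi> y) \<le> norm (\<phi> y)"
        unfolding dist using \<theta>01[of n y] by (intro mult_left_le_one_le) auto
    qed auto
    have "AE y in lebesgue. y \<noteq> x"
      by (intro AE_completion AE_lborel_singleton)
    then show "AE y in lebesgue. (\<lambda>n. ennreal ((norm (\<phi>' n y - \<phi> y))\<^sup>2)) \<longlonglongrightarrow> 0"
    proof eventually_elim
      case (elim y)
      then have p: "norm (x - y) > 0" by simp
      obtain N where N: "2 / norm (x - y) \<le> real N" using real_arch_simple by blast
      have "eventually (\<lambda>n. ennreal ((norm (\<phi>' n y - \<phi> y))\<^sup>2) = 0) sequentially"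
        using eventually_ge_at_top[of N]
      proof eventually_elim
        case (elim n)
        then have "2 / norm (x - y) \<le> real n" using N by linarith
        then have "2 \<le> real n * norm (x - y)" using p by (simp add: field_simps)
        then have "\<theta> n y = 1" by (simp add: \<theta>_def)
        then show ?case by (simp add: dist)
      qed
      then show ?case by (rule tendsto_eventually)
    qed
  qed (use fin in \<open>auto simp: sqnorm_def\<close>)
  then have "(\<lambda>n. sqnorm (\<lambda>y. \<phi>' n y - \<phi> y)) \<longlonglongrightarrow> 0" by simp
  \<comment> \<open>Both errors are kept to e/4 because the triangle inequality for squared norms
    doubles their sum.\<close>
  then have "eventually (\<lambda>n. sqnorm (\<lambda>y. \<phi>' n y - \<phi> y) < ennreal (e / 4)) sequentially"
    by (rule order_tendstoD) (use e in simp)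
  from eventually_happens'[OF sequentially_bot eventually_conj[OF this eventually_gt_at_top[of 0]]]
  obtain n where n: "sqnorm (\<lambda>y. \<phi>' n y - \<phi> y) < ennreal (e / 4)" "n > 0" by blast
  obtain \<psi> where \<psi>: "test_fun \<psi>" "sqnorm (\<lambda>y. \<psi> y - \<phi>' n y) \<le> ennreal (e / 4)"
    using test_fun_sqnorm_approx[OF cont[OF n(2)] K(1,2), of "e / 4"] K(3) e by (auto simp: \<phi>'_def)
  have "sqnorm (\<lambda>y. \<psi> y - \<phi> y) \<le> 2 * (sqnorm (\<lambda>y. \<psi> y - \<phi>' n y) + sqnorm (\<lambda>y. \<phi>' n y - \<phi> y))"
    by (rule sqnorm_diff_le[OF test_fun_measurable[OF \<psi>(1)] m]) (unfold \<phi>'_def, measurable)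
  also have "\<dots> \<le> 2 * (ennreal (e / 4) + ennreal (e / 4))"
    by (intro mult_left_mono add_mono \<psi> less_imp_le[OF n(1)]) auto
  also have "\<dots> = ennreal e"
    using e by (simp add: ennreal_mult'[symmetric] flip: ennreal_plus ennreal_numeral)
  finally show ?thesis using \<psi>(1) by blast
qed

section \<open>The mild solution\<close>

lemma continuous_on_sing_holder:
  assumes "\<And>R. 1 \<le> R \<Longrightarrow> sing_holder R f"
  shows "continuous_on (- {0}) f"
  unfolding continuous_on_eq_continuous_within
proof
  fix z :: "real^2" assume z: "z \<in> - {0}"
  define R where "R = norm z + 1"
  obtain C where C: "\<And>z z'. z \<noteq> 0 \<Longrightarrow> z' \<noteq> 0 \<Longrightarrow> norm z \<le> R \<Longrightarrow> norm z' \<le> R \<Longrightarrow>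
      norm (f z - f z') \<le> C * norm (z - z') powr (3/4) * (norm z powr (-3/4) + norm z' powr (-3/4))"
    using sing_holderE[OF assms[of R]] R_def by (metis le_add_same_cancel2 norm_ge_zero)
  have "((\<lambda>w. C * norm (w - z) powr (3/4) * (norm w powr (-3/4) + norm z powr (-3/4)))
      \<longlongrightarrow> C * 0 * (norm z powr (-3/4) + norm z powr (-3/4))) (at z)"
  proof (intro tendsto_intros tendsto_zero_powrI)
    show "((\<lambda>w. norm (w - z)) \<longlongrightarrow> 0) (at z)" by (intro tendsto_eq_intros) auto
  qed (use z in auto)
  then have lim: "((\<lambda>w. C * norm (w - z) powr (3/4) * (norm w powr (-3/4) + norm z powr (-3/4))) \<longlongrightarrow> 0) (at z)"
    by simp
  have "((\<lambda>w. f w - f z) \<longlongrightarrow> 0) (at z)"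
  proof (rule Lim_null_comparison[OF _ lim])
    have "eventually (\<lambda>w. w \<in> ball z 1 \<inter> - {0}) (at z)"
      by (intro eventually_at_in_open') (use z in auto)
    then show "eventually (\<lambda>w. norm (f w - f z) \<le> C * norm (w - z) powr (3/4) * (norm w powr (-3/4) + norm z powr (-3/4))) (at z)"
    proof eventually_elim
      case (elim w)
      have "norm w \<le> norm z + norm (w - z)" using norm_triangle_ineq[of z "w - z"] by simp
      then have "norm w \<le> R" using elim unfolding R_def by (simp add: dist_norm norm_minus_commute)
      then show ?case using elim z by (intro C) (auto simp: R_def)
    qed
  qed
  then have "(f \<longlongrightarrow> f z) (at z)" by (rule LIM_zero_cancel)
  then show "continuous (at z within - {0}) f"
    unfolding continuous_within by (rule tendsto_within_subset) simp
qed

section \<open>Square integrals of the Green tensor\<close>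

locale green_setting =
  fixes lam mu om :: real and a b :: "real^2"
  assumes om: "om > 0" and mu: "mu > 0" and lm: "lam + mu > 0" and box: "box a b \<noteq> {}"
begin

abbreviation G where "G \<equiv> green_navier lam mu om"
abbreviation \<Gamma> where "\<Gamma> \<equiv> green_kernel lam mu om"

lemma G_eq: "x \<noteq> y \<Longrightarrow> G x y $ i $ j = \<Gamma> i j (x - y)"
  by (rule green_navier_eq_kernel[OF om mu lm])

lemma continuous_on_\<Gamma>: "continuous_on (- {0}) (\<Gamma> i j)"
  by (rule continuous_on_sing_holder) (rule sing_holder_green_kernel)

lemma continuous_on_G: "continuous_on (- {x}) (\<lambda>y. G x y $ i $ j)"
proof -
  have "continuous_on (- {x}) (\<lambda>y. \<Gamma> i j (x - y))"
    by (rule continuous_on_compose2[OF continuous_on_\<Gamma>]) (auto intro!: continuous_intros)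
  then show ?thesis by (rule continuous_on_eq) (auto simp: G_eq)
qed

lemma G_measurable [measurable]: "(\<lambda>y. G x y $ i $ j) \<in> borel_measurable borel"
proof -
  have m: "(\<lambda>y. indicator (- {x}) y *\<^sub>R (G x y $ i $ j)) \<in> borel_measurable borel"
    by (rule borel_measurable_continuous_on_indicator) (auto intro: continuous_on_G)
  have "(\<lambda>y. if y = x then G x x $ i $ j else indicator (- {x}) y *\<^sub>R (G x y $ i $ j)) \<in> borel_measurable borel"
    by (rule measurable_If) (use m in auto)
  moreover have "(\<lambda>y. if y = x then G x x $ i $ j else indicator (- {x}) y *\<^sub>R (G x y $ i $ j)) = (\<lambda>y. G x y $ i $ j)"
    by (auto simp: fun_eq_iff)
  ultimately show ?thesis by simp
qed

lemma AE_lborel_neq: "AE y in lborel. y \<noteq> (x :: real^2)"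
  by (rule AE_lborel_singleton)

text \<open>Squaring doubles the exponents of \<open>sing_holder\<close>, and the squared weight
  |z|^(-3/2) has a box integral \<open>I\<close> bounded independently of its centre. Squaring the
  sum of two weights costs a factor 2 and adding their integrals another, hence
  \<open>4 * C\<^sup>2 * I\<close>.\<close>

lemma G_square_bounds:
  "\<exists>K>0. \<forall>x z i j. norm x \<le> r \<longrightarrow> norm z \<le> r \<longrightarrow>
     (\<integral>\<^sup>+y. indicator (box a b) y * ennreal ((norm (G x y $ i $ j))\<^sup>2) \<partial>lborel) \<le> ennreal K \<and>
     (\<integral>\<^sup>+y. indicator (box a b) y * ennreal ((norm (G x y $ i $ j - G z y $ i $ j))\<^sup>2) \<partial>lborel)
       \<le> ennreal (K * norm (x - z) powr (3/2))"
proof -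
  obtain s where s: "s > 0" "\<And>y. y \<in> box a b \<Longrightarrow> norm y \<le> s"
    using bounded_box[of a b] by (auto simp: bounded_pos)
  \<comment> \<open>Bounds x - y for \<open>x\<close> in the ball of radius \<open>r\<close> and
    \<open>y\<close> in the box; being at least 1 is a condition of the weighted class.\<close>
  define R where "R = max 1 (\<bar>r\<bar> + s)"
  have R: "1 \<le> R" by (simp add: R_def)
  have "\<exists>C\<ge>0. \<forall>z z'. z \<noteq> 0 \<longrightarrow> z' \<noteq> 0 \<longrightarrow> norm z \<le> R \<longrightarrow> norm z' \<le> R \<longrightarrow>
      norm (\<Gamma> i j z) \<le> C * norm z powr (-3/4) \<and>
      norm (\<Gamma> i j z - \<Gamma> i j z') \<le> C * norm (z - z') powr (3/4) * (norm z powr (-3/4) + norm z' powr (-3/4))" for i j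
    using sing_holder_green_kernel[OF R, of lam mu om i j] unfolding sing_holder_def .
  then obtain C' where C': "\<And>i j. 0 \<le> C' i j" "\<And>i j z. z \<noteq> 0 \<Longrightarrow> norm z \<le> R \<Longrightarrow> norm (\<Gamma> i j z) \<le> C' i j * norm z powr (-3/4)"
    "\<And>i j z z'. z \<noteq> 0 \<Longrightarrow> z' \<noteq> 0 \<Longrightarrow> norm z \<le> R \<Longrightarrow> norm z' \<le> R \<Longrightarrow>
      norm (\<Gamma> i j z - \<Gamma> i j z') \<le> C' i j * norm (z - z') powr (3/4) * (norm z powr (-3/4) + norm z' powr (-3/4))"
    by metis
  \<comment> \<open>The sum dominates the constants of all four entries at once, and the added 1
    keeps the final constant positive.\<close>
  define C where "C = (\<Sum>i\<in>UNIV. \<Sum>j\<in>UNIV. C' i j) + 1"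
  have CC: "C' i j \<le> C" for i j
  proof -
    have "C' i j \<le> (\<Sum>j\<in>UNIV. C' i j)" by (intro member_le_sum C') auto
    also have "\<dots> \<le> (\<Sum>i\<in>UNIV. \<Sum>j\<in>UNIV. C' i j)"
      by (intro member_le_sum[where f="\<lambda>i. \<Sum>j\<in>UNIV. C' i j"] sum_nonneg C') auto
    finally show ?thesis by (simp add: C_def)
  qed
  have C1: "C \<ge> 1" unfolding C_def by (simp add: sum_nonneg C')
  have ab: "a $ 1 \<le> b $ 1" "a $ 2 \<le> b $ 2"
    using box by (auto simp: mem_box_cart forall_2 set_eq_iff)
  define I where "I = (8 + (b $ 1 - a $ 1)) * (8 + (b $ 2 - a $ 2))"
  have I: "I > 0" unfolding I_def using ab by (intro mult_pos_pos) auto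
  have w: "(\<integral>\<^sup>+y. indicator (box a b) y * ennreal (norm (x - y) powr (-3/2)) \<partial>lborel) \<le> ennreal I" for x :: "real^2"
    unfolding I_def by (rule nn_integral_norm_powr_le[OF ab])
  have sq: "(norm v powr (-3/4))\<^sup>2 = norm v powr (-3/2)" for v :: "real^2"
    by (simp add: power2_eq_square flip: powr_add)
  show ?thesis
  proof (intro exI[of _ "4 * C\<^sup>2 * I"] conjI allI impI)
    show "0 < 4 * C\<^sup>2 * I" using C1 I by simp
    fix x z :: "real^2" and i j :: 2
    assume x: "norm x \<le> r" and z: "norm z \<le> r"
    have nR: "norm (x - y) \<le> R" if "norm x \<le> r" "y \<in> box a b" for x y
      using norm_triangle_ineq4[of x y] that(1) s(2)[OF that(2)] unfolding R_def by linarith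
    have Cle: "\<And>t. t \<ge> 0 \<Longrightarrow> C' i j * t \<le> C * t" using CC by (intro mult_right_mono)
    have "(\<integral>\<^sup>+y. indicator (box a b) y * ennreal ((norm (G x y $ i $ j))\<^sup>2) \<partial>lborel)
       \<le> (\<integral>\<^sup>+y. ennreal (C\<^sup>2) * (indicator (box a b) y * ennreal (norm (x - y) powr (-3/2))) \<partial>lborel)"
    proof (rule nn_integral_mono_AE)
      show "AE y in lborel. indicator (box a b) y * ennreal ((norm (G x y $ i $ j))\<^sup>2)
          \<le> ennreal (C\<^sup>2) * (indicator (box a b) y * ennreal (norm (x - y) powr (-3/2)))"
        using AE_lborel_neq[of x]
      proof eventually_elim
        case (elim y)
        show ?case
        proof (cases "y \<in> box a b")
          case True
          have "norm (\<Gamma> i j (x - y)) \<le> C' i j * norm (x - y) powr (-3/4)"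
            using elim nR[OF x True] by (intro C'(2)) auto
          also have "\<dots> \<le> C * norm (x - y) powr (-3/4)" by (rule Cle) simp
          finally have "(norm (\<Gamma> i j (x - y)))\<^sup>2 \<le> (C * norm (x - y) powr (-3/4))\<^sup>2"
            by (intro power_mono) auto
          then have "ennreal ((norm (G x y $ i $ j))\<^sup>2) \<le> ennreal (C\<^sup>2 * norm (x - y) powr (-3/2))"
            using elim by (intro ennreal_leI) (simp only: G_eq[OF elim[symmetric]] power_mult_distrib sq)
          then show ?thesis using True by (simp add: ennreal_mult')
        qed simp
      qed
    qed
    also have "\<dots> = ennreal (C\<^sup>2) * (\<integral>\<^sup>+y. indicator (box a b) y * ennreal (norm (x - y) powr (-3/2)) \<partial>lborel)"
      by (rule nn_integral_cmult) auto
    also have "\<dots> \<le> ennreal (C\<^sup>2) * ennreal I" by (intro mult_left_mono w) auto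
    also have "\<dots> = ennreal (C\<^sup>2 * I)" by (simp add: ennreal_mult')
    also have "\<dots> \<le> ennreal (4 * C\<^sup>2 * I)" using I by (intro ennreal_leI) simp
    finally show "(\<integral>\<^sup>+y. indicator (box a b) y * ennreal ((norm (G x y $ i $ j))\<^sup>2) \<partial>lborel) \<le> ennreal (4 * C\<^sup>2 * I)" .
    define d where "d = norm (x - z) powr (3/2)"
    have d: "(norm (x - z) powr (3/4))\<^sup>2 = d" unfolding d_def by (simp add: power2_eq_square flip: powr_add)
    have d0: "0 \<le> d" by (simp add: d_def)
    have "(\<integral>\<^sup>+y. indicator (box a b) y * ennreal ((norm (G x y $ i $ j - G z y $ i $ j))\<^sup>2) \<partial>lborel)
      \<le> (\<integral>\<^sup>+y. ennreal (2 * C\<^sup>2 * d) * (indicator (box a b) y * ennreal (norm (x - y) powr (-3/2))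
          + indicator (box a b) y * ennreal (norm (z - y) powr (-3/2))) \<partial>lborel)"
    proof (rule nn_integral_mono_AE)
      show "AE y in lborel. indicator (box a b) y * ennreal ((norm (G x y $ i $ j - G z y $ i $ j))\<^sup>2)
          \<le> ennreal (2 * C\<^sup>2 * d) * (indicator (box a b) y * ennreal (norm (x - y) powr (-3/2))
          + indicator (box a b) y * ennreal (norm (z - y) powr (-3/2)))"
        using AE_lborel_neq[of x] AE_lborel_neq[of z]
      proof eventually_elim
        case (elim y)
        show ?case
        proof (cases "y \<in> box a b")
          case True
          let ?u = "norm (x - y) powr (-3/4)" and ?v = "norm (z - y) powr (-3/4)"
          have "norm (\<Gamma> i j (x - y) - \<Gamma> i j (z - y)) \<le> C' i j * norm ((x - y) - (z - y)) powr (3/4) * (?u + ?v)"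
            using elim nR[OF x True] nR[OF z True] by (intro C'(3)) auto
          also have "\<dots> \<le> C * norm (x - z) powr (3/4) * (?u + ?v)"
            using CC[of i j] by (simp add: mult_right_mono)
          finally have "(norm (\<Gamma> i j (x - y) - \<Gamma> i j (z - y)))\<^sup>2 \<le> (C * norm (x - z) powr (3/4) * (?u + ?v))\<^sup>2"
            by (intro power_mono) auto
          also have "\<dots> = C\<^sup>2 * d * (?u + ?v)\<^sup>2" by (simp only: power_mult_distrib d)
          also have "\<dots> \<le> C\<^sup>2 * d * (2 * (?u\<^sup>2 + ?v\<^sup>2))"
            using sum_squares_bound[of ?u ?v] d0 by (intro mult_left_mono) (auto simp: power2_sum)
          also have "\<dots> = 2 * C\<^sup>2 * d * (norm (x - y) powr (-3/2) + norm (z - y) powr (-3/2))"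
            by (simp only: sq mult_ac)
          finally have "ennreal ((norm (G x y $ i $ j - G z y $ i $ j))\<^sup>2)
              \<le> ennreal (2 * C\<^sup>2 * d * (norm (x - y) powr (-3/2) + norm (z - y) powr (-3/2)))"
            by (intro ennreal_leI) (simp only: G_eq[OF elim(1)[symmetric]] G_eq[OF elim(2)[symmetric]])
          also have "\<dots> = ennreal (2 * C\<^sup>2 * d) * (ennreal (norm (x - y) powr (-3/2)) + ennreal (norm (z - y) powr (-3/2)))"
            using d0 by (subst ennreal_mult) (auto simp: ennreal_plus)
          finally show ?thesis using True by simp
        qed simp
      qed
    qed
    also have "\<dots> = ennreal (2 * C\<^sup>2 * d) * ((\<integral>\<^sup>+y. indicator (box a b) y * ennreal (norm (x - y) powr (-3/2)) \<partial>lborel)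
        + (\<integral>\<^sup>+y. indicator (box a b) y * ennreal (norm (z - y) powr (-3/2)) \<partial>lborel))"
      by (subst nn_integral_cmult, simp, subst nn_integral_add) auto
    also have "\<dots> \<le> ennreal (2 * C\<^sup>2 * d) * (ennreal I + ennreal I)"
      by (intro mult_left_mono add_mono w) auto
    also have "ennreal I + ennreal I = ennreal (I + I)"
      using I by (intro ennreal_plus[symmetric]) auto
    also have "ennreal (2 * C\<^sup>2 * d) * ennreal (I + I) = ennreal (2 * C\<^sup>2 * d * (I + I))"
      using I d0 by (intro ennreal_mult[symmetric]) auto
    also have "2 * C\<^sup>2 * d * (I + I) = 4 * C\<^sup>2 * I * norm (x - z) powr (3/2)" by (simp add: d_def)
    finally show "(\<integral>\<^sup>+y. indicator (box a b) y * ennreal ((norm (G x y $ i $ j - G z y $ i $ j))\<^sup>2) \<partial>lborel)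
       \<le> ennreal (4 * C\<^sup>2 * I * norm (x - z) powr (3/2))" .
  qed
qed

end

lemma holder_on_continuous_on:
  assumes h: "holder_on \<eta> D h" and \<eta>: "0 < \<eta>"
  shows "continuous_on D h"
  unfolding continuous_on_eq_continuous_within
proof
  fix x assume x: "x \<in> D"
  obtain C where C: "\<And>x y. x \<in> D \<Longrightarrow> y \<in> D \<Longrightarrow> \<bar>h x - h y\<bar> \<le> C * dist x y powr \<eta>"
    using h unfolding holder_on_def by blast
  have "((\<lambda>y. C * dist y x powr \<eta>) \<longlongrightarrow> C * 0) (at x within D)"
  proof (intro tendsto_intros tendsto_zero_powrI)
    show "((\<lambda>y. dist y x) \<longlongrightarrow> 0) (at x within D)" by (intro tendsto_eq_intros) auto
  qed (use \<eta> in auto)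
  then have lim: "((\<lambda>y. C * dist y x powr \<eta>) \<longlongrightarrow> 0) (at x within D)" by simp
  have "((\<lambda>y. h y - h x) \<longlongrightarrow> 0) (at x within D)"
    by (rule Lim_null_comparison[OF _ lim]) (use C x in \<open>auto simp: eventually_at_filter\<close>)
  then show "continuous (at x within D) h"
    unfolding continuous_within by (rule LIM_zero_cancel)
qed

text \<open>The open sets \<open>D\<close> and \<open>- K\<close> cover the plane, and
  \<open>h\<close> is continuous on the first by the Hoelder condition and zero on the second.
  Boundedness comes from compactness of \<open>K\<close>.\<close>

lemma holder_compact_support_continuous:
  fixes h :: "real^2 \<Rightarrow> real"
  assumes h: "holder_on \<eta> D h" "0 < \<eta>" and D: "open D" and K: "compact K" "K \<subseteq> D" "\<And>x. x \<notin> K \<Longrightarrow> h x = 0"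
  shows "continuous_on UNIV h" "\<exists>H>0. \<forall>x. \<bar>h x\<bar> \<le> H"
proof -
  have "continuous_on (D \<union> - K) h"
  proof (rule continuous_on_open_Un)
    show "continuous_on D h" by (rule holder_on_continuous_on[OF h])
    have "continuous_on (- K) (\<lambda>_. 0 :: real)" by simp
    then show "continuous_on (- K) h" by (rule continuous_on_eq) (use K in auto)
  qed (use D K compact_imp_closed in auto)
  moreover have "D \<union> - K = UNIV" using K by auto
  ultimately show c: "continuous_on UNIV h" by simp
  have "bounded (h ` K)"
    by (intro compact_imp_bounded compact_continuous_image K(1) continuous_on_subset[OF c]) auto
  then obtain H where H: "H > 0" "\<And>x. x \<in> K \<Longrightarrow> \<bar>h x\<bar> \<le> H" by (auto simp: bounded_pos)
  have "\<bar>h x\<bar> \<le> H" for x using H K(3)[of x] by (cases "x \<in> K") auto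
  then show "\<exists>H>0. \<forall>x. \<bar>h x\<bar> \<le> H" using H(1) by blast
qed

lemma bounded_linear_axis: "bounded_linear (axis j :: complex \<Rightarrow> complex^2)"
proof -
  have "linear (axis j :: complex \<Rightarrow> complex^2)"
    by (rule linearI) (auto simp: axis_def vec_eq_iff)
  then show ?thesis by (simp add: linear_conv_bounded_linear)
qed

lemma vec_sum_axis: "(x :: complex^2) = axis 1 (x $ 1) + axis 2 (x $ 2)"
  by (simp add: vec_eq_iff forall_2 axis_def)

lemma measurable_axis [measurable (raw)]:
  "f \<in> borel_measurable M \<Longrightarrow> (\<lambda>x. axis j (f x) :: complex^2) \<in> borel_measurable M"
  by (rule borel_measurable_continuous_on[OF linear_continuous_on[OF bounded_linear_axis]])

lemma measurable_complex_vec: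
  assumes "\<And>j. (\<lambda>x. f x $ j) \<in> borel_measurable M"
  shows "(f :: 'a \<Rightarrow> complex^2) \<in> borel_measurable M"
proof -
  have "(\<lambda>x. axis 1 (f x $ 1) + axis 2 (f x $ 2) :: complex^2) \<in> borel_measurable M"
    by (intro borel_measurable_add measurable_axis assms)
  then show ?thesis by (simp flip: vec_sum_axis)
qed

section \<open>The deterministic part of the solution\<close>

context green_setting
begin

definition det_entry :: "(real^2 \<Rightarrow> real^2) \<Rightarrow> real^2 \<Rightarrow> 2 \<Rightarrow> 2 \<Rightarrow> real^2 \<Rightarrow> complex" where
  "det_entry g x j k y = G x y $ j $ k * of_real (indicator (box a b) y * g y $ k)"

context
  fixes g :: "real^2 \<Rightarrow> real^2"
  assumes g: "\<And>j. Lp_on 2 (box a b) (\<lambda>y. g y $ j)"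
begin

lemma g_measurable [measurable]: "(\<lambda>y. indicator (box a b) y * g y $ k) \<in> borel_measurable lebesgue"
  using g[of k] unfolding Lp_on_def set_borel_measurable_def by simp

lemma G_measurable_lebesgue [measurable]: "(\<lambda>y. G x y $ i $ j) \<in> borel_measurable lebesgue"
  by (intro measurable_completion) (use G_measurable in simp)

lemma g_square: "(\<integral>\<^sup>+y. ennreal ((indicator (box a b) y * g y $ k)\<^sup>2) \<partial>lebesgue) < \<infinity>"
proof -
  have "(\<integral>\<^sup>+y\<in>box a b. ennreal (\<bar>g y $ k\<bar> powr 2) \<partial>lebesgue) < \<infinity>"
    using g[of k] unfolding Lp_on_def by simp
  also have "(\<integral>\<^sup>+y\<in>box a b. ennreal (\<bar>g y $ k\<bar> powr 2) \<partial>lebesgue)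
      = (\<integral>\<^sup>+y. ennreal ((indicator (box a b) y * g y $ k)\<^sup>2) \<partial>lebesgue)"
    by (intro nn_integral_cong) (auto split: split_indicator)
  finally show ?thesis .
qed

lemma det_entry_measurable [measurable]: "det_entry g x j k \<in> borel_measurable lebesgue"
  unfolding det_entry_def by measurable

text \<open>Young's inequality with a free weight stands in for Cauchy-Schwarz under the integral;
  the weight is tuned afterwards.\<close>

lemma mult_le_weighted: "0 < e \<Longrightarrow> s * t \<le> s\<^sup>2 / e + e * t\<^sup>2" for s t e :: real
proof -
  assume e: "0 < e"
  have "0 \<le> (s / sqrt e - sqrt e * t)\<^sup>2 + (s / sqrt e)\<^sup>2 + (sqrt e * t)\<^sup>2" by simp
  also have "\<dots> = 2 * (s\<^sup>2 / e + e * t\<^sup>2) - 2 * (s * t)"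
    using e by (simp add: power2_diff power_divide power_mult_distrib)
  finally show ?thesis by simp
qed

text \<open>Stated for an arbitrary factor \<open>c\<close>: a single tensor entry with weight 1
  gives integrability, a difference of two entries gives continuity in the source point.\<close>

lemma det_weighted_bound:
  assumes e: "0 < e" and c [measurable]: "c \<in> borel_measurable borel"
  shows "(\<integral>\<^sup>+y. ennreal (norm (c y * complex_of_real (indicator (box a b) y * g y $ k))) \<partial>lebesgue)
    \<le> ennreal (1 / e) * (\<integral>\<^sup>+y. indicator (box a b) y * ennreal ((norm (c y))\<^sup>2) \<partial>lborel)
      + ennreal e * (\<integral>\<^sup>+y. ennreal ((indicator (box a b) y * g y $ k)\<^sup>2) \<partial>lebesgue)"
proof -
  have [measurable]: "c \<in> borel_measurable lebesgue"
    by (intro measurable_completion) (use c in simp)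
  have "(\<integral>\<^sup>+y. ennreal (norm (c y * complex_of_real (indicator (box a b) y * g y $ k))) \<partial>lebesgue)
    \<le> (\<integral>\<^sup>+y. ennreal (1 / e) * (indicator (box a b) y * ennreal ((norm (c y))\<^sup>2))
       + ennreal e * ennreal ((indicator (box a b) y * g y $ k)\<^sup>2) \<partial>lebesgue)"
  proof (rule nn_integral_mono)
    fix y
    show "ennreal (norm (c y * complex_of_real (indicator (box a b) y * g y $ k)))
      \<le> ennreal (1 / e) * (indicator (box a b) y * ennreal ((norm (c y))\<^sup>2))
       + ennreal e * ennreal ((indicator (box a b) y * g y $ k)\<^sup>2)"
    proof (cases "y \<in> box a b")
      case True
      have "norm (c y * complex_of_real (g y $ k)) \<le> (norm (c y))\<^sup>2 / e + e * (g y $ k)\<^sup>2"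
        using mult_le_weighted[OF e, of "norm (c y)" "\<bar>g y $ k\<bar>"] by (simp add: norm_mult)
      then have "ennreal (norm (c y * complex_of_real (g y $ k))) \<le> ennreal (1 / e * (norm (c y))\<^sup>2 + e * (g y $ k)\<^sup>2)"
        by (intro ennreal_leI) simp
      also have "\<dots> = ennreal (1 / e * (norm (c y))\<^sup>2) + ennreal (e * (g y $ k)\<^sup>2)"
        using e by (intro ennreal_plus) auto
      also have "\<dots> = ennreal (1 / e) * ennreal ((norm (c y))\<^sup>2) + ennreal e * ennreal ((g y $ k)\<^sup>2)"
        using e by (intro arg_cong2[of _ _ _ _ "(+)"] ennreal_mult') auto
      finally show ?thesis using True by simp
    qed simp
  qed
  also have "\<dots> = ennreal (1 / e) * (\<integral>\<^sup>+y. indicator (box a b) y * ennreal ((norm (c y))\<^sup>2) \<partial>lebesgue)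
      + ennreal e * (\<integral>\<^sup>+y. ennreal ((indicator (box a b) y * g y $ k)\<^sup>2) \<partial>lebesgue)"
  proof -
    have 1: "(\<lambda>y. indicator (box a b) y * ennreal ((norm (c y))\<^sup>2)) \<in> borel_measurable lebesgue"
      by (intro measurable_completion) simp
    have 2: "(\<lambda>y. ennreal ((indicator (box a b) y * g y $ k)\<^sup>2)) \<in> borel_measurable lebesgue"
      by measurable
    show ?thesis
      using 1 2 by (subst nn_integral_add) (auto simp: nn_integral_cmult)
  qed
  finally show ?thesis by (simp add: nn_integral_completion)
qed

lemma det_entry_integrable: "integrable lebesgue (det_entry g x j k)"
  unfolding integrable_iff_bounded
proof
  obtain K where K: "K > 0" "(\<integral>\<^sup>+y. indicator (box a b) y * ennreal ((norm (G x y $ j $ k))\<^sup>2) \<partial>lborel) \<le> ennreal K"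
    using G_square_bounds[of "norm x"] by blast
  have "(\<integral>\<^sup>+y. ennreal (norm (det_entry g x j k y)) \<partial>lebesgue)
    \<le> ennreal (1 / 1) * (\<integral>\<^sup>+y. indicator (box a b) y * ennreal ((norm (G x y $ j $ k))\<^sup>2) \<partial>lborel)
      + ennreal 1 * (\<integral>\<^sup>+y. ennreal ((indicator (box a b) y * g y $ k)\<^sup>2) \<partial>lebesgue)"
    unfolding det_entry_def by (rule det_weighted_bound) auto
  also have "\<dots> < \<infinity>"
    using K(2) g_square[of k] by (auto simp: less_top[symmetric] top_unique)
  finally show "(\<integral>\<^sup>+y. ennreal (norm (det_entry g x j k y)) \<partial>lebesgue) < \<infinity>" .
qed (rule det_entry_measurable)

lemma det_entry_continuous:
  assumes "bounded S"
  shows "continuous_on S (\<lambda>x. \<integral>y. det_entry g x j k y \<partial>lebesgue)"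
proof -
  obtain r where r: "\<And>x. x \<in> S \<Longrightarrow> norm x \<le> r" using assms by (auto simp: bounded_iff)
  obtain K where K: "K > 0" "\<And>x z. norm x \<le> r \<Longrightarrow> norm z \<le> r \<Longrightarrow>
     (\<integral>\<^sup>+y. indicator (box a b) y * ennreal ((norm (G x y $ j $ k - G z y $ j $ k))\<^sup>2) \<partial>lborel)
       \<le> ennreal (K * norm (x - z) powr (3/2))"
    using G_square_bounds[of r] by blast
  obtain L where L: "L \<ge> 0" "(\<integral>\<^sup>+y. ennreal ((indicator (box a b) y * g y $ k)\<^sup>2) \<partial>lebesgue) = ennreal L"
    using g_square[of k] by (auto simp: less_top_ennreal)
  let ?v = "\<lambda>x. \<integral>y. det_entry g x j k y \<partial>lebesgue"
  have le: "norm (?v x - ?v z) \<le> (K + L) * norm (x - z) powr (3/4)" if x: "x \<in> S" and z: "z \<in> S" for x z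
  proof (cases "x = z")
    case False
    \<comment> \<open>This weight balances the squared increment of the tensor, of order e^2 and
      divided by e, against e times the squared norm of the source.\<close>
    define e where "e = norm (x - z) powr (3/4)"
    have e: "e > 0" using False by (simp add: e_def)
    have ee: "norm (x - z) powr (3/2) = e * e" by (simp add: e_def flip: powr_add)
    have "?v x - ?v z = (\<integral>y. det_entry g x j k y - det_entry g z j k y \<partial>lebesgue)"
      by (simp add: det_entry_integrable)
    then have "ennreal (norm (?v x - ?v z)) \<le> (\<integral>\<^sup>+y. ennreal (norm (det_entry g x j k y - det_entry g z j k y)) \<partial>lebesgue)"
      by (simp only:) (rule integral_norm_bound_ennreal, intro Bochner_Integration.integrable_diff det_entry_integrable)
    also have "\<dots> = (\<integral>\<^sup>+y. ennreal (norm ((G x y $ j $ k - G z y $ j $ k) * complex_of_real (indicator (box a b) y * g y $ k))) \<partial>lebesgue)"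
      by (simp only: det_entry_def left_diff_distrib)
    also have "\<dots> \<le> ennreal (1 / e) * (\<integral>\<^sup>+y. indicator (box a b) y * ennreal ((norm (G x y $ j $ k - G z y $ j $ k))\<^sup>2) \<partial>lborel)
      + ennreal e * (\<integral>\<^sup>+y. ennreal ((indicator (box a b) y * g y $ k)\<^sup>2) \<partial>lebesgue)"
      by (rule det_weighted_bound[OF e]) measurable
    also have "\<dots> \<le> ennreal (1 / e) * ennreal (K * (e * e)) + ennreal e * ennreal L"
      unfolding L(2) ee[symmetric] using K(2)[OF r[OF x] r[OF z]] by (intro add_mono mult_left_mono) auto
    also have "\<dots> = ennreal (1 / e * (K * (e * e))) + ennreal (e * L)"
      using e K(1) L(1) by (intro arg_cong2[of _ _ _ _ "(+)"] ennreal_mult[symmetric]) auto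
    also have "\<dots> = ennreal (1 / e * (K * (e * e)) + e * L)"
      using e K(1) L(1) by (intro ennreal_plus[symmetric]) auto
    also have "1 / e * (K * (e * e)) + e * L = (K + L) * e"
      using e by (simp add: field_simps)
    finally show ?thesis
      using e K(1) L(1) by (subst (asm) ennreal_le_iff) (auto simp: e_def)
  qed simp
  show ?thesis
    unfolding continuous_on_eq_continuous_within
  proof
    fix x assume x: "x \<in> S"
    have "((\<lambda>y. (K + L) * norm (y - x) powr (3/4)) \<longlongrightarrow> (K + L) * 0) (at x within S)"
    proof (intro tendsto_intros tendsto_zero_powrI)
      show "((\<lambda>y. norm (y - x)) \<longlongrightarrow> 0) (at x within S)" by (intro tendsto_eq_intros) auto
    qed auto
    then have lim: "((\<lambda>y. (K + L) * norm (y - x) powr (3/4)) \<longlongrightarrow> 0) (at x within S)" by simp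
    have "((\<lambda>y. ?v y - ?v x) \<longlongrightarrow> 0) (at x within S)"
      by (rule Lim_null_comparison[OF _ lim]) (use le x in \<open>auto simp: eventually_at_filter\<close>)
    then show "continuous (at x within S) ?v"
      unfolding continuous_within by (rule LIM_zero_cancel)
  qed
qed

text \<open>The vector integral is a Bochner integral in \<open>complex^2\<close>; writing the
  integrand along the two axes and using that \<open>axis\<close> is bounded linear reduces it to
  scalar integrals.\<close>

lemma det_part_eq:
  "(LINT y:box a b|lebesgue. G x y *v (\<chi> k. complex_of_real (g y $ k)))
    = (\<chi> j. \<Sum>k\<in>UNIV. \<integral>y. det_entry g x j k y \<partial>lebesgue)"
proof -
  let ?F = "\<lambda>y. indicator (box a b) y *\<^sub>R (G x y *v (\<chi> k. complex_of_real (g y $ k)))"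
  have F: "?F = (\<lambda>y. axis 1 (\<Sum>k\<in>UNIV. det_entry g x 1 k y) + axis 2 (\<Sum>k\<in>UNIV. det_entry g x 2 k y))"
  proof (rule ext, subst vec_sum_axis)
    fix y
    have "?F y $ j = (\<Sum>k\<in>UNIV. det_entry g x j k y)" for j
      by (cases "y \<in> box a b") (simp_all add: matrix_vector_mult_def det_entry_def)
    then show "axis 1 (?F y $ 1) + axis 2 (?F y $ 2)
        = axis 1 (\<Sum>k\<in>UNIV. det_entry g x 1 k y) + axis 2 (\<Sum>k\<in>UNIV. det_entry g x 2 k y)" by simp
  qed
  have i: "integrable lebesgue (\<lambda>y. axis j (\<Sum>k\<in>UNIV. det_entry g x j k y) :: complex^2)" for j
    by (intro integrable_bounded_linear[OF bounded_linear_axis] Bochner_Integration.integrable_sum det_entry_integrable)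
  have e: "(\<integral>y. axis j (\<Sum>k\<in>UNIV. det_entry g x j k y) \<partial>lebesgue) = (axis j (\<Sum>k\<in>UNIV. \<integral>y. det_entry g x j k y \<partial>lebesgue) :: complex^2)" for j
    by (subst integral_bounded_linear[OF bounded_linear_axis])
       (simp_all add: det_entry_integrable Bochner_Integration.integral_sum)
  show ?thesis
    unfolding set_lebesgue_integral_def F
    by (subst vec_sum_axis[of "vec_lambda _"]) (simp add: i e)
qed

end

section \<open>The stochastic part of the solution\<close>

definition stoch_entry :: "(2 \<Rightarrow> real^2 \<Rightarrow> real) \<Rightarrow> real^2 \<Rightarrow> 2 \<Rightarrow> 2 \<Rightarrow> real^2 \<Rightarrow> complex" where
  "stoch_entry h x j k y = indicator (box a b) y *
    (G x y ** (\<chi> a b. if a = b then complex_of_real (h a y) else 0)) $ j $ k"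

lemma stoch_entry_eq: "stoch_entry h x j k y = indicator (box a b) y * (G x y $ j $ k * of_real (h k y))"
  by (simp add: stoch_entry_def matrix_matrix_mult_def if_distrib[of "\<lambda>t. _ * t"] cong: if_cong)

context
  fixes h :: "2 \<Rightarrow> real^2 \<Rightarrow> real" and k :: 2 and K :: "(real^2) set" and H :: real
  assumes hc: "continuous_on UNIV (h k)" and hH: "\<And>x. \<bar>h k x\<bar> \<le> H" and H: "H > 0"
    and K: "compact K" "K \<subseteq> box a b" "\<And>x. x \<notin> K \<Longrightarrow> h k x = 0"
begin

lemma stoch_entry_measurable: "stoch_entry h x j k \<in> borel_measurable lebesgue"
proof (intro measurable_completion)
  have [measurable]: "h k \<in> borel_measurable borel" by (rule borel_measurable_continuous_onI[OF hc])
  have "(\<lambda>y. indicator (box a b) y * (G x y $ j $ k * complex_of_real (h k y))) \<in> borel_measurable borel"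
    by measurable
  then show "stoch_entry h x j k \<in> borel_measurable lborel"
    by (simp add: stoch_entry_eq[abs_def])
qed

text \<open>The coefficient \<open>h k\<close> is bounded by \<open>H\<close> and can be pulled out.
  The factor \<open>c\<close> is arbitrary so that one tensor entry and a difference of two are
  covered alike.\<close>

lemma sqnorm_stoch_le:
  assumes [measurable]: "c \<in> borel_measurable borel"
    and le: "(\<integral>\<^sup>+y. indicator (box a b) y * ennreal ((norm (c y))\<^sup>2) \<partial>lborel) \<le> ennreal B"
  shows "sqnorm (\<lambda>y. indicator (box a b) y * (c y * complex_of_real (h k y))) \<le> ennreal (H\<^sup>2 * B)"
proof -
  have "sqnorm (\<lambda>y. indicator (box a b) y * (c y * complex_of_real (h k y)))
      \<le> (\<integral>\<^sup>+y. ennreal (H\<^sup>2) * (indicator (box a b) y * ennreal ((norm (c y))\<^sup>2)) \<partial>lebesgue)"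
    unfolding sqnorm_def
  proof (rule nn_integral_mono)
    fix y
    have "norm (c y * complex_of_real (h k y)) \<le> H * norm (c y)"
      using mult_right_mono[OF hH[of y], of "norm (c y)"] by (simp add: norm_mult mult.commute)
    then have "(norm (c y * complex_of_real (h k y)))\<^sup>2 \<le> (H * norm (c y))\<^sup>2" by (intro power_mono) auto
    then have "ennreal ((norm (c y * complex_of_real (h k y)))\<^sup>2) \<le> ennreal (H\<^sup>2 * (norm (c y))\<^sup>2)"
      by (intro ennreal_leI) (simp only: power_mult_distrib)
    then show "ennreal ((norm (indicator (box a b) y * (c y * complex_of_real (h k y))))\<^sup>2)
      \<le> ennreal (H\<^sup>2) * (indicator (box a b) y * ennreal ((norm (c y))\<^sup>2))"
      by (cases "y \<in> box a b") (auto simp: ennreal_mult')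
  qed
  also have "\<dots> = ennreal (H\<^sup>2) * (\<integral>\<^sup>+y. indicator (box a b) y * ennreal ((norm (c y))\<^sup>2) \<partial>lborel)"
    by (simp add: nn_integral_completion nn_integral_cmult)
  also have "\<dots> \<le> ennreal (H\<^sup>2) * ennreal B" by (intro mult_left_mono le) auto
  finally show ?thesis by (simp add: ennreal_mult')
qed

lemma sqnorm_stoch_entry: "sqnorm (stoch_entry h x j k) < \<infinity>"
proof -
  obtain C where C: "(\<integral>\<^sup>+y. indicator (box a b) y * ennreal ((norm (G x y $ j $ k))\<^sup>2) \<partial>lborel) \<le> ennreal C"
    using G_square_bounds[of "norm x"] by blast
  have "sqnorm (stoch_entry h x j k) \<le> ennreal (H\<^sup>2 * C)"
    unfolding stoch_entry_eq[abs_def] by (rule sqnorm_stoch_le[OF _ C]) measurable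
  then show ?thesis by (rule le_less_trans) simp
qed

lemma sqnorm_stoch_entry_diff:
  "\<exists>C>0. \<forall>x z. norm x \<le> r \<longrightarrow> norm z \<le> r \<longrightarrow>
    sqnorm (\<lambda>y. stoch_entry h x j k y - stoch_entry h z j k y) \<le> ennreal (C * norm (x - z) powr (3/2))"
proof -
  obtain C where C: "C > 0" "\<And>x z. norm x \<le> r \<Longrightarrow> norm z \<le> r \<Longrightarrow>
     (\<integral>\<^sup>+y. indicator (box a b) y * ennreal ((norm (G x y $ j $ k - G z y $ j $ k))\<^sup>2) \<partial>lborel)
       \<le> ennreal (C * norm (x - z) powr (3/2))"
    using G_square_bounds[of r] by blast
  have "sqnorm (\<lambda>y. stoch_entry h x j k y - stoch_entry h z j k y) \<le> ennreal (H\<^sup>2 * (C * norm (x - z) powr (3/2)))"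
    if "norm x \<le> r" "norm z \<le> r" for x z
  proof -
    have "(\<lambda>y. stoch_entry h x j k y - stoch_entry h z j k y)
      = (\<lambda>y. indicator (box a b) y * ((G x y $ j $ k - G z y $ j $ k) * complex_of_real (h k y)))"
      by (simp add: fun_eq_iff stoch_entry_eq algebra_simps)
    then show ?thesis
      using sqnorm_stoch_le[OF _ C(2)[OF that]] by simp
  qed
  moreover have "0 < H\<^sup>2 * C" using C(1) H by simp
  ultimately show ?thesis
    unfolding mult.assoc[symmetric] by blast
qed

lemma stoch_entry_approx:
  "\<exists>\<psi>. (\<forall>n. test_fun (\<psi> n)) \<and> (\<lambda>n. sqnorm (\<lambda>y. \<psi> n y - stoch_entry h x j k y)) \<longlonglongrightarrow> 0"
proof -
  \<comment> \<open>The indicator may be dropped since \<open>h k\<close> vanishes off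
    \<open>K\<close>, which lies inside the box. The integrand thus has no jump at the boundary, and
    its only possible discontinuity is at \<open>x\<close>.\<close>
  have eq: "stoch_entry h x j k y = G x y $ j $ k * of_real (h k y)" for y
    using K(2,3) by (cases "y \<in> box a b") (auto simp: stoch_entry_eq)
  have "continuous_on (- {x}) (stoch_entry h x j k)"
    unfolding eq[abs_def]
    by (intro continuous_on_mult continuous_on_G continuous_on_of_real continuous_on_subset[OF hc]) simp
  then have "\<exists>\<psi>. test_fun \<psi> \<and> sqnorm (\<lambda>y. \<psi> y - stoch_entry h x j k y) \<le> ennreal ((1/2) ^ n)" for n :: nat
    by (rule test_fun_sqnorm_approx_singular[OF _ K(1,2) _ stoch_entry_measurable sqnorm_stoch_entry])
       (use K(3) in \<open>auto simp: eq\<close>)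
  then obtain \<psi> where \<psi>: "\<And>n. test_fun (\<psi> n)" "\<And>n. sqnorm (\<lambda>y. \<psi> n y - stoch_entry h x j k y) \<le> ennreal ((1/2) ^ n)"
    by metis
  have "(\<lambda>n. ennreal ((1/2) ^ n)) \<longlonglongrightarrow> ennreal 0"
    by (intro tendsto_ennrealI LIMSEQ_realpow_zero) auto
  then have lim: "(\<lambda>n. ennreal ((1/2) ^ n)) \<longlonglongrightarrow> 0" by simp
  have "(\<lambda>n. sqnorm (\<lambda>y. \<psi> n y - stoch_entry h x j k y)) \<longlonglongrightarrow> 0"
    by (rule tendsto_sandwich[OF _ _ tendsto_const lim]) (use \<psi>(2) in auto)
  with \<psi>(1) show ?thesis by blast
qed

text \<open>The Wiener integrals are chosen separately for every \<open>x\<close> and carry no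
  regularity in \<open>x\<close>; the fourth moments of their increments let the continuity
  criterion replace them by one process with continuous paths.\<close>

lemma stoch_entry_process:
  assumes "planar_sheet M W B" and S: "bounded S"
  shows "\<exists>Y. (\<forall>x. Y x \<in> borel_measurable M) \<and> (\<forall>\<omega>\<in>space M. continuous_on S (\<lambda>x. Y x \<omega>)) \<and>
    (\<forall>x\<in>S. \<exists>I. wiener_integral M W (stoch_entry h x j k) I \<and> (AE \<omega> in M. Y x \<omega> = I \<omega>))"
proof -
  interpret planar_sheet M W B by fact
  have "\<exists>I. wiener_integral M W (stoch_entry h x j k) I" for x
    using stoch_entry_approx[of x j] ex_wiener_integral[OF stoch_entry_measurable] by blast
  then obtain I where I: "\<And>x. wiener_integral M W (stoch_entry h x j k) (I x)" by metis
  have "\<exists>Y. (\<forall>x. Y x \<in> borel_measurable M) \<and> (\<forall>\<omega>\<in>space M. continuous_on S (\<lambda>x. Y x \<omega>)) \<and>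
    (\<forall>x\<in>S. AE \<omega> in M. Y x \<omega> = I x \<omega>)"
  proof (rule kolmogorov_continuity_plane[OF _ _ S])
    show "I x \<in> borel_measurable M" for x
      using I[of x] by (simp add: wiener_integral_def)
    fix r
    obtain C where C: "C > 0" "\<And>x z. norm x \<le> r \<Longrightarrow> norm z \<le> r \<Longrightarrow>
      sqnorm (\<lambda>y. stoch_entry h x j k y - stoch_entry h z j k y) \<le> ennreal (C * norm (x - z) powr (3/2))"
      using sqnorm_stoch_entry_diff[of r j] by blast
    show "\<exists>C\<ge>0. \<forall>x z. norm x \<le> r \<longrightarrow> norm z \<le> r \<longrightarrow>
        (\<integral>\<^sup>+\<omega>. ennreal (norm (I x \<omega> - I z \<omega>) ^ 4) \<partial>M) \<le> ennreal (C * norm (x - z) ^ 3)"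
    \<comment> \<open>\<open>307200 = 3072 * 10^2\<close>, from the moment bound for a difference of
      Wiener integrals; squaring the exponent 3/2 produces the cube of the distance. The case
      \<open>x = z\<close> is separate since that bound asks for a positive
      \<open>d\<close>.\<close>
    proof (intro exI[of _ "307200 * C\<^sup>2"] conjI allI impI)
      fix x z :: "real^2" assume xz: "norm x \<le> r" "norm z \<le> r"
      show "(\<integral>\<^sup>+\<omega>. ennreal (norm (I x \<omega> - I z \<omega>) ^ 4) \<partial>M) \<le> ennreal (307200 * C\<^sup>2 * norm (x - z) ^ 3)"
      proof (cases "x = z")
        case False
        have "(\<integral>\<^sup>+\<omega>. ennreal (norm (I x \<omega> - I z \<omega>) ^ 4) \<partial>M) \<le> ennreal (3072 * (10 * (C * norm (x - z) powr (3/2)))\<^sup>2)"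
          by (rule wiener_integral_diff_moment[OF I I C(2)[OF xz]]) (use C(1) False in simp)
        also have "3072 * (10 * (C * norm (x - z) powr (3/2)))\<^sup>2 = 307200 * C\<^sup>2 * (norm (x - z) powr (3/2))\<^sup>2"
          by (simp add: power_mult_distrib)
        also have "(norm (x - z) powr (3/2))\<^sup>2 = norm (x - z) ^ 3"
        proof -
          have "(norm (x - z) powr (3/2))\<^sup>2 = norm (x - z) powr 3"
            by (simp add: power2_eq_square flip: powr_add)
          also have "\<dots> = norm (x - z) ^ 3" using False powr_realpow[of "norm (x - z)" 3] by simp
          finally show ?thesis .
        qed
        finally show ?thesis .
      qed simp
    qed simp
  qed
  with I show ?thesis by blast
qed

end

end

section \<open>Existence and uniqueness of the mild solution\<close>

lemma planar_sheet_component: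
  assumes M: "prob_space M" and W: "brownian_sheet2 M W"
  shows "\<exists>B. planar_sheet M (W k) B"
proof -
  obtain B :: "2 \<times> bool \<times> bool \<Rightarrow> (real^2) set \<Rightarrow> 'a \<Rightarrow> real"
    where B: "\<And>i. white_noise_pos M (B i)"
      "\<And>k x. AE \<omega> in M. W k x \<omega> = B (k, 0 \<le> x $ 1, 0 \<le> x $ 2) (rect0 (\<chi> i. \<bar>x $ i\<bar>)) \<omega>"
    and m: "\<And>k. (\<lambda>(x, \<omega>). W k x \<omega>) \<in> borel_measurable (lborel \<Otimes>\<^sub>M M)"
    using W unfolding brownian_sheet2_def by blast
  have "planar_sheet M (W k) (\<lambda>q1 q2. B (k, q1, q2))"
    unfolding planar_sheet_def planar_sheet_axioms_def using M B m by blast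
  then show ?thesis by blast
qed

lemma AE_eq_continuous_fields:
  fixes u v :: "real^2 \<Rightarrow> 'a \<Rightarrow> 'b::real_normed_vector"
  assumes u: "\<forall>\<omega>\<in>space M. continuous_on S (\<lambda>x. u x \<omega>)" and v: "\<forall>\<omega>\<in>space M. continuous_on S (\<lambda>x. v x \<omega>)"
    and eq: "\<And>x. x \<in> S \<Longrightarrow> AE \<omega> in M. u x \<omega> = v x \<omega>"
  shows "AE \<omega> in M. \<forall>x\<in>S. u x \<omega> = v x \<omega>"
proof -
  obtain T where T: "countable T" "T \<subseteq> S" "S \<subseteq> closure T" using separable[of S] by blast
  have "AE \<omega> in M. \<forall>x\<in>T. u x \<omega> = v x \<omega>"
    by (rule AE_ball_countable') (use T eq in auto)
  then show ?thesis
    using AE_space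
  proof eventually_elim
    case (elim \<omega>)
    show ?case
    proof
      fix x assume x: "x \<in> S"
      then obtain s where s: "\<And>n. s n \<in> T" "s \<longlonglongrightarrow> x"
        using T(3) closure_sequential[of x T] by blast
      have lim: "(\<lambda>n. f (s n)) \<longlonglongrightarrow> f x" if "continuous_on S f" for f :: "real^2 \<Rightarrow> 'b"
      proof (rule continuous_on_tendsto_compose[OF that s(2) x])
        show "\<forall>\<^sub>F n in sequentially. s n \<in> S" using s(1) T(2) by (intro always_eventually) blast
      qed
      have "(\<lambda>n. u (s n) \<omega>) \<longlonglongrightarrow> u x \<omega>" "(\<lambda>n. v (s n) \<omega>) \<longlonglongrightarrow> v x \<omega>"
        using u v elim(2) by (auto intro: lim[of "\<lambda>x. u x \<omega>"] lim[of "\<lambda>x. v x \<omega>"])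
      moreover have "(\<lambda>n. u (s n) \<omega>) = (\<lambda>n. v (s n) \<omega>)" using elim(1) s(1) by auto
      ultimately show "u x \<omega> = v x \<omega>" using LIMSEQ_unique by metis
    qed
  qed
qed

theorem theorem2p3:
  fixes M :: "'a measure" and W :: "2 \<Rightarrow> real^2 \<Rightarrow> 'a \<Rightarrow> real"
    and lam mu om :: real and a b :: "real^2"
    and g :: "real^2 \<Rightarrow> real^2" and h :: "2 \<Rightarrow> real^2 \<Rightarrow> real"
    and \<Omega> :: "(real^2) set"
  assumes "prob_space M"
    and "om > 0" and "mu > 0" and "lam + mu > 0"
    and "box a b \<noteq> {}"
    and "\<forall>j. Lp_on 2 (box a b) (\<lambda>y. g y $ j) \<and> compact_support_in (box a b) (\<lambda>y. g y $ j)"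
    and "\<forall>j. (\<forall>y. h j y \<ge> 0) \<and> (\<exists>p. 2 < p \<and> Lp_on p (box a b) (h j))
            \<and> (\<exists>\<eta>. 0 < \<eta> \<and> \<eta> \<le> 1 \<and> holder_on \<eta> (box a b) (h j))
            \<and> compact_support_in (box a b) (h j)"
    and "brownian_sheet2 M W"
    and "open \<Omega>" and "connected \<Omega>" and "bounded \<Omega>"
  shows "\<exists>u. mild_solution M W lam mu om (box a b) g h \<Omega> u \<and>
            (\<forall>v. mild_solution M W lam mu om (box a b) g h \<Omega> v \<longrightarrow>
                 (AE \<omega> in M. \<forall>x\<in>\<Omega>. u x \<omega> = v x \<omega>))"
proof -
  interpret green_setting lam mu om a b
    by unfold_locales (use assms in auto)
  have g: "\<And>j. Lp_on 2 (box a b) (\<lambda>y. g y $ j)" using assms(6) by blast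
  define P where "P j k Y \<longleftrightarrow> (\<forall>x. Y x \<in> borel_measurable M) \<and> (\<forall>\<omega>\<in>space M. continuous_on \<Omega> (\<lambda>x. Y x \<omega>)) \<and>
    (\<forall>x\<in>\<Omega>. \<exists>I. wiener_integral M (W k) (stoch_entry h x j k) I \<and> (AE \<omega> in M. Y x \<omega> = I \<omega>))" for j k Y
  have "\<exists>Y. P j k Y" for j k
  proof -
    obtain \<eta> K where h: "0 < \<eta>" "holder_on \<eta> (box a b) (h k)"
      and K: "compact K" "K \<subseteq> box a b" "\<And>x. x \<notin> K \<Longrightarrow> h k x = 0"
      using assms(7) unfolding compact_support_in_def by metis
    have hc: "continuous_on UNIV (h k)"
      by (rule holder_compact_support_continuous(1)[OF h(2,1) open_box K])
    obtain H where H: "H > 0" "\<And>x. \<bar>h k x\<bar> \<le> H"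
      using holder_compact_support_continuous(2)[OF h(2,1) open_box K] by blast
    obtain B where "planar_sheet M (W k) B" using planar_sheet_component[OF assms(1,8)] by blast
    from stoch_entry_process[of h k H K, OF hc H(2,1) K this assms(11)] show ?thesis
      unfolding P_def .
  qed
  then obtain Y where PY: "\<And>j k. P j k (Y j k)" by metis
  note PYd = PY[unfolded P_def]
  have Y: "\<And>j k x. Y j k x \<in> borel_measurable M"
    "\<And>j k. \<forall>\<omega>\<in>space M. continuous_on \<Omega> (\<lambda>x. Y j k x \<omega>)"
    using PYd[THEN conjunct1] PYd[THEN conjunct2, THEN conjunct1] by blast+
  define Q where "Q j k x I \<longleftrightarrow> wiener_integral M (W k) (stoch_entry h x j k) I \<and> (AE \<omega> in M. Y j k x \<omega> = I \<omega>)" for j k x I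
  define I where "I j k x = (SOME I. Q j k x I)" for j k x
  have QI: "Q j k x (I j k x)" if "x \<in> \<Omega>" for j k x
  proof -
    have "\<exists>I. Q j k x I"
      unfolding Q_def by (rule PYd[THEN conjunct2, THEN conjunct2, THEN bspec, OF that])
    then show ?thesis unfolding I_def by (rule someI_ex)
  qed
  have I: "\<And>j k x. x \<in> \<Omega> \<Longrightarrow> wiener_integral M (W k) (stoch_entry h x j k) (I j k x)"
    "\<And>j k x. x \<in> \<Omega> \<Longrightarrow> AE \<omega> in M. Y j k x \<omega> = I j k x \<omega>"
    by (fact QI[unfolded Q_def, THEN conjunct1] QI[unfolded Q_def, THEN conjunct2])+
  define V where "V x = (LINT y:box a b|lebesgue. G x y *v (\<chi> k. complex_of_real (g y $ k)))" for x
  define u where "u x \<omega> = V x + (\<chi> j. \<Sum>k\<in>UNIV. Y j k x \<omega>)" for x \<omega>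
  have V: "continuous_on \<Omega> V"
    unfolding V_def det_part_eq[OF g]
    by (intro continuous_on_vec_lambda continuous_on_sum det_entry_continuous[OF g] assms(11))
  have uc: "\<forall>\<omega>\<in>space M. continuous_on \<Omega> (\<lambda>x. u x \<omega>)"
    unfolding u_def using Y(2)
    by (intro ballI continuous_on_add V continuous_on_vec_lambda continuous_on_sum) blast
  have um: "u x \<in> borel_measurable M" for x
    by (rule measurable_complex_vec, simp add: u_def)
       (intro borel_measurable_add borel_measurable_const borel_measurable_sum Y(1))
  \<comment> \<open>Stated for arbitrary versions \<open>I'\<close> of the Wiener integrals: it
    shows that \<open>u\<close> is a solution, and it also compares \<open>u\<close> with a solution
    built from other versions.\<close>
  have ae: "AE \<omega> in M. u x \<omega> = V x + (\<chi> j. \<Sum>k\<in>UNIV. I' j k \<omega>)"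
    if x: "x \<in> \<Omega>" and I': "\<And>j k. wiener_integral M (W k) (stoch_entry h x j k) (I' j k)" for x I'
  proof -
    have "AE \<omega> in M. Y j k x \<omega> = I' j k \<omega>" for j k
    proof -
      obtain B where "planar_sheet M (W k) B" using planar_sheet_component[OF assms(1,8)] by blast
      then interpret planar_sheet M "W k" B .
      show ?thesis
        using I(2)[OF x, of j k] wiener_integral_unique[OF I(1)[OF x] I'] by eventually_elim simp
    qed
    then have "AE \<omega> in M. \<forall>j\<in>UNIV. \<forall>k\<in>UNIV. Y j k x \<omega> = I' j k \<omega>"
      by (intro AE_finite_allI) auto
    then show ?thesis by eventually_elim (simp add: u_def)
  qed
  have mild: "mild_solution M W lam mu om (box a b) g h \<Omega> v \<longleftrightarrow>
     (\<forall>x\<in>\<Omega>. v x \<in> borel_measurable M) \<and> (\<forall>\<omega>\<in>space M. continuous_on \<Omega> (\<lambda>x. v x \<omega>)) \<and>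
     (\<forall>x\<in>\<Omega>. \<exists>I :: 2 \<Rightarrow> 2 \<Rightarrow> 'a \<Rightarrow> complex. (\<forall>j k. wiener_integral M (W k) (stoch_entry h x j k) (I j k)) \<and>
        (AE \<omega> in M. v x \<omega> = V x + (\<chi> j. \<Sum>k\<in>UNIV. I j k \<omega>)))" for v
    unfolding mild_solution_def V_def stoch_entry_def[abs_def] ..
  show ?thesis
  proof (intro exI[of _ u] conjI allI impI)
    have "\<exists>I :: 2 \<Rightarrow> 2 \<Rightarrow> 'a \<Rightarrow> complex. (\<forall>j k. wiener_integral M (W k) (stoch_entry h x j k) (I j k)) \<and>
        (AE \<omega> in M. u x \<omega> = V x + (\<chi> j. \<Sum>k\<in>UNIV. I j k \<omega>))" if x: "x \<in> \<Omega>" for x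
      using I(1)[OF x] ae[OF x I(1)[OF x]] by (intro exI[of _ "\<lambda>j k. I j k x"]) simp
    then show "mild_solution M W lam mu om (box a b) g h \<Omega> u"
      unfolding mild using um uc by blast
    fix v assume v: "mild_solution M W lam mu om (box a b) g h \<Omega> v"
    show "AE \<omega> in M. \<forall>x\<in>\<Omega>. u x \<omega> = v x \<omega>"
    proof (rule AE_eq_continuous_fields[OF uc])
      show "\<forall>\<omega>\<in>space M. continuous_on \<Omega> (\<lambda>x. v x \<omega>)" using v unfolding mild by blast
      fix x assume x: "x \<in> \<Omega>"
      then obtain I' :: "2 \<Rightarrow> 2 \<Rightarrow> 'a \<Rightarrow> complex"
        where I': "\<And>j k. wiener_integral M (W k) (stoch_entry h x j k) (I' j k)"
          "AE \<omega> in M. v x \<omega> = V x + (\<chi> j. \<Sum>k\<in>UNIV. I' j k \<omega>)"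
        using v unfolding mild by blast
      show "AE \<omega> in M. u x \<omega> = v x \<omega>"
        using ae[OF x I'(1)] I'(2) by eventually_elim simp
    qed
  qed
qed

end
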